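(* Let $f:\mathbb R^d\to\mathbb R\cup\{\infty\}$ and a family of functions $\{g_a\}_{a>0}$ satisfy the following conditions: (CF1) $f$ is a G-type potential with measure $\mu_f$; (CF2) for each $a>0$, $g_a(z)$ is finite for all $z\in\mathbb R^d\setminus\{0\}$ and $g_a(z)=\int_0^\infty e^{-|z|^2t}\,d\mu_{g_a}(t)$ for some positive measure $\mu_{g_a}$ on $(0,\infty)$; (CF3) if $f^{\pm}(z):=\int_0^\infty e^{-|z|^2t}\,d\mu_f^{\pm}(t)$, then for every $a>0$ both series $\sum_{v\in\mathcal V}f^{\pm}(q+v)g_a(q+v)$ converge absolutely for all $q\notin\mathcal V$; (CF4) $\lim_{a\to0^+}g_a(x)=1$ for all $x\in\mathbb R^d\setminus\{0\}$. Let $(x_j)_{j=1}^N\in(\mathbb R^d)^N$ be a non-degenerate configuration, i.e. $x_i-x_j\notin\mathcal V$ for all $i\neq j$, and write $x_{kj}=x_k-x_j$. Then the $\limsup$ in $$E_{f,1}^{\mathrm p}\big((x_j)_{j=1}^N;\{g_a\}_{a>0}\big):=\limsup_{a\to0^+}\sum_{k\ne j}\left(\sum_{v\in\mathcal V}f(x_{kj}+v)g_a(x_{kj}+v)-\int_0^1\frac{\pi^{d/2}}{t^{d/2}}\,d(\mu_f*\mu_{g_a})(t)\right)$$ is a limit, and $$E_{f,1}^{\mathrm p}\big((x_j)_{j=1}^N;\{g_a\}_{a>0}\big)=\sum_{k\neq j}K_f^{\mathrm p}(x_k,x_j).$$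
   Context: Let $V$ be a real $d\times d$ matrix with linearly independent columns and $\det V=1$; $\mathcal V=\{Vk:k\in\mathbb Z^d\}$; $\mathcal V^*=\{w\in\mathbb R^d: w\cdot v\in\mathbb Z\ \forall v\in\mathcal V\}$. $\mu^\pm$ denote the positive and negative parts of a signed measure $\mu$; $*$ is convolution of measures on $(0,\infty)$ (push-forward of the product under addition); $\int_a^b h\,d\mu$ means integration over $[a,b)$ (over $(0,b)$ if $a=0$ and $\mu$ is a measure on $(0,\infty)$). G-type potential: a lower-semicontinuous $f:\mathbb R^d\to\mathbb R\cup\{\infty\}$ such that for every $q\ne0$, $f(q)$ is finite and $f(q)=\int_0^\infty e^{-|q|^2t}\,d\mu_f(t)$ for some signed measure $\mu_f$ on $(0,\infty)$ with finite negative part, and $f(0)=\mu_f((0,\infty))\in\mathbb R\cup\{\infty\}$. The periodic kernel is $$K_f^{\mathrm p}(x,y)=\sum_{v\in\mathcal V}\int_1^\infty e^{-|x-y+v|^2t}\,d\mu_f(t)+\sum_{w\in\mathcal V^*\setminus\{0\}}e^{2\pi i w\cdot(x-y)}\int_0^1\frac{\pi^{d/2}}{t^{d/2}}e^{-\pi^2|w|^2/t}\,d\mu_f(t).$$ *)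

theory Defs
  imports "HOL-Probability.Probability"
begin

section \<open>Signed measures\<close>

definition signed_measure :: "'a measure \<Rightarrow> ('a set \<Rightarrow> ereal) \<Rightarrow> bool" where
  "signed_measure M \<mu> \<longleftrightarrow>
     \<mu> {} = 0 \<and> (\<infinity> \<notin> \<mu> ` sets M \<or> -\<infinity> \<notin> \<mu> ` sets M) \<and>
     (\<forall>A :: nat \<Rightarrow> 'a set. range A \<subseteq> sets M \<longrightarrow> disjoint_family A \<longrightarrow>
        (\<lambda>n. \<mu> (A n)) sums \<mu> (\<Union>n. A n))"

text \<open>The positive part of the Jordan decomposition is
  \<open>\<mu>\<^sup>+(A) = sup {\<mu>(B) | B \<subseteq> A measurable}\<close>. As \<open>B = {}\<close> is allowed,
  the truncation of negative values by \<^const>\<open>e2ennreal\<close> does not change the supremum.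
  That this is countably additive is proved below.\<close>

definition pos_part :: "'a measure \<Rightarrow> ('a set \<Rightarrow> ereal) \<Rightarrow> 'a measure" where
  "pos_part M \<mu> = measure_of (space M) (sets M)
     (\<lambda>A. \<Squnion>B\<in>{B\<in>sets M. B \<subseteq> A}. e2ennreal (\<mu> B))"

definition neg_part :: "'a measure \<Rightarrow> ('a set \<Rightarrow> ereal) \<Rightarrow> 'a measure" where
  "neg_part M \<mu> = pos_part M (\<lambda>A. - \<mu> A)"

lemma space_pos_part [simp]: "space (pos_part M \<mu>) = space M"
  by (simp add: pos_part_def space_measure_of sets.space_closed)

lemma sets_pos_part [simp]: "sets (pos_part M \<mu>) = sets M"
  by (simp add: pos_part_def sets.space_closed sets.sigma_sets_eq)

lemma space_neg_part [simp]: "space (neg_part M \<mu>) = space M"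
  and sets_neg_part [simp]: "sets (neg_part M \<mu>) = sets M"
  by (simp_all add: neg_part_def)

lemma signed_measure_uminus:
  assumes "signed_measure M \<mu>"
  shows "signed_measure M (\<lambda>A. - \<mu> A)"
proof -
  have "(\<lambda>n. - \<mu> (A n)) sums - \<mu> (\<Union>n. A n)"
    if A: "range A \<subseteq> sets M" "disjoint_family A" for A :: "nat \<Rightarrow> 'a set"
  proof -
    have s: "(\<lambda>n. \<mu> (A n)) sums \<mu> (\<Union>n. A n)"
      using assms A unfolding signed_measure_def by blast
    have neg: "(\<Sum>i<n. - \<mu> (A i)) = - (\<Sum>i<n. \<mu> (A i))" for n
    proof -
      have *: "\<forall>i. \<mu> (A i) \<in> \<mu> ` sets M" using A by auto
      from assms consider "\<infinity> \<notin> \<mu> ` sets M" | "-\<infinity> \<notin> \<mu> ` sets M"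
        unfolding signed_measure_def by blast
      then show ?thesis
      proof cases
        case 1
        then have i: "\<mu> (A i) \<noteq> \<infinity>" for i using * by metis
        have "(\<Sum>i<n. - \<mu> (A i)) = - (\<Sum>i<n. \<mu> (A i)) \<and> (\<Sum>i<n. \<mu> (A i)) \<noteq> \<infinity>"
        proof (induction n)
          case (Suc n)
          then show ?case using i[of n]
            by (cases "\<Sum>i<n. \<mu> (A i)"; cases "\<mu> (A n)") auto
        qed simp
        then show ?thesis by blast
      next
        case 2
        then have i: "\<mu> (A i) \<noteq> -\<infinity>" for i using * by metis
        have "(\<Sum>i<n. - \<mu> (A i)) = - (\<Sum>i<n. \<mu> (A i)) \<and> (\<Sum>i<n. \<mu> (A i)) \<noteq> -\<infinity>"
        proof (induction n)
          case (Suc n)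
          then show ?case using i[of n]
            by (cases "\<Sum>i<n. \<mu> (A i)"; cases "\<mu> (A n)") auto
        qed simp
        then show ?thesis by blast
      qed
    qed
    show ?thesis
      using s unfolding sums_def neg by (intro tendsto_uminus_ereal)
  qed
  moreover have "- \<mu> {} = 0" using assms unfolding signed_measure_def by simp
  moreover have "\<infinity> \<notin> (\<lambda>A. - \<mu> A) ` sets M \<or> -\<infinity> \<notin> (\<lambda>A. - \<mu> A) ` sets M"
  proof -
    have "\<infinity> \<in> \<mu> ` sets M" if "-\<infinity> \<in> (\<lambda>A. - \<mu> A) ` sets M"
      using that by (force simp: image_iff)
    moreover have "-\<infinity> \<in> \<mu> ` sets M" if inf: "\<infinity> \<in> (\<lambda>A. - \<mu> A) ` sets M"
    proof -
      obtain A where A: "A \<in> sets M" "- \<mu> A = \<infinity>" using inf by auto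
      then have "\<mu> A = -\<infinity>" by (cases "\<mu> A") auto
      then show ?thesis using A(1) by (metis imageI)
    qed
    ultimately show ?thesis using assms unfolding signed_measure_def by blast
  qed
  ultimately show ?thesis
    unfolding signed_measure_def by blast
qed

lemma signed_measure_Un:
  assumes \<mu>: "signed_measure M \<mu>" and A: "A \<in> sets M" "B \<in> sets M" "A \<inter> B = {}"
  shows "\<mu> (A \<union> B) = \<mu> A + \<mu> B"
proof -
  have "range (binaryset A B) \<subseteq> sets M"
    using A by (auto simp: range_binaryset_eq)
  moreover have "disjoint_family (binaryset A B)"
    using A by (auto simp: disjoint_family_on_def binaryset_def)
  ultimately have "(\<lambda>n. \<mu> (binaryset A B n)) sums \<mu> (\<Union>n. binaryset A B n)"
    using \<mu> unfolding signed_measure_def by blast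
  moreover have "(\<lambda>n. \<mu> (binaryset A B n)) sums (\<mu> A + \<mu> B)"
    using \<mu> unfolding signed_measure_def by (intro binaryset_sums) auto
  ultimately show ?thesis
    by (simp only: UN_binaryset_eq) (rule sums_unique2)
qed

lemma emeasure_pos_part:
  assumes \<mu>: "signed_measure M \<mu>" and A: "A \<in> sets M"
  shows "emeasure (pos_part M \<mu>) A = (\<Squnion>B\<in>{B\<in>sets M. B \<subseteq> A}. e2ennreal (\<mu> B))"
proof -
  define m where "m A = (\<Squnion>B\<in>{B\<in>sets M. B \<subseteq> A}. e2ennreal (\<mu> B))" for A
  have le_m: "e2ennreal (\<mu> B) \<le> m A" if "B \<in> sets M" "B \<subseteq> A" for A B
    using that unfolding m_def by (auto intro: SUP_upper)
  have emp: "\<mu> {} = 0" using \<mu> unfolding signed_measure_def by blast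
  have m_witness: "\<exists>B\<in>sets M. B \<subseteq> C \<and> 0 \<le> \<mu> B \<and> e2ennreal (\<mu> B) > y" if "y < m C" for y C
  proof -
    obtain B where B: "B \<in> sets M" "B \<subseteq> C" "y < e2ennreal (\<mu> B)"
      using \<open>y < m C\<close> unfolding m_def less_SUP_iff by auto
    moreover have "0 \<le> \<mu> B"
    proof (rule ccontr)
      assume "\<not> 0 \<le> \<mu> B"
      then have "e2ennreal (\<mu> B) = 0" by (simp add: e2ennreal_neg)
      then show False using B(3) by simp
    qed
    ultimately show ?thesis by blast
  qed
  have m_mono: "m C \<le> m D" if "C \<subseteq> D" for C D
    unfolding m_def using that by (intro SUP_subset_mono) auto
  have m_eq: "m C = (\<Squnion>B\<in>{B\<in>sets M. B \<subseteq> C \<and> 0 \<le> \<mu> B}. e2ennreal (\<mu> B))" for C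
  proof (rule antisym)
    show "m C \<le> (\<Squnion>B\<in>{B\<in>sets M. B \<subseteq> C \<and> 0 \<le> \<mu> B}. e2ennreal (\<mu> B))"
    proof (rule ccontr)
      assume "\<not> ?thesis"
      then obtain B where "B \<in> sets M" "B \<subseteq> C" "0 \<le> \<mu> B"
        "e2ennreal (\<mu> B) > (\<Squnion>B\<in>{B\<in>sets M. B \<subseteq> C \<and> 0 \<le> \<mu> B}. e2ennreal (\<mu> B))"
        using m_witness by (meson not_le)
      then show False
        by (metis (mono_tags, lifting) SUP_upper mem_Collect_eq not_le)
    qed
    show "(\<Squnion>B\<in>{B\<in>sets M. B \<subseteq> C \<and> 0 \<le> \<mu> B}. e2ennreal (\<mu> B)) \<le> m C"
      unfolding m_def by (intro SUP_subset_mono) auto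
  qed
  have m_Un: "m C + m D \<le> m (C \<union> D)" if "C \<inter> D = {}" for C D
  proof -
    let ?S = "\<lambda>C. {B\<in>sets M. B \<subseteq> C \<and> 0 \<le> \<mu> B}"
    have ne: "?S X \<noteq> {}" for X using emp by (auto intro!: exI[of _ "{}"])
    have 1: "e2ennreal (\<mu> B) + e2ennreal (\<mu> B') \<le> m (C \<union> D)"
      if "B \<in> ?S C" "B' \<in> ?S D" for B B'
    proof -
      have "\<mu> (B \<union> B') = \<mu> B + \<mu> B'"
        using that \<open>C \<inter> D = {}\<close> by (intro signed_measure_Un[OF \<mu>]) auto
      then have "e2ennreal (\<mu> B) + e2ennreal (\<mu> B') = e2ennreal (\<mu> (B \<union> B'))"
        using that by (simp add: plus_ennreal.abs_eq eq_onp_def)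
      also have "\<dots> \<le> m (C \<union> D)" using that by (intro le_m) auto
      finally show ?thesis .
    qed
    have 2: "e2ennreal (\<mu> B) + m D \<le> m (C \<union> D)" if B: "B \<in> ?S C" for B
    proof -
      have "e2ennreal (\<mu> B) + m D = (\<Squnion>B'\<in>?S D. e2ennreal (\<mu> B) + e2ennreal (\<mu> B'))"
        unfolding m_eq[of D] by (rule ennreal_SUP_add_right[OF ne])
      also have "\<dots> \<le> m (C \<union> D)" using 1[OF B] by (intro SUP_least) auto
      finally show ?thesis .
    qed
    have "m C + m D = (\<Squnion>B\<in>?S C. e2ennreal (\<mu> B) + m D)"
      unfolding m_eq[of C] by (rule ennreal_SUP_add_left[symmetric, OF ne])
    also have "\<dots> \<le> m (C \<union> D)" using 2 by (intro SUP_least) auto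
    finally show ?thesis .
  qed
  have m_empty: "m {} = 0"
    unfolding m_def using emp by (auto simp: e2ennreal_neg intro!: SUP_eq_const)
  have ca: "countably_additive (sets M) m"
  proof (rule countably_additiveI)
    fix A :: "nat \<Rightarrow> 'a set"
    assume A: "range A \<subseteq> sets M" "disjoint_family A" "(\<Union>i. A i) \<in> sets M"
    show "(\<Sum>i. m (A i)) = m (\<Union>i. A i)"
    proof (rule antisym)
      have fin: "(\<Sum>i<n. m (A i)) \<le> m (\<Union>i<n. A i)" for n
      proof (induction n)
        case (Suc n)
        have "(\<Sum>i<Suc n. m (A i)) \<le> m (\<Union>i<n. A i) + m (A n)"
          using Suc by (simp add: add_right_mono)
        also have "\<dots> \<le> m ((\<Union>i<n. A i) \<union> A n)"
        proof (rule m_Un)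
          have "A i \<inter> A n = {}" if "i < n" for i
            using A(2) that by (intro disjoint_family_onD) auto
          then show "(\<Union>i<n. A i) \<inter> A n = {}" by blast
        qed
        also have "(\<Union>i<n. A i) \<union> A n = (\<Union>i<Suc n. A i)"
          by (auto simp: less_Suc_eq)
        finally show ?case .
      qed (simp add: m_empty)
      have "(\<Sum>i<n. m (A i)) \<le> m (\<Union>i. A i)" for n
        using fin[of n] by (rule order_trans) (intro m_mono; auto)
      then show "(\<Sum>i. m (A i)) \<le> m (\<Union>i. A i)"
        by (intro suminf_le_const summableI)
    next
      have "e2ennreal (\<mu> B) \<le> (\<Sum>i. m (A i))" if B: "B \<in> sets M" "B \<subseteq> (\<Union>i. A i)" for B
      proof -
        have "range (\<lambda>n. B \<inter> A n) \<subseteq> sets M" using A B by auto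
        moreover have "disjoint_family (\<lambda>n. B \<inter> A n)"
          using A(2) unfolding disjoint_family_on_def by blast
        ultimately have "(\<lambda>n. \<mu> (B \<inter> A n)) sums \<mu> (\<Union>n. B \<inter> A n)"
          using \<mu> unfolding signed_measure_def by blast
        also have "(\<Union>n. B \<inter> A n) = B" using B by auto
        finally have lim: "(\<lambda>n. \<Sum>i<n. \<mu> (B \<inter> A i)) \<longlonglongrightarrow> \<mu> B"
          unfolding sums_def .
        have "(\<Sum>i<n. \<mu> (B \<inter> A i)) \<le> enn2ereal (\<Sum>i. m (A i))" for n
        proof -
          have "(\<Sum>i<n. \<mu> (B \<inter> A i)) \<le> (\<Sum>i<n. enn2ereal (m (A i)))"
          proof (rule sum_mono)
            fix i
            have "e2ennreal (\<mu> (B \<inter> A i)) \<le> m (A i)"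
              using A B by (intro le_m) auto
            then have le: "enn2ereal (e2ennreal (\<mu> (B \<inter> A i))) \<le> enn2ereal (m (A i))"
              by (simp add: less_eq_ennreal.rep_eq)
            show "\<mu> (B \<inter> A i) \<le> enn2ereal (m (A i))"
            proof (cases "0 \<le> \<mu> (B \<inter> A i)")
              case True
              then show ?thesis using le by (simp only: enn2ereal_e2ennreal)
            next
              case False
              then show ?thesis using enn2ereal_nonneg[of "m (A i)"] by (meson linear order_trans)
            qed
          qed
          also have "\<dots> = enn2ereal (\<Sum>i<n. m (A i))"
            by (induction n) (auto simp: plus_ennreal.rep_eq zero_ennreal.rep_eq)
          also have "\<dots> \<le> enn2ereal (\<Sum>i. m (A i))"
            unfolding less_eq_ennreal.rep_eq[symmetric] by (intro sum_le_suminf) auto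
          finally show ?thesis .
        qed
        then have "\<mu> B \<le> enn2ereal (\<Sum>i. m (A i))"
          by (intro LIMSEQ_le_const2[OF lim]) auto
        then have "e2ennreal (\<mu> B) \<le> e2ennreal (enn2ereal (\<Sum>i. m (A i)))"
          by (rule e2ennreal_mono)
        then show ?thesis by simp
      qed
      then show "m (\<Union>i. A i) \<le> (\<Sum>i. m (A i))"
        unfolding m_def[of "\<Union>i. A i"] by (intro SUP_least) auto
    qed
  qed
  have "emeasure (measure_of (space M) (sets M) m) A = m A"
  proof (rule emeasure_measure_of_sigma)
    show "sigma_algebra (space M) (sets M)" by (rule sets.sigma_algebra_axioms)
    show "positive (sets M) m" using m_empty by (simp add: positive_def)
  qed (fact ca A)+
  moreover have "m = (\<lambda>A. \<Squnion>B\<in>{B\<in>sets M. B \<subseteq> A}. e2ennreal (\<mu> B))"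
    by (rule ext) (rule m_def)
  ultimately show ?thesis
    unfolding pos_part_def by (simp only:)
qed

text \<open>\<open>\<integral>\<^sub>A h d\<mu>\<close> and \<open>\<integral>\<^sub>A h d(\<mu> * \<nu>)\<close> for a signed measure \<open>\<mu>\<close> and a positive measure \<open>\<nu>\<close>.
  The signed set function \<open>\<mu> * \<nu>\<close> may be \<open>\<infinity> - \<infinity>\<close> on unbounded sets, hence
  the second integral is the difference of those against \<open>\<mu>\<^sup>+ * \<nu>\<close> and \<open>\<mu>\<^sup>- * \<nu>\<close>.\<close>

definition signed_lint :: "'a measure \<Rightarrow> ('a set \<Rightarrow> ereal) \<Rightarrow> 'a set \<Rightarrow> ('a \<Rightarrow> real) \<Rightarrow> real" where
  "signed_lint M \<mu> A h = (LINT t:A|pos_part M \<mu>. h t) - (LINT t:A|neg_part M \<mu>. h t)"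

definition signed_conv_lint ::
    "real measure \<Rightarrow> (real set \<Rightarrow> ereal) \<Rightarrow> real measure \<Rightarrow> real set \<Rightarrow> (real \<Rightarrow> real) \<Rightarrow> real" where
  "signed_conv_lint M \<mu> \<nu> A h =
     (LINT t:A|convolution (pos_part M \<mu>) \<nu>. h t) - (LINT t:A|convolution (neg_part M \<mu>) \<nu>. h t)"


section \<open>G-type potentials\<close>

abbreviation half_line :: "real measure" where
  "half_line \<equiv> restrict_space borel {0<..}"

definition gauss_transform :: "real measure \<Rightarrow> 'a::real_normed_vector \<Rightarrow> ennreal" where
  "gauss_transform M z = (\<integral>\<^sup>+t. ennreal (exp (- ((norm z)\<^sup>2 * t))) \<partial>M)"

definition lower_semicont :: "('a::topological_space \<Rightarrow> ereal) \<Rightarrow> bool" where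
  "lower_semicont f \<longleftrightarrow> (\<forall>x. f x \<le> Liminf (at x) f)"

definition G_type :: "(real ^ 'n \<Rightarrow> ereal) \<Rightarrow> (real set \<Rightarrow> ereal) \<Rightarrow> bool" where
  "G_type f \<mu> \<longleftrightarrow>
     (\<forall>q. f q \<noteq> -\<infinity>) \<and> lower_semicont f \<and>
     signed_measure half_line \<mu> \<and> emeasure (neg_part half_line \<mu>) {0<..} < \<infinity> \<and>
     (\<forall>q. q \<noteq> 0 \<longrightarrow> f q < \<infinity> \<and>
        f q = enn2ereal (gauss_transform (pos_part half_line \<mu>) q)
              - enn2ereal (gauss_transform (neg_part half_line \<mu>) q)) \<and>
     f 0 = \<mu> {0<..}"


section \<open>Lattices, periodic kernel and energy\<close>

definition lattice_of :: "real ^ 'n ^ 'n \<Rightarrow> (real ^ 'n) set" where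
  "lattice_of V = {V *v k | k. \<forall>i. k $ i \<in> \<int>}"

definition dual_lattice :: "real ^ 'n ^ 'n \<Rightarrow> (real ^ 'n) set" where
  "dual_lattice V = {w. \<forall>v\<in>lattice_of V. w \<bullet> v \<in> \<int>}"

definition periodic_kernel ::
    "real ^ 'n ^ 'n \<Rightarrow> (real set \<Rightarrow> ereal) \<Rightarrow> real ^ 'n \<Rightarrow> real ^ 'n \<Rightarrow> complex" where
  "periodic_kernel V \<mu> x y =
     of_real (\<Sum>\<^sub>\<infinity>v\<in>lattice_of V. signed_lint half_line \<mu> {1..} (\<lambda>t. exp (- ((norm (x - y + v))\<^sup>2 * t))))
     + (\<Sum>\<^sub>\<infinity>w\<in>dual_lattice V - {0}. exp (2 * of_real pi * \<i> * of_real (w \<bullet> (x - y))) *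
          of_real (signed_lint half_line \<mu> {0<..<1}
            (\<lambda>t. pi powr (CARD('n) / 2) / t powr (CARD('n) / 2) * exp (- (pi\<^sup>2 * (norm w)\<^sup>2 / t)))))"

text \<open>For non-degenerate configurations all arguments \<open>x\<^sub>k - x\<^sub>j + v\<close> are nonzero, so
  \<^const>\<open>real_of_ereal\<close> is only applied to finite values.\<close>

definition regularized_energy ::
    "real ^ 'n ^ 'n \<Rightarrow> (real ^ 'n \<Rightarrow> ereal) \<Rightarrow> (real set \<Rightarrow> ereal) \<Rightarrow>
     (real ^ 'n \<Rightarrow> ereal) \<Rightarrow> real measure \<Rightarrow> nat \<Rightarrow> (nat \<Rightarrow> real ^ 'n) \<Rightarrow> real" where
  "regularized_energy V f \<mu> g \<nu> N x =
     (\<Sum>k=1..N. \<Sum>j\<in>{1..N} - {k}.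
        (\<Sum>\<^sub>\<infinity>v\<in>lattice_of V. real_of_ereal (f (x k - x j + v) * g (x k - x j + v)))
        - signed_conv_lint half_line \<mu> \<nu> {0<..<1} (\<lambda>t. pi powr (CARD('n) / 2) / t powr (CARD('n) / 2)))"

definition periodic_energy ::
    "real ^ 'n ^ 'n \<Rightarrow> (real ^ 'n \<Rightarrow> ereal) \<Rightarrow> (real set \<Rightarrow> ereal) \<Rightarrow>
     (real \<Rightarrow> real ^ 'n \<Rightarrow> ereal) \<Rightarrow> (real \<Rightarrow> real measure) \<Rightarrow> nat \<Rightarrow> (nat \<Rightarrow> real ^ 'n) \<Rightarrow> ereal" where
  "periodic_energy V f \<mu> g \<nu> N x =
     Limsup (at_right 0) (\<lambda>a. ereal (regularized_energy V f \<mu> (g a) (\<nu> a) N x))"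

end

theory Submission
  imports Defs
begin

text \<open>
  Fix a pair and let \<open>q\<close> be the difference of its points. Let \<open>\<Theta>(t) = \<Sum>\<^sub>v exp (- |q + v|\<^sup>2 t)\<close>,
  \<open>h(t) = (\<pi>/t)\<^bsup>d/2\<^esup>\<close> and \<open>G = \<Theta> - 1\<^bsub>(0,1)\<^esub> h\<close>. If \<open>\<mu>\<close> is one of \<open>\<mu>\<^sub>f\<^sup>+\<close>, \<open>\<mu>\<^sub>f\<^sup>-\<close> and
  \<open>\<nu>\<^sub>a\<close> is the measure of \<open>g\<^sub>a\<close>, the contribution of \<open>\<mu>\<close> to the regularized energy of the pair is
  \<open>\<integral> G d(\<mu> * \<nu>\<^sub>a)\<close>. By Poisson summation \<open>\<Theta>(t) = h(t) \<Sum>\<^sub>w exp (2\<pi>i w \<cdot> q) exp (- \<pi>\<^sup>2 |w|\<^sup>2 / t)\<close> with \<open>w\<close> in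
  the dual lattice, and subtracting \<open>h\<close> on \<open>(0,1)\<close> removes exactly the term \<open>w = 0\<close>. Therefore
  \<open>|G(t)| \<le> C exp (- c t)\<close> for some \<open>c > 0\<close>, and \<open>\<integral> G d\<mu>\<close> is the contribution of \<open>\<mu>\<close> to the periodic
  kernel. Since \<open>g\<^sub>a \<rightarrow> 1\<close>, the measures \<open>\<nu>\<^sub>a\<close> tend to the Dirac mass at \<open>0\<close> when tested against functions
  bounded by \<open>exp (- c t)\<close>. The only jump of \<open>G\<close>, at \<open>t = 1\<close>, is harmless because \<open>G\<close> is continuous
  from the right and \<open>\<nu>\<^sub>a\<close> lives on \<open>(0,\<infinity>)\<close>; so \<open>\<integral> G d(\<mu> * \<nu>\<^sub>a) \<rightarrow> \<integral> G d\<mu>\<close>.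
\<close>

section \<open>Sums as integrals over counting measures\<close>

text \<open>The two parts of \<open>G\<close> cannot be treated separately: \<Theta> and
  \<open>h\<close> both blow up like t to the power -d/2 at 0, while \<mu> is only known to make exp
  (- c t) integrable for every c > 0. For fixed a, (CF3) makes \<Theta> integrable against the
  convolution of \<mu> and \<open>\<nu> a\<close>; on (0,1) the function \<open>h\<close> is then
  the difference of the integrable functions \<Theta> and \<open>G\<close>. Convergence of
  \<open>g a\<close> at z \<noteq> 0 is convergence of the Laplace transform of
  \<open>\<nu> a\<close> at |z|^2. At the value 0 nothing is given, and the total masses may be
  infinite, which is why test functions must decay exponentially. The rate c is a lower bound for
  the squared distance from q to the lattice points, positive because q is not one of them (up to
  sign). Poisson summation is obtained from Abel means, whose kernel is nonnegative and a product of
  one-dimensional geometric series. Lattice sums are Bochner integrals over counting measures on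
  integer vectors, so that exchanging a sum with an integral is Fubini and passing to a limit under
  a sum is dominated convergence.\<close>

lemma borel_measurable_cis [measurable]: "cis \<in> borel_measurable borel"
  by (intro borel_measurable_continuous_onI continuous_on_cis continuous_on_id)

text \<open>A non-integrable \<open>f\<close> has integral 0 by convention; in that case only
  nonnegativity of the right side remains to be checked.\<close>

lemma norm_integral_le:
  fixes f :: "'a \<Rightarrow> 'b::{banach, second_countable_topology}"
  assumes g: "integrable M g" and le: "\<And>x. x \<in> space M \<Longrightarrow> norm (f x) \<le> g x"
  shows "norm (\<integral>x. f x \<partial>M) \<le> (\<integral>x. g x \<partial>M)"
proof (cases "integrable M f")
  case True
  then show ?thesis
    using g le by (intro order_trans[OF integral_norm_bound] integral_mono) auto
next
  case False
  have "0 \<le> (\<integral>x. g x \<partial>M)"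
    using le order_trans[OF norm_ge_zero] by (intro Bochner_Integration.integral_nonneg) blast
  with False show ?thesis by (simp add: not_integrable_integral_eq)
qed

text \<open>Fubini for the product of a counting measure with \<open>M\<close>. Countability of the
  index type provides joint measurability and sigma-finiteness of the counting measure. The last
  conclusion, summability of the norms, lets a second interchange start from the result of the
  first.\<close>

lemma (in sigma_finite_measure) integral_count_space_swap:
  fixes f :: "'k::countable \<Rightarrow> 'a \<Rightarrow> 'b::{banach, second_countable_topology}"
  assumes f[measurable]: "\<And>i. f i \<in> borel_measurable M"
    and fin: "(\<integral>\<^sup>+x. \<integral>\<^sup>+i. ennreal (norm (f i x)) \<partial>count_space UNIV \<partial>M) < \<infinity>"
  shows "integrable M (\<lambda>x. \<integral>i. f i x \<partial>count_space UNIV)"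
    and "integrable M (f i)"
    and "integrable (count_space UNIV) (\<lambda>i. \<integral>x. f i x \<partial>M)"
    and "(\<integral>x. \<integral>i. f i x \<partial>count_space UNIV \<partial>M) = (\<integral>i. \<integral>x. f i x \<partial>M \<partial>count_space UNIV)"
    and "integrable (count_space UNIV) (\<lambda>i. \<integral>x. norm (f i x) \<partial>M)"
proof -
  interpret C: sigma_finite_measure "count_space (UNIV :: 'k set)"
    by (rule sigma_finite_measure_count_space)
  interpret P: pair_sigma_finite "count_space (UNIV :: 'k set)" M ..
  have m: "(\<lambda>(i, x). f i x) \<in> borel_measurable (count_space UNIV \<Otimes>\<^sub>M M)"
    by (intro measurable_pair_measure_countable1) auto
  have "(\<integral>\<^sup>+p. ennreal (norm (case_prod f p)) \<partial>(count_space UNIV \<Otimes>\<^sub>M M)) < \<infinity>"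
    using fin m by (subst P.nn_integral_snd[symmetric]) auto
  then have int: "integrable (count_space UNIV \<Otimes>\<^sub>M M) (case_prod f)"
    using m by (intro integrableI_bounded) auto
  show "integrable M (\<lambda>x. \<integral>i. f i x \<partial>count_space UNIV)"
    using P.integrable_snd[OF int] .
  show "integrable (count_space UNIV) (\<lambda>i. \<integral>x. f i x \<partial>M)"
    using P.integrable_fst[OF int] .
  show "(\<integral>x. \<integral>i. f i x \<partial>count_space UNIV \<partial>M) = (\<integral>i. \<integral>x. f i x \<partial>M \<partial>count_space UNIV)"
    using P.Fubini_integral[OF int] .
  show "integrable M (f i)"
    using P.AE_integrable_fst[OF int] by (simp add: AE_count_space)
  show "integrable (count_space UNIV) (\<lambda>i. \<integral>x. norm (f i x) \<partial>M)"
    using P.integrable_fst'[OF integrable_norm[OF int]] by simp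
qed

text \<open>Tonelli: the finiteness demanded by \<open>integral_count_space_swap\<close> can be
  checked with the sum outside.\<close>

lemma (in sigma_finite_measure) integral_count_space_swapI:
  fixes f :: "'k::countable \<Rightarrow> 'a \<Rightarrow> 'b::{banach, second_countable_topology}"
  assumes f[measurable]: "\<And>i. f i \<in> borel_measurable M"
    and int: "\<And>i. integrable M (f i)"
    and sum: "integrable (count_space UNIV) (\<lambda>i. \<integral>x. norm (f i x) \<partial>M)"
  shows "(\<integral>\<^sup>+x. \<integral>\<^sup>+i. ennreal (norm (f i x)) \<partial>count_space UNIV \<partial>M) < \<infinity>"
proof -
  have "(\<integral>\<^sup>+x. \<integral>\<^sup>+i. ennreal (norm (f i x)) \<partial>count_space UNIV \<partial>M)
      = (\<integral>\<^sup>+i. \<integral>\<^sup>+x. ennreal (norm (f i x)) \<partial>M \<partial>count_space UNIV)"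
    by (rule nn_integral_count_space_nn_integral) auto
  also have "\<dots> = (\<integral>\<^sup>+i. ennreal (\<integral>x. norm (f i x) \<partial>M) \<partial>count_space UNIV)"
    using int by (intro nn_integral_cong nn_integral_eq_integral) auto
  also have "\<dots> = ennreal (\<integral>i. \<integral>x. norm (f i x) \<partial>M \<partial>count_space UNIV)"
    using sum by (intro nn_integral_eq_integral) auto
  finally show ?thesis by simp
qed

text \<open>A sum over integer vectors of a product of one-variable terms factorizes; this reduces
  lattice sums to geometric series.\<close>

lemma prod_count_space:
  fixes f :: "'n::finite \<Rightarrow> int \<Rightarrow> 'b::{real_normed_field, banach, second_countable_topology}"
  assumes "\<And>i. integrable (count_space UNIV) (f i)"
  shows "integrable (count_space UNIV) (\<lambda>k. \<Prod>i\<in>UNIV. f i (k i))"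
    and "(\<integral>k. (\<Prod>i\<in>UNIV. f i (k i)) \<partial>count_space UNIV) = (\<Prod>i\<in>UNIV. \<integral>m. f i m \<partial>count_space UNIV)"
  using abs_summable_on_prod_PiE[of UNIV "\<lambda>_. UNIV" f] infsetsum_prod_PiE[of UNIV "\<lambda>_. UNIV" f] assms
  by (simp_all add: abs_summable_on_def infsetsum_def PiE_UNIV_domain)

section \<open>The Abel--Poisson kernel\<close>

text \<open>Nonnegative m contribute a geometric series in z, negative m one in the conjugate of z;
  the latter starts at exponent 1, whence its numerator.\<close>

lemma has_bochner_integral_int_powabs_cis:
  fixes r t :: real
  assumes r: "0 \<le> r" "r < 1"
  defines "z \<equiv> complex_of_real r * cis t"
  shows "has_bochner_integral (count_space UNIV)
     (\<lambda>m::int. complex_of_real (r ^ nat \<bar>m\<bar>) * cis (of_int m * t)) (1 / (1 - z) + cnj z / (1 - cnj z))"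
proof -
  let ?f = "\<lambda>m::int. complex_of_real (r ^ nat \<bar>m\<bar>) * cis (of_int m * t)"
  have nz: "norm z < 1" "norm (cnj z) < 1" using r by (auto simp: z_def norm_mult)
  have U: "UNIV = range int \<union> range (\<lambda>n. - int (Suc n))"
  proof -
    have "m \<in> range int \<union> range (\<lambda>n. - int (Suc n))" for m by (cases m) auto
    then show ?thesis by blast
  qed
  have D: "range int \<inter> range (\<lambda>n. - int (Suc n)) = {}"
    by (auto simp del: of_nat_Suc)
  have inj: "inj int" "inj (\<lambda>n. - int (Suc n))" by (auto simp: inj_on_def)
  have f1: "?f (int n) = z ^ n" for n
    unfolding z_def power_mult_distrib by (simp add: Complex.DeMoivre)
  have f2: "?f (- int (Suc n)) = cnj z * cnj z ^ n" for n
  proof -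
    have "cnj z * cnj z ^ n = cnj (z ^ Suc n)" by simp
    also have "\<dots> = ?f (- int (Suc n))"
      unfolding z_def power_mult_distrib Complex.DeMoivre by (simp add: cis_cnj del: of_nat_Suc power_Suc)
    finally show ?thesis ..
  qed
  have s1: "Infinite_Set_Sum.abs_summable_on ?f (range int)"
    unfolding abs_summable_on_reindex_iff[OF inj(1), symmetric] o_def f1
    using summable_geometric[of "norm z"] nz
    by (simp add: f1 abs_summable_on_nat_iff' norm_power)
  have s2: "Infinite_Set_Sum.abs_summable_on ?f (range (\<lambda>n. - int (Suc n)))"
    unfolding abs_summable_on_reindex_iff[OF inj(2), symmetric] o_def f2
    using summable_geometric[of "norm (cnj z)"] nz
    by (simp add: abs_summable_on_nat_iff' norm_power norm_mult)
  have i1: "infsetsum ?f (range int) = 1 / (1 - z)"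
    unfolding infsetsum_reindex[OF inj(1)] o_def f1
    using summable_geometric[of "norm z"] suminf_geometric nz
    by (subst infsetsum_nat') (simp_all add: abs_summable_on_nat_iff' norm_power)
  have i2: "infsetsum ?f (range (\<lambda>n. - int (Suc n))) = cnj z / (1 - cnj z)"
    unfolding infsetsum_reindex[OF inj(2)] o_def f2
    using summable_geometric[of "norm (cnj z)"] suminf_geometric[of "cnj z"] nz
    by (subst infsetsum_nat') (simp_all add: abs_summable_on_nat_iff' norm_power norm_mult suminf_mult summable_geometric)
  have "Infinite_Set_Sum.abs_summable_on ?f UNIV"
    unfolding U using s1 s2 by (rule abs_summable_on_union)
  moreover have "infsetsum ?f UNIV = 1 / (1 - z) + cnj z / (1 - cnj z)"
    unfolding U using infsetsum_Un_disjoint[OF s1 s2 D] i1 i2 by simp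
  ultimately show ?thesis
    by (simp add: abs_summable_on_def infsetsum_def has_bochner_integral_iff)
qed

lemma integrable_int_powabs:
  fixes r :: real
  assumes r: "0 \<le> r" "r < 1"
  shows "integrable (count_space UNIV) (\<lambda>m::int. r ^ nat \<bar>m\<bar>)"
proof -
  have "integrable (count_space UNIV) (\<lambda>m::int. norm (complex_of_real (r ^ nat \<bar>m\<bar>) * cis (of_int m * 0)))"
    by (intro integrable_norm has_bochner_integral_int_powabs_cis[THEN integrable.intros] r)
  then show ?thesis using r by (simp add: norm_power)
qed

text \<open>The denominator is \<open>|1 - r exp (2\<pi>it)|\<^sup>2\<close>, arranged as a sum of nonnegative terms.\<close>

definition abel :: "real \<Rightarrow> real \<Rightarrow> real" where
  "abel r t = (1 - r\<^sup>2) / ((1 - r)\<^sup>2 + 2 * r * (1 - cos (2 * pi * t)))"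

text \<open>Over a common denominator the two geometric sums give (1 - |z|^2) / |1 - z|^2. The minus
  sign in the phase is the one of the Fourier transform used later.\<close>

lemma abel_series:
  assumes r: "0 \<le> r" "r < 1"
  shows "has_bochner_integral (count_space UNIV)
    (\<lambda>m::int. complex_of_real (r ^ nat \<bar>m\<bar>) * cis (of_int m * (- (2 * pi * t)))) (complex_of_real (abel r t))"
proof -
  define z where "z = complex_of_real r * cis (- (2 * pi * t))"
  have nz: "norm z < 1" using r by (simp add: z_def norm_mult)
  then have ne: "1 - z \<noteq> 0" "1 - cnj z \<noteq> 0" by auto
  have zz: "z * cnj z = complex_of_real (r\<^sup>2)"
    unfolding complex_norm_square[symmetric] using r by (simp add: z_def norm_mult)
  have s: "z + cnj z = complex_of_real (2 * r * cos (2 * pi * t))"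
    by (simp add: z_def complex_eq_iff)
  have d: "(1 - z) * (1 - cnj z) = complex_of_real ((1 - r)\<^sup>2 + 2 * r * (1 - cos (2 * pi * t)))"
  proof -
    have "(1 - z) * (1 - cnj z) = 1 - (z + cnj z) + z * cnj z" by (simp add: algebra_simps)
    also have "\<dots> = complex_of_real ((1 - r)\<^sup>2 + 2 * r * (1 - cos (2 * pi * t)))"
      unfolding s zz by (simp add: power2_eq_square algebra_simps)
    finally show ?thesis .
  qed
  have "1 / (1 - z) + cnj z / (1 - cnj z) = (1 - z * cnj z) / ((1 - z) * (1 - cnj z))"
    using ne by (simp add: field_simps)
  also have "\<dots> = complex_of_real (abel r t)"
    unfolding d zz by (simp add: abel_def)
  finally show ?thesis
    using has_bochner_integral_int_powabs_cis[OF r, of "- (2 * pi * t)"] unfolding z_def by simp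
qed

lemma abel_nonneg: "0 \<le> r \<Longrightarrow> r < 1 \<Longrightarrow> 0 \<le> abel r t"
  unfolding abel_def
  by (intro divide_nonneg_nonneg add_nonneg_nonneg mult_nonneg_nonneg)
     (auto simp: power_le_one_iff abs_square_le_1)

lemma abel_measurable [measurable]: "abel r \<in> borel_measurable borel"
  unfolding abel_def by measurable

lemma abel_add_int: "abel r (t + of_int m) = abel r t"
proof -
  have "cos (2 * pi * (t + of_int m)) = cos (2 * pi * t)"
    by (simp add: distrib_left cos_add)
  then show ?thesis by (simp add: abel_def)
qed

text \<open>Dropping (1 - r)^2 from the denominator leaves a bound that is uniform in t away from 0
  and, for fixed \<delta>, tends to 0 as r tends to 1.\<close>

lemma abel_le:
  assumes r: "0 < r" "r < 1" and t: "0 < \<delta>" "\<delta> \<le> \<bar>t\<bar>" "\<bar>t\<bar> \<le> 1/2"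
  shows "abel r t \<le> (1 - r\<^sup>2) / (2 * r * (1 - cos (2 * pi * \<delta>)))"
proof -
  have c: "cos (2 * pi * t) \<le> cos (2 * pi * \<delta>)"
  proof -
    have "cos (2 * pi * \<bar>t\<bar>) \<le> cos (2 * pi * \<delta>)"
      using t by (intro cos_monotone_0_pi_le) auto
    then show ?thesis by (simp add: abs_if split: if_splits)
  qed
  have c1: "cos (2 * pi * \<delta>) < cos 0"
    using t by (intro cos_monotone_0_pi) auto
  have "2 * r * (1 - cos (2 * pi * \<delta>)) \<le> 2 * r * (1 - cos (2 * pi * t))"
    using r c by (intro mult_left_mono) auto
  also have "\<dots> \<le> (1 - r)\<^sup>2 + 2 * r * (1 - cos (2 * pi * t))" by simp
  finally have le: "2 * r * (1 - cos (2 * pi * \<delta>)) \<le> (1 - r)\<^sup>2 + 2 * r * (1 - cos (2 * pi * t))" .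
  have pos: "0 < 2 * r * (1 - cos (2 * pi * \<delta>))"
    using r c1 by simp
  have "0 \<le> 1 - r\<^sup>2" using r by (simp add: power_le_one_iff)
  then show ?thesis
    unfolding abel_def using order_less_le_trans[OF pos le] le pos by (intro divide_left_mono mult_pos_pos[OF order_less_le_trans[OF pos le] pos])
qed

text \<open>Orthogonality of the characters on a period. The interval is half-open because its
  integer translates must tile the line.\<close>

lemma integral_cis_unit_interval:
  "has_bochner_integral lborel (\<lambda>t. indicator {-1/2..<1/2} t *\<^sub>R cis (of_int m * (- (2 * pi * t)))) (if m = 0 then 1 else 0)"
proof (cases "m = 0")
  case True
  have "has_bochner_integral lborel (\<lambda>t. indicator {-1/2..<1/2::real} t *\<^sub>R (1::complex)) (measure lborel {-1/2..<1/2::real} *\<^sub>R 1)"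
    by (rule has_bochner_integral_scaleR_left, rule has_bochner_integral_real_indicator) auto
  with True show ?thesis by simp
next
  case False
  define c where "c = complex_of_real (- (2 * pi * of_int m)) * \<i>"
  have "c \<noteq> 0" using False by (simp add: c_def)
  have e: "cis (of_int m * (- (2 * pi * t))) = exp (c * complex_of_real t)" for t
    by (simp add: c_def cis_conv_exp mult_ac)
  define F where "F t = exp (c * complex_of_real t) / c" for t :: real
  have "has_bochner_integral lborel (\<lambda>t. indicator {-1/2..1/2} t *\<^sub>R cis (of_int m * (- (2 * pi * t)))) (F (1/2) - F (-1/2))"
    unfolding e
  proof (rule has_bochner_integral_FTC_Icc)
    show "(F has_vector_derivative exp (c * complex_of_real t)) (at t within {- 1 / 2..1 / 2})" for t
      unfolding F_def using \<open>c \<noteq> 0\<close>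
      by (intro has_vector_derivative_real_field) (auto intro!: derivative_eq_intros)
  qed (auto intro!: continuous_intros)
  moreover have "F (1/2) = F (-1/2)"
  proof -
    have "exp (c * complex_of_real (-1/2)) = exp (c * complex_of_real (1/2)) * cis (2 * pi * of_int m)"
      by (simp add: c_def cis_conv_exp flip: exp_add) (simp add: algebra_simps)
    also have "cis (2 * pi * of_int m) = 1" by (rule cis_multiple_2pi) auto
    finally show ?thesis by (simp add: F_def)
  qed
  ultimately have "has_bochner_integral lborel (\<lambda>t. indicator {-1/2..1/2} t *\<^sub>R cis (of_int m * (- (2 * pi * t)))) 0"
    by simp
  \<comment> \<open>The fundamental theorem of calculus yields the closed interval; removing the
    endpoint 1/2 changes a null set.\<close>
  moreover have "AE t in lborel. indicator {-1/2..1/2} t *\<^sub>R cis (of_int m * (- (2 * pi * t)))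
      = indicator {-1/2..<1/2} t *\<^sub>R cis (of_int m * (- (2 * pi * t)))"
    using AE_lborel_singleton[of "1/2::real"] by eventually_elim (auto simp: indicator_def)
  ultimately show ?thesis using False
    by (subst has_bochner_integral_cong_AE[symmetric]) auto
qed

text \<open>Integrating the series term by term, only m = 0 survives.\<close>

lemma integral_abel:
  assumes r: "0 \<le> r" "r < 1"
  shows "has_bochner_integral lborel (\<lambda>t. indicator {-1/2..<1/2} t * abel r t) 1"
proof -
  let ?f = "\<lambda>(m::int) t. complex_of_real (r ^ nat \<bar>m\<bar>) * (indicator {-1/2..<1/2::real} t *\<^sub>R cis (of_int m * (- (2 * pi * t))))"
  have n: "norm (?f m t) = r ^ nat \<bar>m\<bar> * indicator {-1/2..<1/2} t" for m t
    using r by (simp add: norm_mult norm_power)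
  have i: "integrable lborel (?f m)" for m
    using integral_cis_unit_interval[of m] by (intro integrable_mult_right) (auto simp: has_bochner_integral_iff)
  have fin: "(\<integral>\<^sup>+t. \<integral>\<^sup>+m. ennreal (norm (?f m t)) \<partial>count_space UNIV \<partial>lborel) < \<infinity>"
    using i integrable_int_powabs[OF r]
    by (intro lborel.integral_count_space_swapI borel_measurable_integrable) (simp_all only: n, simp)
  have e: "(\<integral>m. ?f m t \<partial>count_space UNIV) = complex_of_real (indicator {-1/2..<1/2} t * abel r t)" for t
    using abel_series[OF r, of t]
    by (cases "t \<in> {-1/2..<1/2}") (simp_all add: has_bochner_integral_iff)
  have i0: "(\<integral>t. ?f m t \<partial>lborel) = indicator {0} m" for m
    unfolding integral_mult_right_zero
    using integral_cis_unit_interval[of m] by (simp only: has_bochner_integral_iff) simp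
  have supp: "{a \<in> UNIV. indicator {0::int} a \<noteq> (0::complex)} = {0}" by (auto simp: indicator_def)
  have i1: "integral\<^sup>L (count_space UNIV) (indicator {0::int}) = (1::complex)"
    by (subst lebesgue_integral_count_space_finite_support) (simp_all only: supp, auto)
  note sw = lborel.integral_count_space_swap[OF borel_measurable_integrable[OF i] fin]
  have "integrable lborel (\<lambda>t. complex_of_real (indicator {-1/2..<1/2} t * abel r t))"
    using sw(1) unfolding e .
  moreover have "(\<integral>t. complex_of_real (indicator {-1/2..<1/2} t * abel r t) \<partial>lborel) = (\<integral>m. indicator {0::int} m \<partial>count_space UNIV)"
    using sw(4) unfolding e i0 .
  then have "complex_of_real (\<integral>t. indicator {-1/2..<1/2} t * abel r t \<partial>lborel) = 1"
    by (simp only: integral_complex_of_real) (simp add: i1)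
  ultimately show ?thesis
    by (simp only: has_bochner_integral_iff complex_of_real_integrable_eq of_real_eq_1_iff)
qed

lemma borel_measurable_count_space_integral [measurable (raw)]:
  fixes f :: "'k::countable \<Rightarrow> 'a \<Rightarrow> 'b::{banach, second_countable_topology}"
  assumes f: "\<And>i. f i \<in> borel_measurable M"
  shows "(\<lambda>x. \<integral>i. f i x \<partial>count_space UNIV) \<in> borel_measurable M"
proof -
  interpret C: sigma_finite_measure "count_space (UNIV :: 'k set)"
    by (rule sigma_finite_measure_count_space)
  have "(\<lambda>(i, x). f i x) \<in> borel_measurable (count_space UNIV \<Otimes>\<^sub>M M)"
    by (intro measurable_pair_measure_countable1) (auto simp: f)
  then have "(\<lambda>p. (\<lambda>(i, x). f i x) (snd p, fst p)) \<in> borel_measurable (M \<Otimes>\<^sub>M count_space UNIV)"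
    by measurable
  then have "(\<lambda>(x, i). f i x) \<in> borel_measurable (M \<Otimes>\<^sub>M count_space UNIV)"
    by (simp add: case_prod_unfold)
  then show ?thesis by (rule C.borel_measurable_lebesgue_integral)
qed

section \<open>The product kernel on the unit cube as an approximate identity\<close>

lemma Basis_vec_real: "(Basis :: (real^'n) set) = range (\<lambda>i. axis i 1)"
  by (auto simp: Basis_vec_def)

text \<open>Lebesgue measure on \<open>real^'n\<close> is the image of a product measure indexed by
  \<open>Basis\<close>; the factors are transported along the bijection between coordinates and
  basis vectors.\<close>

lemma integral_lborel_vec_prod:
  fixes f :: "'n::finite \<Rightarrow> real \<Rightarrow> 'b::{real_normed_field, banach, second_countable_topology}"
  assumes f: "\<And>i. integrable lborel (f i)"
  shows "has_bochner_integral lborel (\<lambda>y::real^'n. \<Prod>i\<in>UNIV. f i (y $ i)) (\<Prod>i\<in>UNIV. \<integral>t. f i t \<partial>lborel)"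
proof -
  interpret product_sigma_finite "\<lambda>_::real^'n. lborel :: real measure" ..
  let ?ax = "\<lambda>i. axis i 1 :: real^'n"
  have inj: "inj ?ax" by (auto simp: inj_on_def axis_eq_axis)
  have [simp]: "inv ?ax (axis i 1) = i" for i using inv_f_f[OF inj] .
  let ?f = "\<lambda>b. f (inv ?ax b)"
  let ?T = "\<lambda>g. \<Sum>b\<in>Basis. g b *\<^sub>R (b :: real^'n)"
  have T: "?T \<in> Pi\<^sub>M Basis (\<lambda>_. lborel) \<rightarrow>\<^sub>M borel"
    by measurable
  have [measurable]: "f i \<in> borel_measurable borel" for i
    using borel_measurable_integrable[OF f[of i]] by simp
  have m: "(\<lambda>y::real^'n. \<Prod>i\<in>UNIV. f i (y $ i)) \<in> borel_measurable borel"
    by measurable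
  have e: "(\<Prod>i\<in>UNIV. f i (?T g $ i)) = (\<Prod>b\<in>Basis. ?f b (g b))" for g
  proof -
    have "?T g $ i = g (axis i 1)" for i
    proof -
      have "?T g \<bullet> axis i 1 = g (axis i 1)" by (rule inner_sum_left_Basis) (auto simp: Basis_vec_real)
      then show ?thesis by (simp only: inner_axis inner_real_def mult_1_right)
    qed
    then show ?thesis unfolding Basis_vec_real by (simp add: prod.reindex[OF inj])
  qed
  have "integrable (Pi\<^sub>M Basis (\<lambda>_. lborel)) (\<lambda>g. \<Prod>b\<in>Basis. ?f b (g b))"
    by (intro product_integrable_prod f) auto
  moreover have "(\<integral>g. (\<Prod>b\<in>Basis. ?f b (g b)) \<partial>Pi\<^sub>M Basis (\<lambda>_. lborel)) = (\<Prod>b\<in>Basis. \<integral>t. ?f b t \<partial>lborel)"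
    by (intro product_integral_prod f) auto
  moreover have "(\<Prod>b\<in>Basis. \<integral>t. ?f b t \<partial>lborel) = (\<Prod>i\<in>UNIV. \<integral>t. f i t \<partial>lborel)"
    unfolding Basis_vec_real by (simp add: prod.reindex[OF inj])
  ultimately have "has_bochner_integral (distr (Pi\<^sub>M Basis (\<lambda>_. lborel)) borel ?T) (\<lambda>y::real^'n. \<Prod>i\<in>UNIV. f i (y $ i)) (\<Prod>i\<in>UNIV. \<integral>t. f i t \<partial>lborel)"
    by (simp only: has_bochner_integral_iff integrable_distr_eq[OF T m] integral_distr[OF T m] e)
  then show ?thesis by (simp only: lborel_eq[symmetric])
qed

text \<open>Integer vectors are coded as functions into \<open>int\<close>, a countable type over
  the finite index type, so that sums run over \<open>count_space UNIV\<close>.\<close>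

definition ivec :: "('n \<Rightarrow> int) \<Rightarrow> real^'n" where
  "ivec k = (\<chi> i. of_int (k i))"

lemma ivec_nth [simp]: "ivec k $ i = of_int (k i)"
  by (simp add: ivec_def)

definition cube :: "(real^'n) set" where
  "cube = {y. \<forall>i. y $ i \<in> {-1/2..<1/2}}"

definition abel_prod :: "real \<Rightarrow> real^'n \<Rightarrow> real" where
  "abel_prod r y = (\<Prod>i\<in>UNIV. abel r (y $ i))"

lemma abel_prod_nonneg: "0 \<le> r \<Longrightarrow> r < 1 \<Longrightarrow> 0 \<le> abel_prod r y"
  unfolding abel_prod_def by (intro prod_nonneg ballI abel_nonneg)

lemma abel_prod_measurable [measurable]: "abel_prod r \<in> borel_measurable borel"
  unfolding abel_prod_def by measurable

lemma cube_measurable [measurable]: "cube \<in> sets borel"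
  unfolding cube_def by measurable

lemma indicator_cube: "indicator cube y = (\<Prod>i\<in>UNIV. indicator {-1/2..<1/2} (y $ i) :: real)"
proof (cases "y \<in> cube")
  case True then show ?thesis by (auto simp: cube_def)
next
  case False
  then obtain i where "y $ i \<notin> {-1/2..<1/2}" by (auto simp: cube_def)
  then have "(\<Prod>i\<in>UNIV. indicator {-1/2..<1/2} (y $ i) :: real) = 0"
    by (intro prod_zero bexI[of _ i]) (simp_all only: indicator_simps finite_class.finite_UNIV UNIV_I, simp)
  with False show ?thesis by simp
qed

lemma abel_prod_cube:
  assumes r: "0 \<le> r" "r < 1"
  shows "has_bochner_integral lborel (\<lambda>y::real^'n. indicator cube y * abel_prod r y) 1"
proof -
  have "has_bochner_integral lborel (\<lambda>y::real^'n. \<Prod>i\<in>UNIV. indicator {-1/2..<1/2} (y $ i) * abel r (y $ i))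
     (\<Prod>i\<in>(UNIV::'n set). \<integral>t. indicator {-1/2..<1/2} t * abel r t \<partial>lborel)"
    by (intro integral_lborel_vec_prod integrable.intros[OF integral_abel[OF r]])
  then show ?thesis
    by (simp only: has_bochner_integral_integral_eq[OF integral_abel[OF r]] prod.distrib indicator_cube abel_prod_def) simp
qed

text \<open>The factor of coordinate \<open>i\<close> is cut off to \<delta> \<le> |t| and bounded
  by \<open>abel_le\<close> on an interval of length 1; every other factor integrates to 1.\<close>

lemma abel_prod_tail:
  fixes i :: "'n::finite"
  assumes r: "0 < r" "r < 1" and d: "0 < \<delta>" "\<delta> \<le> 1/2"
  shows "integrable lborel (\<lambda>y::real^'n. indicator {y. \<delta> \<le> \<bar>y $ i\<bar>} y * (indicator cube y * abel_prod r y))"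
    and "(\<integral>y. indicator {y. \<delta> \<le> \<bar>y $ i\<bar>} (y::real^'n) * (indicator cube y * abel_prod r y) \<partial>lborel)
       \<le> (1 - r\<^sup>2) / (2 * r * (1 - cos (2 * pi * \<delta>)))"
proof -
  let ?S = "(1 - r\<^sup>2) / (2 * r * (1 - cos (2 * pi * \<delta>)))"
  let ?g = "\<lambda>t. indicator {-1/2..<1/2} t * abel r t"
  let ?h = "\<lambda>t. indicator {t. \<delta> \<le> \<bar>t\<bar>} t * ?g t"
  let ?f = "\<lambda>j. if j = i then ?h else ?g"
  have g: "integrable lborel ?g" using integral_abel[of r] r by (simp add: has_bochner_integral_iff)
  have h: "integrable lborel ?h"
    by (rule Bochner_Integration.integrable_bound[OF g]) (auto simp: indicator_def)
  have "has_bochner_integral lborel (\<lambda>y::real^'n. \<Prod>j\<in>UNIV. ?f j (y $ j)) (\<Prod>j\<in>UNIV. \<integral>t. ?f j t \<partial>lborel)"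
    using g h by (intro integral_lborel_vec_prod) auto
  moreover have "(\<Prod>j\<in>UNIV. ?f j (y $ j)) = indicator {y. \<delta> \<le> \<bar>y $ i\<bar>} y * (indicator cube y * abel_prod r y)" for y
  proof -
    have "(\<Prod>j\<in>UNIV. ?f j (y $ j)) = (\<Prod>j\<in>UNIV. (if j = i then indicator {t. \<delta> \<le> \<bar>t\<bar>} (y $ j) else 1) * ?g (y $ j))"
      by (intro prod.cong) auto
    also have "\<dots> = indicator {t. \<delta> \<le> \<bar>t\<bar>} (y $ i) * (indicator cube y * abel_prod r y)"
      by (simp add: prod.distrib indicator_cube abel_prod_def)
    finally show ?thesis by (simp add: indicator_def)
  qed
  moreover have "(\<Prod>j\<in>UNIV. \<integral>t. ?f j t \<partial>lborel) = (\<integral>t. ?h t \<partial>lborel)"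
  proof -
    have "(\<Prod>j\<in>UNIV. \<integral>t. ?f j t \<partial>lborel) = (\<Prod>j\<in>UNIV. if j = i then \<integral>t. ?h t \<partial>lborel else 1)"
      using integral_abel[of r] r by (intro prod.cong) (auto simp: has_bochner_integral_iff)
    then show ?thesis by simp
  qed
  ultimately have hb: "has_bochner_integral lborel (\<lambda>y::real^'n. indicator {y. \<delta> \<le> \<bar>y $ i\<bar>} y * (indicator cube y * abel_prod r y)) (\<integral>t. ?h t \<partial>lborel)"
    by (simp only:)
  then show "integrable lborel (\<lambda>y::real^'n. indicator {y. \<delta> \<le> \<bar>y $ i\<bar>} y * (indicator cube y * abel_prod r y))"
    by (rule integrable.intros)
  have "cos (2 * pi * \<delta>) \<le> 1" by simp
  then have S0: "0 \<le> ?S" using r by (intro divide_nonneg_nonneg mult_nonneg_nonneg) (auto simp: power_le_one_iff)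
  have "(\<integral>t. ?h t \<partial>lborel) \<le> (\<integral>t. indicator {-1/2..<1/2::real} t * ?S \<partial>lborel)"
  proof (rule integral_mono[OF h])
    show "integrable lborel (\<lambda>t. indicator {-1/2..<1/2::real} t * ?S)"
      by (intro integrable_mult_left integrable_real_indicator) auto
    show "?h t \<le> indicator {-1/2..<1/2} t * ?S" for t
      using abel_le[OF r d(1), of t] S0 by (auto simp: indicator_def)
  qed
  also have "\<dots> = ?S" by simp
  finally show "(\<integral>y. indicator {y. \<delta> \<le> \<bar>y $ i\<bar>} (y::real^'n) * (indicator cube y * abel_prod r y) \<partial>lborel) \<le> ?S"
    using hb by (simp add: has_bochner_integral_iff)
qed

text \<open>The kernels are nonnegative with integral 1 on the cube. Near 0 continuity of
  \<open>h\<close> makes the error small; elsewhere it is at most 2 B times a kernel mass that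
  vanishes as r tends to 1.\<close>

lemma abel_prod_tendsto:
  fixes h :: "real^'n \<Rightarrow> 'b::{banach, second_countable_topology}"
  assumes h[measurable]: "h \<in> borel_measurable borel"
    and B: "\<And>y. y \<in> cube \<Longrightarrow> norm (h y) \<le> B"
    and cont: "isCont h 0"
    and r: "\<And>j. 0 < r j" "\<And>j. r j < 1" "r \<longlonglongrightarrow> 1"
  shows "(\<lambda>j. \<integral>y. (indicator cube y * abel_prod (r j) y) *\<^sub>R h y \<partial>lborel) \<longlonglongrightarrow> h 0"
proof (rule LIMSEQ_I)
  fix e :: real assume e: "0 < e"
  let ?w = "\<lambda>j y. indicator cube y * abel_prod (r j) (y::real^'n)"
  have 0: "(0::real^'n) \<in> cube" by (simp add: cube_def)
  then have B0: "0 \<le> B" using B[OF 0] norm_ge_zero order_trans by blast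
  obtain d where d: "d > 0" "\<And>y. norm y < d \<Longrightarrow> norm (h y - h 0) < e / 2"
    using cont[unfolded continuous_at_eps_delta dist_norm, rule_format, of "e/2"] e by auto
  \<comment> \<open>If all coordinates of y are below \<delta> in modulus, its l1 norm is at most
    d/2, hence its norm is below d. The cap 1/4 keeps \<delta> in the range of
    \<open>abel_prod_tail\<close>.\<close>
  define \<delta> where "\<delta> = min (1/4) (d / (2 * real CARD('n)))"
  have \<delta>: "0 < \<delta>" "\<delta> \<le> 1/2" using d by (auto simp: \<delta>_def)
  define S where "S j = (1 - (r j)\<^sup>2) / (2 * r j * (1 - cos (2 * pi * \<delta>)))" for j
  have "cos (2 * pi * \<delta>) < cos 0"
    using \<delta> by (intro cos_monotone_0_pi) auto
  then have "S \<longlonglongrightarrow> (1 - 1\<^sup>2) / (2 * 1 * (1 - cos (2 * pi * \<delta>)))"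
    unfolding S_def using r by (intro tendsto_intros) auto
  then have "(\<lambda>j. 2 * B * (real CARD('n) * S j)) \<longlonglongrightarrow> 2 * B * (real CARD('n) * 0)"
    by (intro tendsto_intros) simp
  then have ev: "eventually (\<lambda>j. 2 * B * (real CARD('n) * S j) < e / 2) sequentially"
    using e by (intro order_tendstoD(2)) auto
  have bound: "norm ((\<integral>y. ?w j y *\<^sub>R h y \<partial>lborel) - h 0) \<le> e / 2 + 2 * B * (real CARD('n) * S j)" for j
  proof -
    have rj: "0 \<le> r j" "0 < r j" "r j < 1" using r less_imp_le by auto
    note w = abel_prod_cube[OF rj(1,3), where 'n = 'n]
    have wi: "integrable lborel (?w j)" and w1: "(\<integral>y. ?w j y \<partial>lborel) = 1"
      using w by (simp_all add: has_bochner_integral_iff)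
    have w0: "0 \<le> ?w j y" for y by (simp add: indicator_def abel_prod_nonneg[OF rj(1,3)])
    have i1: "integrable lborel (\<lambda>y. ?w j y *\<^sub>R h y)"
    proof (rule Bochner_Integration.integrable_bound[OF integrable_mult_left[OF wi, of B]])
      show "AE y in lborel. norm (?w j y *\<^sub>R h y) \<le> norm (?w j y * B)"
        using B B0 by (intro AE_I2) (auto simp: indicator_def abel_prod_nonneg[OF rj(1,3)] abs_mult intro!: mult_left_mono)
    qed simp
    have i2: "integrable lborel (\<lambda>y. ?w j y *\<^sub>R h 0)" using wi by (rule integrable_scaleR_left)
    \<comment> \<open>This function majorizes the error pointwise: the first term covers the
      \<delta>-box, the sum over coordinates covers its complement.\<close>
    have "has_bochner_integral lborel (\<lambda>y. e / 2 * ?w j y + 2 * B * (\<Sum>i\<in>UNIV. indicator {y. \<delta> \<le> \<bar>y $ i\<bar>} y * ?w j y))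
       (e / 2 * 1 + 2 * B * (\<Sum>i\<in>UNIV. \<integral>y. indicator {y. \<delta> \<le> \<bar>y $ i\<bar>} y * ?w j y \<partial>lborel))"
      by (intro has_bochner_integral_add has_bochner_integral_mult_right has_bochner_integral_sum
          has_bochner_integral_integrable abel_prod_tail(1)[OF rj(2,3) \<delta>] w)
    then have tails: "has_bochner_integral lborel (\<lambda>y. e / 2 * ?w j y + 2 * B * (\<Sum>i\<in>UNIV. indicator {y. \<delta> \<le> \<bar>y $ i\<bar>} y * ?w j y))
       (e / 2 + 2 * B * (\<Sum>i\<in>UNIV. \<integral>y. indicator {y. \<delta> \<le> \<bar>y $ i\<bar>} y * ?w j y \<partial>lborel))"
      by (simp only: mult_1_right)
    have "(\<integral>y. ?w j y *\<^sub>R h y \<partial>lborel) - h 0 = (\<integral>y. ?w j y *\<^sub>R h y - ?w j y *\<^sub>R h 0 \<partial>lborel)"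
      using i1 i2 w1 by (subst Bochner_Integration.integral_diff) (auto simp: integral_scaleR_left wi)
    also have "norm \<dots> \<le> (\<integral>y. e / 2 * ?w j y + 2 * B * (\<Sum>i\<in>UNIV. indicator {y. \<delta> \<le> \<bar>y $ i\<bar>} y * ?w j y) \<partial>lborel)"
    proof (rule norm_integral_le)
      show "integrable lborel (\<lambda>y. e / 2 * ?w j y + 2 * B * (\<Sum>i\<in>UNIV. indicator {y. \<delta> \<le> \<bar>y $ i\<bar>} y * ?w j y))"
        using wi abel_prod_tail(1)[OF rj(2,3) \<delta>] by (intro Bochner_Integration.integrable_add integrable_mult_right Bochner_Integration.integrable_sum)
      fix y :: "real^'n"
      have tail0: "0 \<le> (\<Sum>i\<in>UNIV. indicator {y. \<delta> \<le> \<bar>y $ i\<bar>} y * ?w j y)"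
        using w0 by (intro sum_nonneg) (auto simp: indicator_def)
      have "norm (h y - h 0) * ?w j y \<le> e / 2 * ?w j y + 2 * B * (\<Sum>i\<in>UNIV. indicator {y. \<delta> \<le> \<bar>y $ i\<bar>} y * ?w j y)"
      proof (cases "\<exists>i. \<delta> \<le> \<bar>y $ i\<bar>")
        case True
        then obtain i where i: "\<delta> \<le> \<bar>y $ i\<bar>" by blast
        have "norm (h y - h 0) * ?w j y \<le> 2 * B * ?w j y"
        proof (cases "y \<in> cube")
          case True
          have "norm (h y - h 0) \<le> B + B"
            using B[OF True] B[OF 0] norm_triangle_ineq4[of "h y" "h 0"] by linarith
          then show ?thesis using w0 by (intro mult_right_mono) auto
        qed simp
        also have "\<dots> \<le> 2 * B * (\<Sum>i\<in>UNIV. indicator {y. \<delta> \<le> \<bar>y $ i\<bar>} y * ?w j y)"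
        proof -
          have "indicator {y. \<delta> \<le> \<bar>y $ i\<bar>} y * ?w j y \<le> (\<Sum>i\<in>UNIV. indicator {y. \<delta> \<le> \<bar>y $ i\<bar>} y * ?w j y)"
            using w0 by (intro member_le_sum) (auto simp: indicator_def)
          then show ?thesis using i B0 by (intro mult_left_mono) auto
        qed
        finally show ?thesis using w0[of y] e by (simp add: add_increasing)
      next
        case False
        have "norm y \<le> (\<Sum>i\<in>UNIV. \<bar>y $ i\<bar>)" by (rule norm_le_l1_cart)
        also have "\<dots> \<le> (\<Sum>i\<in>(UNIV::'n set). \<delta>)" using False by (intro sum_mono) (auto simp: not_le less_imp_le)
        also have "\<dots> \<le> d / 2"
          using \<delta>_def by (simp add: min_def field_simps)
        also have "\<dots> < d" using d by simp
        finally have "norm (h y - h 0) \<le> e / 2" using d(2) less_imp_le by blast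
        then have "norm (h y - h 0) * ?w j y \<le> e / 2 * ?w j y" using w0 by (intro mult_right_mono)
        then show ?thesis using tail0 B0 by (simp add: add_increasing2)
      qed
      then show "norm (?w j y *\<^sub>R h y - ?w j y *\<^sub>R h 0) \<le> e / 2 * ?w j y + 2 * B * (\<Sum>i\<in>UNIV. indicator {y. \<delta> \<le> \<bar>y $ i\<bar>} y * ?w j y)"
        using w0[of y] by (simp add: scaleR_diff_right[symmetric] mult.commute del: scaleR_scaleR)
    qed
    also have "\<dots> = e / 2 + 2 * B * (\<Sum>i\<in>UNIV. \<integral>y. indicator {y. \<delta> \<le> \<bar>y $ i\<bar>} y * ?w j y \<partial>lborel)"
      by (rule has_bochner_integral_integral_eq[OF tails])
    also have "\<dots> \<le> e / 2 + 2 * B * (\<Sum>i\<in>(UNIV::'n set). S j)"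
      unfolding S_def using B0 abel_prod_tail(2)[OF rj(2,3) \<delta>] by (intro add_left_mono mult_left_mono sum_mono) auto
    finally show ?thesis by simp
  qed
  from ev obtain N where N: "\<And>j. j \<ge> N \<Longrightarrow> 2 * B * (real CARD('n) * S j) < e / 2"
    unfolding eventually_sequentially by blast
  show "\<exists>N. \<forall>j\<ge>N. norm ((\<integral>y. ?w j y *\<^sub>R h y \<partial>lborel) - h 0) < e"
    using bound N by (intro exI[of _ N] allI impI) (smt (verit) field_sum_of_halves)
qed

section \<open>Folding integrals over space onto the unit cube\<close>

lemma mem_cube_diff_ivec: "y - ivec k \<in> cube \<longleftrightarrow> k = (\<lambda>i. \<lfloor>y $ i + 1/2\<rfloor>)"
proof -
  have "y $ i - of_int (k i) \<in> {-1/2..<1/2} \<longleftrightarrow> k i = \<lfloor>y $ i + 1/2\<rfloor>" for i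
    by (auto simp: eq_commute[of "k i"] floor_eq_iff)
  then show ?thesis by (auto simp: cube_def fun_eq_iff)
qed

lemma integral_lborel_translate:
  fixes f :: "'a::euclidean_space \<Rightarrow> 'b::{banach, second_countable_topology}"
  assumes [measurable]: "f \<in> borel_measurable borel"
  shows "(\<integral>y. f (y + c) \<partial>lborel) = (\<integral>y. f y \<partial>lborel)"
    and "integrable lborel (\<lambda>y. f (y + c)) \<longleftrightarrow> integrable lborel f"
  using integral_distr[of "(+) c" lborel borel f] integrable_distr_eq[of "(+) c" lborel borel f]
  by (simp_all add: lborel_distr_plus add.commute)

text \<open>Space is partitioned into integer translates of the cube, and each piece is translated
  back. This takes two interchanges with the sum, one before and one after the translation; the
  finiteness for the second is inherited from the first.\<close>

lemma integral_lborel_unfold: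
  fixes F :: "real^'n \<Rightarrow> 'b::{banach, second_countable_topology}"
  assumes F: "integrable lborel F"
  shows "(\<integral>y. F y \<partial>lborel) = (\<integral>y. indicator cube y *\<^sub>R (\<integral>k. F (y + ivec k) \<partial>count_space UNIV) \<partial>lborel)"
proof -
  have Fm[measurable]: "F \<in> borel_measurable borel" using borel_measurable_integrable[OF F] by simp
  let ?f = "\<lambda>k y. indicator cube (y - ivec k) *\<^sub>R F y"
  let ?g = "\<lambda>k y. indicator cube y *\<^sub>R F (y + ivec k)"
  \<comment> \<open>For fixed y exactly one k puts \<open>y - ivec k\<close> into the cube, so
    summing the pieces \<open>?f\<close> over k returns \<open>F\<close>.\<close>
  have ind: "indicator cube (y - ivec k) = (indicator {(\<lambda>i. \<lfloor>y $ i + 1/2\<rfloor>)} k :: real)" for k and y :: "real^'n"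
    by (simp add: indicator_def mem_cube_diff_ivec)
  have "(\<integral>\<^sup>+k. ennreal (norm (?f k y)) \<partial>count_space UNIV) = ennreal (norm (F y))" for y
  proof -
    have "(\<integral>\<^sup>+k. ennreal (norm (?f k y)) \<partial>count_space UNIV)
       = (\<integral>\<^sup>+k. ennreal (norm (F y)) * indicator {(\<lambda>i. \<lfloor>y $ i + 1/2\<rfloor>)} k \<partial>count_space UNIV)"
      unfolding ind by (intro nn_integral_cong) (auto simp: indicator_def)
    then show ?thesis by (simp add: nn_integral_cmult_indicator)
  qed
  then have fin: "(\<integral>\<^sup>+y. \<integral>\<^sup>+k. ennreal (norm (?f k y)) \<partial>count_space UNIV \<partial>lborel) < \<infinity>"
    using F by (simp add: integrable_iff_bounded)
  have sum_f: "(\<integral>k. ?f k y \<partial>count_space UNIV) = F y" for y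
    unfolding ind by (subst integral_scaleR_left) auto
  have fm: "?f k \<in> borel_measurable lborel" for k by measurable
  note sf = lborel.integral_count_space_swap[OF fm fin]
  have shift: "(\<integral>y. ?f k y \<partial>lborel) = (\<integral>y. ?g k y \<partial>lborel)"
    "(\<integral>y. norm (?f k y) \<partial>lborel) = (\<integral>y. norm (?g k y) \<partial>lborel)"
    "integrable lborel (?g k) \<longleftrightarrow> integrable lborel (?f k)" for k
    using integral_lborel_translate[of "?f k" "ivec k"] integral_lborel_translate(1)[of "\<lambda>y. norm (?f k y)" "ivec k"] by simp_all
  have fin': "(\<integral>\<^sup>+y. \<integral>\<^sup>+k. ennreal (norm (?g k y)) \<partial>count_space UNIV \<partial>lborel) < \<infinity>"
  proof (rule lborel.integral_count_space_swapI)
    show "integrable lborel (?g k)" for k using sf(2) shift(3) by simp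
    show "integrable (count_space UNIV) (\<lambda>k. \<integral>y. norm (?g k y) \<partial>lborel)"
      using sf(5) unfolding shift(2) .
  qed measurable
  have gm: "?g k \<in> borel_measurable lborel" for k by measurable
  have "(\<integral>y. F y \<partial>lborel) = (\<integral>k. \<integral>y. ?g k y \<partial>lborel \<partial>count_space UNIV)"
    using sf(4) unfolding sum_f shift(1) .
  also have "\<dots> = (\<integral>y. \<integral>k. ?g k y \<partial>count_space UNIV \<partial>lborel)"
    using lborel.integral_count_space_swap(4)[OF gm fin'] ..
  also have "\<dots> = (\<integral>y. indicator cube y *\<^sub>R (\<integral>k. F (y + ivec k) \<partial>count_space UNIV) \<partial>lborel)"
    by (intro Bochner_Integration.integral_cong refl) (auto simp: indicator_def)
  finally show ?thesis .
qed

lemma prod_cis: "(\<Prod>i\<in>A. cis (f i)) = cis (\<Sum>i\<in>A. f i)"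
  by (induction A rule: infinite_finite_induct) (simp_all add: cis_mult)

lemma abel_prod_series:
  fixes y :: "real^'n"
  assumes r: "0 \<le> r" "r < 1"
  shows "(\<integral>k. complex_of_real (\<Prod>i\<in>UNIV. r ^ nat \<bar>k i\<bar>) * cis (- (2 * pi * (ivec k \<bullet> y))) \<partial>count_space UNIV)
    = complex_of_real (abel_prod r y)"
proof -
  have "complex_of_real (\<Prod>i\<in>UNIV. r ^ nat \<bar>k i\<bar>) * cis (- (2 * pi * (ivec k \<bullet> y)))
     = (\<Prod>i\<in>UNIV. complex_of_real (r ^ nat \<bar>k i\<bar>) * cis (of_int (k i) * (- (2 * pi * (y $ i)))))" for k :: "'n \<Rightarrow> int"
    by (simp add: prod.distrib prod_cis inner_vec_def sum_distrib_left sum_negf mult_ac)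
  then show ?thesis
    using prod_count_space(2)[of "\<lambda>i m. complex_of_real (r ^ nat \<bar>m\<bar>) * cis (of_int m * (- (2 * pi * (y $ i))))"]
      abel_series[OF r]
    by (simp only: has_bochner_integral_iff abel_prod_def of_real_prod)
qed

lemma integrable_powabs_prod:
  fixes r :: real
  assumes r: "0 \<le> r" "r < 1"
  shows "integrable (count_space UNIV) (\<lambda>k::'n::finite \<Rightarrow> int. \<Prod>i\<in>UNIV. r ^ nat \<bar>k i\<bar>)"
  using integrable_int_powabs[OF r] by (intro prod_count_space)

text \<open>For fixed r the kernel is bounded by the sum of the moduli of its Fourier coefficients,
  so its product with an integrable function is integrable.\<close>

lemma abel_prod_le:
  fixes y :: "real^'n"
  assumes r: "0 \<le> r" "r < 1"
  shows "abel_prod r y \<le> (\<integral>k. (\<Prod>i\<in>UNIV. r ^ nat \<bar>k i\<bar>) \<partial>count_space (UNIV :: ('n \<Rightarrow> int) set))"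
proof -
  have "abel_prod r y = norm (complex_of_real (abel_prod r y))"
    using abel_prod_nonneg[OF r, of y] by simp
  also have "\<dots> \<le> (\<integral>k. (\<Prod>i\<in>UNIV. r ^ nat \<bar>k i\<bar>) \<partial>count_space (UNIV :: ('n \<Rightarrow> int) set))"
    unfolding abel_prod_series[OF r, symmetric]
    by (rule norm_integral_le[OF integrable_powabs_prod[OF r]])
       (use r in \<open>simp add: norm_mult prod_nonneg flip: of_real_prod of_real_power\<close>)
  finally show ?thesis .
qed

section \<open>Poisson summation\<close>

text \<open>Integrate \<open>A\<close> against the product kernel. Expanding the kernel gives the Abel means of the
  dual sum; folding \<open>A\<close> onto the cube gives the approximate identity applied to its periodization.\<close>

theorem poisson_summation:
  fixes A :: "real^'n \<Rightarrow> complex"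
  defines "hat \<equiv> (\<lambda>m. \<integral>y. A y * cis (- (2 * pi * (ivec m \<bullet> y))) \<partial>lborel)"
  assumes cont: "continuous_on UNIV A" and A: "integrable lborel A"
    and D: "\<And>k y. (\<And>i. \<bar>y $ i\<bar> \<le> 1/2) \<Longrightarrow> norm (A (y + ivec k)) \<le> D k"
    and intD: "integrable (count_space UNIV) D"
    and hat: "integrable (count_space UNIV) hat"
  shows "(\<integral>k. A (ivec k) \<partial>count_space UNIV) = (\<integral>m. hat m \<partial>count_space UNIV)"
proof -
  \<comment> \<open>A sequence tending to 1 from below that starts at 1/2: the tail estimates divide
    by r.\<close>
  define r where "r j = 1 - 1 / (real j + 2)" for j :: nat
  have r: "0 < r j" "0 \<le> r j" "r j < 1" for j by (auto simp: r_def)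
  have rl: "r \<longlonglongrightarrow> 1" unfolding r_def by real_asymp
  have [measurable]: "A \<in> borel_measurable borel"
    using borel_measurable_integrable[OF A] by simp
  define h where "h y = (\<integral>k. A (y + ivec k) \<partial>count_space UNIV)" for y
  let ?c = "\<lambda>j (m::'n \<Rightarrow> int). \<Prod>i\<in>UNIV. r j ^ nat \<bar>m i\<bar>"
  have c0: "0 \<le> ?c j m" "?c j m \<le> 1" for j m
    using r[of j] by (auto intro!: prod_nonneg prod_le_1 power_le_one)
  define L where "L j = (\<integral>y. abel_prod (r j) y *\<^sub>R A y \<partial>lborel)" for j
  have L_hat: "L j = (\<integral>m. complex_of_real (?c j m) * hat m \<partial>count_space UNIV)" for j
  proof -
    let ?f = "\<lambda>m y. A y * (complex_of_real (?c j m) * cis (- (2 * pi * (ivec m \<bullet> y))))"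
    have n: "norm (?f m y) = norm (A y) * ?c j m" for m y
      using c0 by (simp add: norm_mult flip: of_real_prod of_real_power)
    have fm: "?f m \<in> borel_measurable lborel" for m by measurable
    have fin: "(\<integral>\<^sup>+y. \<integral>\<^sup>+m. ennreal (norm (?f m y)) \<partial>count_space UNIV \<partial>lborel) < \<infinity>"
    proof (rule lborel.integral_count_space_swapI[OF fm])
      show "integrable lborel (?f m)" for m
        by (rule Bochner_Integration.integrable_bound[OF integrable_mult_left[OF A, of "?c j m"]])
           (use n c0 in \<open>auto simp: norm_mult\<close>)
      show "integrable (count_space UNIV) (\<lambda>m. \<integral>y. norm (?f m y) \<partial>lborel)"
        unfolding n integral_mult_left_zero by (intro integrable_mult_right integrable_powabs_prod r)
    qed
    have "L j = (\<integral>y. \<integral>m. ?f m y \<partial>count_space UNIV \<partial>lborel)"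
      unfolding L_def integral_mult_right_zero abel_prod_series[OF r(2,3)]
      by (simp add: scaleR_conv_of_real mult.commute)
    also have "\<dots> = (\<integral>m. \<integral>y. ?f m y \<partial>lborel \<partial>count_space UNIV)"
      by (rule lborel.integral_count_space_swap(4)[OF fm fin])
    also have "\<dots> = (\<integral>m. complex_of_real (?c j m) * hat m \<partial>count_space UNIV)"
      unfolding hat_def integral_mult_right_zero[symmetric] by (simp only: mult_ac)
    finally show ?thesis .
  qed
  have "L \<longlonglongrightarrow> (\<integral>m. hat m \<partial>count_space UNIV)"
    unfolding L_hat
  proof (rule integral_dominated_convergence[where w = "\<lambda>m. norm (hat m)"])
    show "AE m in count_space UNIV. (\<lambda>j. complex_of_real (?c j m) * hat m) \<longlonglongrightarrow> hat m"
    proof (rule AE_I2)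
      fix m :: "'n \<Rightarrow> int"
      have "(\<lambda>j. complex_of_real (?c j m) * hat m) \<longlonglongrightarrow> complex_of_real (\<Prod>i\<in>(UNIV::'n set). 1 ^ nat \<bar>m i\<bar>) * hat m"
        by (intro tendsto_intros rl)
      then show "(\<lambda>j. complex_of_real (?c j m) * hat m) \<longlonglongrightarrow> hat m" by simp
    qed
    \<comment> \<open>The Abel factors lie between 0 and 1, so absolute summability of
      \<open>hat\<close> itself dominates the Abel means.\<close>
    show "AE m in count_space UNIV. norm (complex_of_real (?c j m) * hat m) \<le> norm (hat m)" for j
      using c0 by (intro AE_I2) (simp add: norm_mult mult_left_le_one_le flip: of_real_prod of_real_power)
  qed (use hat in auto)
  moreover have "L \<longlonglongrightarrow> h 0"
  proof -
    have "L = (\<lambda>j. \<integral>y. (indicator cube y * abel_prod (r j) y) *\<^sub>R h y \<partial>lborel)"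
    proof
      fix j
      let ?M = "\<integral>k. ?c j k \<partial>count_space UNIV"
      have "abel_prod (r j) (y + ivec k) = abel_prod (r j) y" for y :: "real^'n" and k
        unfolding abel_prod_def by (simp add: abel_add_int)
      moreover have "integrable lborel (\<lambda>y. abel_prod (r j) y *\<^sub>R A y)"
      proof (rule Bochner_Integration.integrable_bound[OF integrable_mult_left[OF integrable_norm[OF A], of ?M]])
        show "AE y in lborel. norm (abel_prod (r j) y *\<^sub>R A y) \<le> norm (norm (A y) * ?M)"
          using abel_prod_le[OF r(2,3)[of j], where 'n = 'n] abel_prod_nonneg[OF r(2,3)[of j], where 'a = 'n]
          by (intro AE_I2) (smt (verit) abs_mult mult.commute mult_left_mono norm_ge_zero norm_scaleR real_norm_def)
      qed measurable
      ultimately show "L j = (\<integral>y. (indicator cube y * abel_prod (r j) y) *\<^sub>R h y \<partial>lborel)"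
        unfolding L_def h_def by (subst integral_lborel_unfold) simp_all
    qed
    moreover have "(\<lambda>j. \<integral>y. (indicator cube y * abel_prod (r j) y) *\<^sub>R h y \<partial>lborel) \<longlonglongrightarrow> h 0"
    proof (rule abel_prod_tendsto[where B = "\<integral>k. D k \<partial>count_space UNIV"])
      show "h \<in> borel_measurable borel" unfolding h_def by measurable
      show "norm (h y) \<le> (\<integral>k. D k \<partial>count_space UNIV)" if "y \<in> cube" for y
      proof -
        have "\<bar>y $ i\<bar> \<le> 1/2" for i using that by (auto simp: cube_def abs_le_iff dest!: spec[of _ i])
        then have le: "norm (A (y + ivec k)) \<le> D k" for k by (rule D)
        then show ?thesis unfolding h_def
          by (rule norm_integral_le[OF intD])
      qed
      show "isCont h 0"
        unfolding continuous_at_sequentially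
      proof (intro allI impI)
        fix s :: "nat \<Rightarrow> real^'n" assume s: "s \<longlonglongrightarrow> 0"
        \<comment> \<open>The majorant \<open>D\<close> is available only for points with
          coordinates at most 1/2 in modulus; a tail of the sequence lies there.\<close>
        have "eventually (\<lambda>j. norm (s j) < 1/2) sequentially"
          using s by (intro order_tendstoD(2)[OF tendsto_norm_zero]) auto
        then obtain N where N: "\<And>j. j \<ge> N \<Longrightarrow> norm (s j) < 1/2"
          unfolding eventually_sequentially by blast
        have "(\<lambda>j. h (s (j + N))) \<longlonglongrightarrow> h 0"
          unfolding h_def
        proof (rule integral_dominated_convergence[where w = D])
          show "AE k in count_space UNIV. (\<lambda>j. A (s (j + N) + ivec k)) \<longlonglongrightarrow> A (0 + ivec k)"
          proof (rule AE_I2)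
            fix k :: "'n \<Rightarrow> int"
            have "(\<lambda>j. s (j + N) + ivec k) \<longlonglongrightarrow> 0 + ivec k"
              using s by (intro tendsto_intros LIMSEQ_ignore_initial_segment)
            then show "(\<lambda>j. A (s (j + N) + ivec k)) \<longlonglongrightarrow> A (0 + ivec k)"
              using cont by (intro continuous_on_tendsto_compose[of UNIV A]) auto
          qed
          show "AE k in count_space UNIV. norm (A (s (j + N) + ivec k)) \<le> D k" for j
            by (intro AE_I2 D) (meson N component_le_norm_cart le_add2 less_imp_le order_trans)
        qed (use intD in auto)
        then show "(h \<circ> s) \<longlonglongrightarrow> h 0"
          unfolding o_def by (rule LIMSEQ_offset)
      qed
    qed (use r rl in auto)
    ultimately show ?thesis by simp
  qed
  ultimately show ?thesis
    using LIMSEQ_unique unfolding h_def by fastforce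
qed

section \<open>Fourier transform of a Gaussian\<close>

text \<open>Derived from the characteristic function exp (- s^2/2) of the standard normal
  distribution by rescaling.\<close>

lemma gauss_fourier_real:
  assumes u: "0 < u"
  shows "has_bochner_integral lborel (\<lambda>t. complex_of_real (exp (- (u * t\<^sup>2))) * cis (- (2 * pi * (w * t))))
    (complex_of_real (sqrt (pi / u) * exp (- (pi\<^sup>2 * w\<^sup>2 / u))))"
proof -
  let ?f = "\<lambda>t. complex_of_real (exp (- (u * t\<^sup>2))) * cis (- (2 * pi * (w * t)))"
  \<comment> \<open>The substitution x = sqrt (2u) t turns x^2/2 into u t^2. The frequency
    \<open>?s\<close> is chosen so that s x = - 2 pi w t, and then s^2/2 = pi^2 w^2/u.\<close>
  let ?c = "sqrt (2 * u)"
  let ?s = "- (2 * pi * w) / ?c"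
  have c: "0 < ?c" using u by simp
  have c2: "?c\<^sup>2 = 2 * u" using u by simp
  have m: "(\<lambda>x. iexp (?s * x)) \<in> borel_measurable lborel" by measurable
  have "(\<integral>x. iexp (?s * x) \<partial>std_normal_distribution) = complex_of_real (exp (- ?s\<^sup>2 / 2))"
    using fun_cong[OF char_std_normal_distribution, of ?s] by (simp only: char_def)
  then have I: "(\<integral>x. std_normal_density x *\<^sub>R iexp (?s * x) \<partial>lborel) = complex_of_real (exp (- ?s\<^sup>2 / 2))"
    by (subst (asm) integral_density) (auto simp: m)
  have N: "integrable lborel (\<lambda>x. std_normal_density x *\<^sub>R iexp (?s * x))"
  proof (rule Bochner_Integration.integrable_bound[of _ std_normal_density])
    show "integrable lborel std_normal_density"
      by simp
  qed simp_all
  have e: "std_normal_density (?c * t) *\<^sub>R iexp (?s * (?c * t)) = complex_of_real (1 / sqrt (2 * pi)) * ?f t" for t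
  proof -
    have "(?c * t)\<^sup>2 / 2 = u * t\<^sup>2" by (simp only: power_mult_distrib c2)
    moreover have "?s * (?c * t) = - (2 * pi * (w * t))" using c by simp
    ultimately show ?thesis
      by (simp only: std_normal_density_def scaleR_conv_of_real cis_conv_exp) (simp add: mult_ac)
  qed
  have "has_bochner_integral lborel (\<lambda>t. std_normal_density (?c * t) *\<^sub>R iexp (?s * (?c * t))) (complex_of_real (exp (- ?s\<^sup>2 / 2)) /\<^sub>R \<bar>?c\<bar>)"
    using lborel_has_bochner_integral_real_affine_iff[of ?c "\<lambda>x. std_normal_density x *\<^sub>R iexp (?s * x)" "complex_of_real (exp (- ?s\<^sup>2 / 2))" 0] I N c
    by (simp add: has_bochner_integral_iff)
  then have "has_bochner_integral lborel (\<lambda>t. complex_of_real (sqrt (2 * pi)) * (complex_of_real (1 / sqrt (2 * pi)) * ?f t))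
      (complex_of_real (sqrt (2 * pi)) * (complex_of_real (exp (- ?s\<^sup>2 / 2)) /\<^sub>R \<bar>?c\<bar>))"
    unfolding e by (rule has_bochner_integral_mult_right)
  moreover have "complex_of_real (sqrt (2 * pi)) * (complex_of_real (1 / sqrt (2 * pi)) * ?f t) = ?f t" for t
  proof -
    have "complex_of_real (sqrt (2 * pi)) * complex_of_real (1 / sqrt (2 * pi)) = 1"
      by (simp flip: of_real_mult)
    then show ?thesis by (simp only: mult.assoc[symmetric]) simp
  qed
  moreover have "complex_of_real (sqrt (2 * pi)) * (complex_of_real (exp (- ?s\<^sup>2 / 2)) /\<^sub>R \<bar>?c\<bar>)
     = complex_of_real (sqrt (pi / u) * exp (- (pi\<^sup>2 * w\<^sup>2 / u)))"
  proof -
    have "?s\<^sup>2 / 2 = pi\<^sup>2 * w\<^sup>2 / u"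
      unfolding power_divide c2 using u by (simp add: power_mult_distrib power2_eq_square)
    moreover have "sqrt (2 * pi) / ?c = sqrt (pi / u)"
      by (simp add: real_sqrt_divide real_sqrt_mult)
    ultimately show ?thesis
      using c by (simp add: scaleR_conv_of_real field_simps flip: of_real_mult)
  qed
  ultimately show ?thesis by simp
qed

lemma gauss_fourier_vec:
  fixes w :: "real^'n"
  assumes u: "0 < u"
  shows "has_bochner_integral lborel (\<lambda>z. complex_of_real (exp (- (u * (norm z)\<^sup>2))) * cis (- (2 * pi * (w \<bullet> z))))
    (complex_of_real ((pi / u) powr (CARD('n) / 2) * exp (- (pi\<^sup>2 * (norm w)\<^sup>2 / u))))"
proof -
  have n2: "(norm z)\<^sup>2 = (\<Sum>i\<in>UNIV. (z $ i)\<^sup>2)" for z :: "real^'n"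
    unfolding power2_norm_eq_inner inner_vec_def by (simp add: power2_eq_square)
  have "has_bochner_integral lborel (\<lambda>z::real^'n. \<Prod>i\<in>UNIV. complex_of_real (exp (- (u * (z $ i)\<^sup>2))) * cis (- (2 * pi * (w $ i * z $ i))))
     (\<Prod>i\<in>UNIV. complex_of_real (sqrt (pi / u) * exp (- (pi\<^sup>2 * (w $ i)\<^sup>2 / u))))"
    using integral_lborel_vec_prod[OF integrable.intros[OF gauss_fourier_real[OF u]], where 'n = 'n, of "\<lambda>i. w $ i"]
    by (simp only: has_bochner_integral_integral_eq[OF gauss_fourier_real[OF u]])
  moreover have "(\<Prod>i\<in>UNIV. complex_of_real (exp (- (u * (z $ i)\<^sup>2))) * cis (- (2 * pi * (w $ i * z $ i))))
      = complex_of_real (exp (- (u * (norm z)\<^sup>2))) * cis (- (2 * pi * (w \<bullet> z)))" for z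
  proof -
    have "(\<Prod>i\<in>UNIV. exp (- (u * (z $ i)\<^sup>2))) = exp (- (u * (norm z)\<^sup>2))"
      by (simp add: n2 sum_distrib_left sum_negf flip: exp_sum)
    moreover have "(\<Sum>i\<in>UNIV. - (2 * pi * (w $ i * z $ i))) = - (2 * pi * (w \<bullet> z))"
      by (simp add: inner_vec_def sum_distrib_left sum_negf)
    ultimately show ?thesis by (simp only: prod.distrib prod_cis of_real_prod[symmetric])
  qed
  moreover have "(\<Prod>i\<in>UNIV. complex_of_real (sqrt (pi / u) * exp (- (pi\<^sup>2 * (w $ i)\<^sup>2 / u))))
     = complex_of_real ((pi / u) powr (CARD('n) / 2) * exp (- (pi\<^sup>2 * (norm w)\<^sup>2 / u)))"
  proof -
    have "sqrt (pi / u) ^ CARD('n) = (pi / u) powr (CARD('n) / 2)"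
      using u by (simp add: powr_half_sqrt[symmetric] powr_powr flip: powr_realpow)
    moreover have "(\<Prod>i\<in>UNIV. exp (- (pi\<^sup>2 * (w $ i)\<^sup>2 / u))) = exp (- (pi\<^sup>2 * (norm w)\<^sup>2 / u))"
      by (simp add: n2 sum_distrib_left sum_negf sum_divide_distrib flip: exp_sum)
    ultimately show ?thesis
      by (simp only: prod.distrib of_real_prod[symmetric]) simp
  qed
  ultimately show ?thesis by simp
qed

section \<open>Linear change of variables\<close>

text \<open>The change of variables theorems of HOL-Analysis are restricted to index types that are
  well-ordered, whereas the index type here is merely finite.\<close>

lemma nn_integral_lborel_translate:
  fixes f :: "'a::euclidean_space \<Rightarrow> ennreal"
  assumes [measurable]: "f \<in> borel_measurable borel"
  shows "(\<integral>\<^sup>+y. f (y + c) \<partial>lborel) = (\<integral>\<^sup>+y. f y \<partial>lborel)"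
  using nn_integral_distr[of "(+) c" lborel borel f] by (simp add: lborel_distr_plus add.commute)

lemma prod_Basis_vec: "(\<Prod>b\<in>(Basis :: (real^'n) set). F b) = (\<Prod>i\<in>UNIV. F (axis i 1))"
proof -
  have "inj (\<lambda>i. axis i 1 :: real^'n)" by (auto simp: inj_on_def axis_eq_axis)
  then show ?thesis unfolding Basis_vec_real by (simp add: prod.reindex)
qed

lemma measurable_matrix_vector_mult [measurable]:
  fixes A :: "real^'n^'m"
  shows "(*v) A \<in> borel_measurable borel"
  by (intro borel_measurable_continuous_onI linear_continuous_on matrix_vector_mul_bounded_linear)

text \<open>Lebesgue measure is determined by its values on boxes. The preimage of a box under a
  coordinate swap is the box with swapped sides, which has the same product of side lengths.\<close>

lemma nn_integral_lborel_swap: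
  fixes h :: "real^'n \<Rightarrow> ennreal"
  assumes [measurable]: "h \<in> borel_measurable borel"
  shows "(\<integral>\<^sup>+x. h (\<chi> i. x $ Transposition.transpose m n i) \<partial>lborel) = (\<integral>\<^sup>+x. h x \<partial>lborel)"
proof -
  let ?t = "Transposition.transpose m n"
  let ?T = "\<lambda>x::real^'n. \<chi> i. x $ ?t i"
  have lin: "linear ?T"
    by (rule linearI) (simp_all add: plus_vec_def scaleR_vec_def)
  then have [measurable]: "?T \<in> borel_measurable borel"
    by (intro borel_measurable_continuous_onI linear_continuous_on linear_conv_bounded_linear[THEN iffD1])
  have "lborel = distr lborel borel ?T"
  proof (rule lborel_eqI)
    fix l u :: "real^'n" assume lu: "\<And>b. b \<in> Basis \<Longrightarrow> l \<bullet> b \<le> u \<bullet> b"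
    have lu': "l $ i \<le> u $ i" for i using lu[of "axis i 1"] by (simp add: Basis_vec_real inner_axis)
    have *: "?T x \<in> box l u \<longleftrightarrow> x \<in> box (?T l) (?T u)" for x
    proof
      assume "?T x \<in> box l u"
      then have "l $ i < x $ ?t i \<and> x $ ?t i < u $ i" for i by (simp add: mem_box_cart)
      from this[of "?t _"] show "x \<in> box (?T l) (?T u)" by (simp add: mem_box_cart)
    next
      assume "x \<in> box (?T l) (?T u)"
      then have "l $ ?t i < x $ i \<and> x $ i < u $ ?t i" for i by (simp add: mem_box_cart)
      from this[of "?t _"] show "?T x \<in> box l u" by (simp add: mem_box_cart)
    qed
    have "emeasure (distr lborel borel ?T) (box l u) = emeasure lborel (?T -` box l u)"
      by (subst emeasure_distr) auto
    also have "?T -` box l u = box (?T l) (?T u)" using * by blast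
    also have "emeasure lborel \<dots> = ennreal (\<Prod>b\<in>Basis. (?T u - ?T l) \<bullet> b)"
      using lu' by (intro emeasure_lborel_box) (auto simp: Basis_vec_real inner_axis)
    also have "(\<Prod>b\<in>Basis. (?T u - ?T l) \<bullet> b) = (\<Prod>i\<in>UNIV. (u - l) $ ?t i)"
      by (simp add: prod_Basis_vec inner_axis)
    also have "\<dots> = (\<Prod>i\<in>UNIV. (u - l) $ i)"
      using prod.permute[OF permutes_swap_id[of m UNIV n], of "\<lambda>i. (u - l) $ i"] by (simp add: o_def)
    finally show "emeasure (distr lborel borel ?T) (box l u) = (\<Prod>b\<in>Basis. (u - l) \<bullet> b)"
      by (simp add: prod_Basis_vec inner_axis)
  qed simp
  then have "(\<integral>\<^sup>+x. h x \<partial>lborel) = (\<integral>\<^sup>+x. h x \<partial>distr lborel borel ?T)" by (rule arg_cong)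
  also have "\<dots> = (\<integral>\<^sup>+x. h (?T x) \<partial>lborel)" by (subst nn_integral_distr) auto
  finally show ?thesis ..
qed

text \<open>With the other coordinates fixed, the shear translates coordinate \<open>m\<close> by
  the value of coordinate \<open>n\<close>, a constant because \<open>m\<close> and \<open>n\<close>
  differ. Integrating over coordinate \<open>m\<close> innermost reduces it to translation
  invariance on the line.\<close>

lemma nn_integral_lborel_shear:
  fixes h :: "real^'n \<Rightarrow> ennreal"
  assumes [measurable]: "h \<in> borel_measurable borel" and mn: "m \<noteq> n"
  shows "(\<integral>\<^sup>+x. h (\<chi> i. if i = m then x $ m + x $ n else x $ i) \<partial>lborel) = (\<integral>\<^sup>+x. h x \<partial>lborel)"
proof -
  let ?T = "\<lambda>x::real^'n. \<chi> i. if i = m then x $ m + x $ n else x $ i"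
  have lin: "linear ?T"
    by (rule linearI) (auto simp: algebra_simps plus_vec_def scaleR_vec_def vec_eq_iff)
  then have T[measurable]: "?T \<in> borel_measurable borel"
    by (intro borel_measurable_continuous_onI linear_continuous_on linear_conv_bounded_linear[THEN iffD1])
  interpret product_sigma_finite "\<lambda>_::real^'n. lborel :: real measure" ..
  let ?bm = "axis m 1 :: real^'n" and ?bn = "axis n 1 :: real^'n"
  let ?B = "Basis - {?bm}"
  have B: "Basis = insert ?bm ?B" "?bm \<notin> ?B" "finite ?B" by (auto simp: Basis_vec_real)
  let ?S = "\<lambda>g. \<Sum>b\<in>Basis. g b *\<^sub>R (b :: real^'n)"
  have S: "?S \<in> Pi\<^sub>M Basis (\<lambda>_. lborel) \<rightarrow>\<^sub>M borel" by measurable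
  have Si: "?S g $ i = g (axis i 1)" for g i
  proof -
    have "?S g \<bullet> axis i 1 = g (axis i 1)" by (rule inner_sum_left_Basis) (auto simp: Basis_vec_real)
    then show ?thesis by (simp only: inner_axis inner_real_def mult_1_right)
  qed
  have TS: "?T (?S (g(?bm := y))) = ?S (g(?bm := y + g ?bn))" for g y
    unfolding Si using mn by (subst vec_eq_iff) (simp only: vec_lambda_beta Si, auto simp: axis_eq_axis)
  have 1: "(\<integral>\<^sup>+x. k x \<partial>lborel) = (\<integral>\<^sup>+g. \<integral>\<^sup>+y. k (?S (g(?bm := y))) \<partial>lborel \<partial>Pi\<^sub>M ?B (\<lambda>_. lborel))"
    if k[measurable]: "k \<in> borel_measurable borel" for k :: "real^'n \<Rightarrow> ennreal"
  proof -
    have "(\<integral>\<^sup>+x. k x \<partial>lborel) = (\<integral>\<^sup>+x. k x \<partial>distr (Pi\<^sub>M Basis (\<lambda>_. lborel)) borel ?S)"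
      by (simp only: lborel_eq[symmetric])
    also have "\<dots> = (\<integral>\<^sup>+g. k (?S g) \<partial>Pi\<^sub>M Basis (\<lambda>_. lborel))"
      using S by (intro nn_integral_distr) auto
    also have "\<dots> = (\<integral>\<^sup>+g. k (?S g) \<partial>Pi\<^sub>M (insert ?bm ?B) (\<lambda>_. lborel))"
      using B(1) by (simp only:)
    also have "\<dots> = (\<integral>\<^sup>+g. \<integral>\<^sup>+y. k (?S (g(?bm := y))) \<partial>lborel \<partial>Pi\<^sub>M ?B (\<lambda>_. lborel))"
    proof (rule product_nn_integral_insert[OF B(3,2)])
      show "(\<lambda>g. k (?S g)) \<in> borel_measurable (Pi\<^sub>M (insert ?bm ?B) (\<lambda>_. lborel))"
        unfolding B(1)[symmetric] using measurable_compose[OF S k] .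
    qed
    finally show ?thesis .
  qed
  have "(\<integral>\<^sup>+x. h (?T x) \<partial>lborel) = (\<integral>\<^sup>+g. \<integral>\<^sup>+y. h (?S (g(?bm := y + g ?bn))) \<partial>lborel \<partial>Pi\<^sub>M ?B (\<lambda>_. lborel))"
    by (subst 1) (simp_all only: TS, measurable)
  also have "\<dots> = (\<integral>\<^sup>+g. \<integral>\<^sup>+y. h (?S (g(?bm := y))) \<partial>lborel \<partial>Pi\<^sub>M ?B (\<lambda>_. lborel))"
  proof (rule arg_cong[where f = "integral\<^sup>N _"], rule ext)
    fix g :: "real^'n \<Rightarrow> real"
    have "?S (g(?bm := y)) = y *\<^sub>R ?bm + (\<Sum>b\<in>?B. g b *\<^sub>R b)" for y
    proof -
      have "?S (g(?bm := y)) = (\<Sum>b\<in>insert ?bm ?B. (g(?bm := y)) b *\<^sub>R b)"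
        using B(1) by (simp only:)
      also have "\<dots> = y *\<^sub>R ?bm + (\<Sum>b\<in>?B. (g(?bm := y)) b *\<^sub>R b)"
        by (subst sum.insert[OF B(3,2)]) simp
      also have "(\<Sum>b\<in>?B. (g(?bm := y)) b *\<^sub>R b) = (\<Sum>b\<in>?B. g b *\<^sub>R b)"
        by (intro sum.cong) auto
      finally show ?thesis .
    qed
    then have "(\<lambda>y. h (?S (g(?bm := y)))) \<in> borel_measurable borel"
      by (simp only:) measurable
    from nn_integral_lborel_translate[OF this, of "g ?bn"]
    show "(\<integral>\<^sup>+y. h (?S (g(?bm := y + g ?bn))) \<partial>lborel) = (\<integral>\<^sup>+y. h (?S (g(?bm := y))) \<partial>lborel)" .
  qed
  also have "\<dots> = (\<integral>\<^sup>+x. h x \<partial>lborel)" by (subst 1) auto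
  finally show ?thesis .
qed

theorem nn_integral_lborel_matrix:
  fixes A :: "real^'n^'n" and h :: "real^'n \<Rightarrow> ennreal"
  assumes "det A \<noteq> 0" "h \<in> borel_measurable borel"
  shows "ennreal \<bar>det A\<bar> * (\<integral>\<^sup>+x. h (A *v x) \<partial>lborel) = (\<integral>\<^sup>+x. h x \<partial>lborel)"
proof -
  \<comment> \<open>The condition on the determinant stays inside the induction as an implication.
    It is vacuous for matrices with a zero row, and for a product it passes to both factors by
    multiplicativity. Diagonal matrices, swaps and shears are the remaining generators.\<close>
  have "det A \<noteq> 0 \<longrightarrow> (\<forall>h\<in>borel_measurable borel. ennreal \<bar>det A\<bar> * (\<integral>\<^sup>+x. h (A *v x) \<partial>lborel) = (\<integral>\<^sup>+x. h x \<partial>lborel))"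
  proof (induction A rule: induct_matrix_elementary_alt)
    case (1 A B)
    show ?case
    proof (intro impI ballI)
      fix h :: "real^'n \<Rightarrow> ennreal"
      assume AB: "det (A ** B) \<noteq> 0" and h[measurable]: "h \<in> borel_measurable borel"
      have m: "(\<lambda>x. h (A *v x)) \<in> borel_measurable borel" by measurable
      have "ennreal \<bar>det (A ** B)\<bar> * (\<integral>\<^sup>+x. h ((A ** B) *v x) \<partial>lborel)
          = ennreal \<bar>det A\<bar> * (ennreal \<bar>det B\<bar> * (\<integral>\<^sup>+x. h (A *v (B *v x)) \<partial>lborel))"
        by (simp add: det_mul abs_mult ennreal_mult mult.assoc matrix_vector_mul_assoc)
      also have "\<dots> = (\<integral>\<^sup>+x. h x \<partial>lborel)"
      proof -
        have nz: "det A \<noteq> 0" "det B \<noteq> 0" using AB by (auto simp: det_mul)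
        show ?thesis
          using 1(2)[THEN mp, OF nz(2), THEN bspec, OF m] 1(1)[THEN mp, OF nz(1), THEN bspec, OF h] by (simp only:)
      qed
      finally show "ennreal \<bar>det (A ** B)\<bar> * (\<integral>\<^sup>+x. h ((A ** B) *v x) \<partial>lborel) = (\<integral>\<^sup>+x. h x \<partial>lborel)" .
    qed
  next
    case (2 A i)
    then show ?case by (metis det_zero_row(2) row_def)
  next
    case (3 A)
    show ?case
    proof (intro impI ballI)
      fix h :: "real^'n \<Rightarrow> ennreal"
      assume A: "det A \<noteq> 0" and h[measurable]: "h \<in> borel_measurable borel"
      have det: "det A = (\<Prod>i\<in>UNIV. A $ i $ i)" using 3 by (rule det_diagonal)
      then have nz: "A $ i $ i \<noteq> 0" for i using A by auto
      let ?c = "\<lambda>b. (A *v b) \<bullet> b"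
      have c: "?c (axis i 1) = A $ i $ i" for i
        by (simp add: inner_axis matrix_vector_mult_basis column_def)
      have Av: "A *v x = 0 + (\<Sum>b\<in>Basis. (?c b * (x \<bullet> b)) *\<^sub>R b)" for x
      proof (rule vec_eq_iff[THEN iffD2], rule allI)
        fix i
        have "(\<Sum>b\<in>Basis. (?c b * (x \<bullet> b)) *\<^sub>R b) \<bullet> axis i 1 = ?c (axis i 1) * (x \<bullet> axis i 1)"
          by (rule inner_sum_left_Basis) (auto simp: Basis_vec_real)
        moreover have "(A *v x) $ i = A $ i $ i * x $ i"
        proof -
          have "(A *v x) $ i = (\<Sum>j\<in>UNIV. if j = i then A $ i $ i * x $ i else 0)"
            unfolding matrix_vector_mult_def vec_lambda_beta using 3 by (intro sum.cong) auto
          then show ?thesis by simp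
        qed
        ultimately show "(A *v x) $ i = (0 + (\<Sum>b\<in>Basis. (?c b * (x \<bullet> b)) *\<^sub>R b)) $ i"
          unfolding c by (simp only: inner_axis inner_real_def mult_1_right add_0)
      qed
      have "lborel = density (distr lborel borel (\<lambda>x. 0 + (\<Sum>b\<in>Basis. (?c b * (x \<bullet> b)) *\<^sub>R b))) (\<lambda>_. \<Prod>b\<in>Basis. \<bar>?c b\<bar>)"
      proof (rule lborel_affine_euclidean)
        show "?c b \<noteq> 0" if "b \<in> Basis" for b using that nz c by (auto simp: Basis_vec_real)
      qed
      then have "lborel = density (distr lborel borel ((*v) A)) (\<lambda>_. ennreal \<bar>det A\<bar>)"
        unfolding Av[symmetric] by (simp add: prod_Basis_vec c det abs_prod)
      then have "(\<integral>\<^sup>+x. h x \<partial>lborel) = (\<integral>\<^sup>+x. h x \<partial>density (distr lborel borel ((*v) A)) (\<lambda>_. ennreal \<bar>det A\<bar>))"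
        by (rule arg_cong)
      also have "\<dots> = ennreal \<bar>det A\<bar> * (\<integral>\<^sup>+x. h (A *v x) \<partial>lborel)"
        by (simp add: nn_integral_density nn_integral_distr nn_integral_cmult)
      finally show "ennreal \<bar>det A\<bar> * (\<integral>\<^sup>+x. h (A *v x) \<partial>lborel) = (\<integral>\<^sup>+x. h x \<partial>lborel)" ..
    qed
  next
    case (4 m n)
    let ?A = "(\<chi> i j. mat 1 $ i $ Transposition.transpose m n j) :: real^'n^'n"
    have "\<bar>det ?A\<bar> = 1"
      using det_permute_columns[OF permutes_swap_id[of m UNIV n], of "mat 1 :: real^'n^'n"] by (simp add: sign_swap_id abs_mult)
    moreover have "?A *v x = (\<chi> i. x $ Transposition.transpose m n i)" for x
    proof -
      have "(\<Sum>j\<in>UNIV. (if i = Transposition.transpose m n j then 1 else 0) * x $ j) = x $ Transposition.transpose m n i" for i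
      proof -
        have "(\<Sum>j\<in>UNIV. (if i = Transposition.transpose m n j then 1 else 0) * x $ j)
            = (\<Sum>j\<in>UNIV. if j = Transposition.transpose m n i then x $ j else 0)"
          by (intro sum.cong) (auto simp: transpose_eq_iff)
        then show ?thesis by simp
      qed
      then show ?thesis by (simp add: vec_eq_iff matrix_vector_mult_def mat_def)
    qed
    ultimately show ?case by (simp add: nn_integral_lborel_swap)
  next
    case (5 m n)
    let ?A = "(\<chi> i j. of_bool (i = m \<and> j = n \<or> i = j)) :: real^'n^'n"
    have "?A = (\<chi> k. if k = m then row m (mat 1) + 1 *s row n (mat 1) else row k (mat 1))"
      using 5 by (auto simp: vec_eq_iff row_def mat_def)
    then have "det ?A = 1"
      using det_row_operation[OF 5, of "mat 1 :: real^'n^'n" 1] by (simp only:) simp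
    moreover have "?A *v x = (\<chi> i. if i = m then x $ m + x $ n else x $ i)" for x
    proof -
      have "(\<Sum>j\<in>UNIV. of_bool (i = m \<and> j = n \<or> i = j) * x $ j) = (if i = m then x $ m + x $ n else x $ i)" for i
      proof -
        have "(\<Sum>j\<in>UNIV. of_bool (i = m \<and> j = n \<or> i = j) * x $ j)
            = (\<Sum>j\<in>UNIV. (if j = n then if i = m then x $ n else 0 else 0) + (if j = i then x $ i else 0))"
          using 5 by (intro sum.cong) auto
        then show ?thesis by (simp add: sum.distrib)
      qed
      then show ?thesis by (simp add: vec_eq_iff matrix_vector_mult_def)
    qed
    ultimately show ?case using 5 by (simp add: nn_integral_lborel_shear)
  qed
  with assms show ?thesis by blast
qed

lemma lborel_distr_matrix:
  fixes V :: "real^'n^'n"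
  assumes "\<bar>det V\<bar> = 1"
  shows "distr lborel borel ((*v) V) = lborel"
proof (rule measure_eqI)
  fix S assume "S \<in> sets (distr lborel borel ((*v) V))"
  then have [measurable]: "S \<in> sets borel" by simp
  have "emeasure (distr lborel borel ((*v) V)) S = (\<integral>\<^sup>+x. indicator S x \<partial>distr lborel borel ((*v) V))"
    by simp
  also have "\<dots> = (\<integral>\<^sup>+x. indicator S (V *v x) \<partial>lborel)"
    by (subst nn_integral_distr) auto
  also have "\<dots> = (\<integral>\<^sup>+x. indicator S x \<partial>lborel)"
    using nn_integral_lborel_matrix[of V "indicator S"] assms by (cases "det V = 0") auto
  also have "\<dots> = emeasure lborel S" by simp
  finally show "emeasure (distr lborel borel ((*v) V)) S = emeasure lborel S" .
qed simp

section \<open>The theta function of a shifted lattice\<close>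

lemma matrix_inv_right_left:
  fixes A :: "real^'n^'n"
  assumes "det A \<noteq> 0"
  shows "A ** matrix_inv A = mat 1" "matrix_inv A ** A = mat 1"
proof -
  have "\<exists>A'. A ** A' = mat 1 \<and> A' ** A = mat 1"
    using assms unfolding invertible_det_nz[symmetric] invertible_def .
  from someI_ex[OF this] show "A ** matrix_inv A = mat 1" "matrix_inv A ** A = mat 1"
    unfolding matrix_inv_def by blast+
qed

text \<open>An invertible matrix is bounded below, and |m| \<le> m^2 for integers. The bound is
  linear in the |k i| on purpose: its exponential is a product of geometric terms, summable by
  \<open>integrable_powabs_prod\<close>.\<close>

lemma matrix_ivec_bound:
  fixes A :: "real^'n^'n"
  assumes "det A \<noteq> 0"
  obtains c where "c > 0" "\<And>k. c * (\<Sum>i\<in>UNIV. real (nat \<bar>k i\<bar>)) \<le> (norm (A *v ivec k))\<^sup>2"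
proof -
  have "inj ((*v) A)"
    using assms by (simp add: inj_matrix_vector_mult invertible_det_nz)
  then obtain B where B: "B > 0" "\<And>x. B * norm x \<le> norm (A *v x)"
    using linear_inj_bounded_below_pos[OF matrix_vector_mul_linear[of A]] by blast
  have "B\<^sup>2 * (\<Sum>i\<in>UNIV. real (nat \<bar>k i\<bar>)) \<le> (norm (A *v ivec k))\<^sup>2" for k
  proof -
    have "(\<Sum>i\<in>UNIV. real (nat \<bar>k i\<bar>)) \<le> (\<Sum>i\<in>UNIV. (real_of_int (k i))\<^sup>2)"
    proof (rule sum_mono)
      fix i
      have "\<bar>k i\<bar> * 1 \<le> \<bar>k i\<bar> * \<bar>k i\<bar>" by (cases "k i = 0") (simp, intro mult_left_mono, auto)
      then have "\<bar>k i\<bar> \<le> (k i)\<^sup>2" by (simp add: power2_eq_square)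
      then have "real_of_int \<bar>k i\<bar> \<le> real_of_int ((k i)\<^sup>2)" by (simp only: of_int_le_iff)
      then show "real (nat \<bar>k i\<bar>) \<le> (real_of_int (k i))\<^sup>2" by simp
    qed
    also have "\<dots> = (norm (ivec k))\<^sup>2"
      unfolding power2_norm_eq_inner inner_vec_def by (simp add: power2_eq_square)
    finally have "B\<^sup>2 * (\<Sum>i\<in>UNIV. real (nat \<bar>k i\<bar>)) \<le> (B * norm (ivec k))\<^sup>2"
      by (simp add: power_mult_distrib mult_left_mono)
    also have "\<dots> \<le> (norm (A *v ivec k))\<^sup>2"
      using B by (intro power_mono) auto
    finally show ?thesis .
  qed
  with B(1) show ?thesis by (intro that[of "B\<^sup>2"]) auto
qed

text \<open>With a = A k one has |a|^2 \<le> 2 |q + a|^2 + 2 |q|^2. The shift thus costs half of the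
  rate c and the factor exp (u |q|^2).\<close>

lemma gauss_sum_bound:
  fixes A :: "real^'n^'n"
  assumes c: "c * (\<Sum>i\<in>UNIV. real (nat \<bar>k i\<bar>)) \<le> (norm (A *v ivec k))\<^sup>2" and u: "0 < u"
  shows "exp (- ((norm (q + A *v ivec k))\<^sup>2 * u)) \<le> exp (u * (norm q)\<^sup>2) * (\<Prod>i\<in>UNIV. exp (- (u * c / 2)) ^ nat \<bar>k i\<bar>)"
proof -
  have "(norm (A *v ivec k))\<^sup>2 \<le> 2 * (norm (q + A *v ivec k))\<^sup>2 + 2 * (norm q)\<^sup>2"
  proof -
    have "norm (A *v ivec k) \<le> norm (q + A *v ivec k) + norm q"
      using norm_triangle_ineq4[of "q + A *v ivec k" q] by simp
    then have "(norm (A *v ivec k))\<^sup>2 \<le> (norm (q + A *v ivec k) + norm q)\<^sup>2"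
      by (intro power_mono) auto
    also have "\<dots> \<le> 2 * (norm (q + A *v ivec k))\<^sup>2 + 2 * (norm q)\<^sup>2"
      using sum_squares_bound[of "norm (q + A *v ivec k)" "norm q"] by (simp add: power2_sum)
    finally show ?thesis .
  qed
  with c have "c / 2 * (\<Sum>i\<in>UNIV. real (nat \<bar>k i\<bar>)) - (norm q)\<^sup>2 \<le> (norm (q + A *v ivec k))\<^sup>2"
    by simp
  from mult_left_mono[OF this, of u] u
  have "exp (- ((norm (q + A *v ivec k))\<^sup>2 * u)) \<le> exp (u * (norm q)\<^sup>2 + - (u * c / 2) * (\<Sum>i\<in>UNIV. real (nat \<bar>k i\<bar>)))"
    by (simp add: algebra_simps)
  also have "\<dots> = exp (u * (norm q)\<^sup>2) * (\<Prod>i\<in>UNIV. exp (- (u * c / 2)) ^ nat \<bar>k i\<bar>)"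
    unfolding exp_add sum_distrib_left exp_sum[OF finite_class.finite_UNIV]
    by (simp add: exp_of_nat_mult[symmetric] mult.commute)
  finally show ?thesis .
qed

lemma integrable_gauss_sum:
  fixes A :: "real^'n^'n"
  assumes A: "det A \<noteq> 0" and u: "0 < u"
  shows "integrable (count_space UNIV) (\<lambda>k. exp (- ((norm (q + A *v ivec k))\<^sup>2 * u)))"
proof -
  obtain c where c: "c > 0" "\<And>k. c * (\<Sum>i\<in>UNIV. real (nat \<bar>k i\<bar>)) \<le> (norm (A *v ivec k))\<^sup>2"
    using matrix_ivec_bound[OF A] by blast
  show ?thesis
  proof (rule Bochner_Integration.integrable_bound)
    show "integrable (count_space UNIV) (\<lambda>k::'n \<Rightarrow> int. exp (u * (norm q)\<^sup>2) * (\<Prod>i\<in>UNIV. exp (- (u * c / 2)) ^ nat \<bar>k i\<bar>))"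
      using u c by (intro integrable_mult_right integrable_powabs_prod) auto
    show "AE k in count_space UNIV. norm (exp (- ((norm (q + A *v ivec k))\<^sup>2 * u)))
        \<le> norm (exp (u * (norm q)\<^sup>2) * (\<Prod>i\<in>UNIV. exp (- (u * c / 2)) ^ nat \<bar>k i\<bar>))"
      using gauss_sum_bound[OF c(2) u, of q] by (intro AE_I2) (auto intro: order_trans[OF _ abs_ge_self])
  qed simp
qed

text \<open>Only finitely many lattice points lie in the unit ball around -q, so the infimum is a
  minimum of positive numbers.\<close>

lemma lattice_norm_bounded_below:
  fixes A :: "real^'n^'n"
  assumes A: "det A \<noteq> 0" and q: "\<And>k. q + A *v ivec k \<noteq> 0"
  obtains c where "c > 0" "\<And>k. c \<le> (norm (q + A *v ivec k))\<^sup>2"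
proof -
  obtain c where c: "c > 0" "\<And>k. c * (\<Sum>i\<in>UNIV. real (nat \<bar>k i\<bar>)) \<le> (norm (A *v ivec k))\<^sup>2"
    using matrix_ivec_bound[OF A] by blast
  let ?F = "{k. (norm (q + A *v ivec k))\<^sup>2 \<le> 1}"
  \<comment> \<open>A point of \<open>?F\<close> satisfies |A k| \<le> 1 + |q|, and the linear lower
    bound with constant c then confines every coordinate to {-R..R}.\<close>
  define R where "R = \<lceil>(1 + norm q)\<^sup>2 / c\<rceil>"
  have "?F \<subseteq> PiE UNIV (\<lambda>_. {-R..R})"
  proof
    fix k assume "k \<in> ?F"
    then have "norm (q + A *v ivec k) \<le> 1" by (simp add: abs_square_le_1)
    then have "norm (A *v ivec k) \<le> 1 + norm q"
      using norm_triangle_ineq4[of "q + A *v ivec k" q] by simp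
    then have "(norm (A *v ivec k))\<^sup>2 \<le> (1 + norm q)\<^sup>2" by (intro power_mono) auto
    with c(2)[of k] have "c * (\<Sum>i\<in>UNIV. real (nat \<bar>k i\<bar>)) \<le> (1 + norm q)\<^sup>2" by linarith
    then have S: "(\<Sum>i\<in>UNIV. real (nat \<bar>k i\<bar>)) \<le> (1 + norm q)\<^sup>2 / c"
      using c(1) by (simp add: field_simps)
    have "\<bar>k i\<bar> \<le> R" for i
    proof -
      have "real (nat \<bar>k i\<bar>) \<le> (\<Sum>i\<in>UNIV. real (nat \<bar>k i\<bar>))" by (intro member_le_sum) auto
      with S have "real_of_int \<bar>k i\<bar> \<le> (1 + norm q)\<^sup>2 / c" by simp
      also have "\<dots> \<le> of_int R" unfolding R_def by simp
      finally show ?thesis by (simp only: of_int_le_iff)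
    qed
    then show "k \<in> PiE UNIV (\<lambda>_. {-R..R})" by (auto simp: PiE_UNIV_domain abs_le_iff) (metis minus_le_iff)
  qed
  then have fin: "finite ?F" by (rule finite_subset) (intro finite_PiE; simp)
  \<comment> \<open>The inserted 1 bounds the terms outside \<open>?F\<close> and keeps the set
    nonempty.\<close>
  let ?S = "insert 1 ((\<lambda>k. (norm (q + A *v ivec k))\<^sup>2) ` ?F)"
  have "Min ?S > 0" using fin q by (subst Min_gr_iff) auto
  moreover have "Min ?S \<le> (norm (q + A *v ivec k))\<^sup>2" for k
  proof (cases "k \<in> ?F")
    case True then show ?thesis using fin by (intro Min_le) auto
  next
    case False
    have "Min ?S \<le> 1" using fin by (intro Min_le) auto
    with False show ?thesis by simp
  qed
  ultimately show ?thesis using that by blast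
qed

text \<open>Instantiated once for each ordered pair of distinct points, with \<open>q\<close> their
  difference.\<close>

locale shifted_lattice =
  fixes V :: "real^'n^'n" and q :: "real^'n"
  assumes det_V: "det V = 1" and q_notin: "q \<notin> lattice_of V"
begin

text \<open>The columns of this matrix are the basis dual to the columns of \<open>V\<close>; it
  generates the dual lattice.\<close>

definition W :: "real^'n^'n" where "W = transpose (matrix_inv V)"

text \<open>For fixed k this is a character of the additive semigroup:
  \<open>E k (s + t) = E k s * E k t\<close>. This turns integrals against a convolution into
  products.\<close>

definition E :: "('n \<Rightarrow> int) \<Rightarrow> real \<Rightarrow> real" where
  "E k t = exp (- ((norm (q + V *v ivec k))\<^sup>2 * t))"

definition h :: "real \<Rightarrow> real" where
  "h t = pi powr (CARD('n) / 2) / t powr (CARD('n) / 2)"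

definition D :: "('n \<Rightarrow> int) \<Rightarrow> real \<Rightarrow> real" where
  "D m t = h t * exp (- (pi\<^sup>2 * (norm (W *v ivec m))\<^sup>2 / t))"

definition ph :: "('n \<Rightarrow> int) \<Rightarrow> complex" where
  "ph m = cis (2 * pi * ((W *v ivec m) \<bullet> q))"

definition \<Theta> :: "real \<Rightarrow> real" where
  "\<Theta> t = (\<integral>k. E k t \<partial>count_space UNIV)"

definition G :: "real \<Rightarrow> real" where
  "G t = \<Theta> t - indicator {0<..<1} t * h t"

lemma inv_V: "V ** matrix_inv V = mat 1" "matrix_inv V ** V = mat 1"
  using matrix_inv_right_left[of V] det_V by auto

lemma W_inner: "(W *v x) \<bullet> (V *v y) = x \<bullet> y"
  by (simp add: W_def dot_lmul_matrix matrix_vector_mul_assoc inv_V)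

lemma W_transpose: "W *v (transpose V *v x) = x" "transpose V *v (W *v x) = x"
  by (simp_all only: W_def matrix_vector_mul_assoc matrix_transpose_mul[symmetric] inv_V transpose_mat matrix_vector_mul_lid)

lemma det_W: "det W \<noteq> 0"
proof -
  have "det W * det V = 1"
    using arg_cong[OF inv_V(2), of det] by (simp add: det_mul W_def det_transpose)
  then show ?thesis by auto
qed

section \<open>Integer coordinates on the lattice and its dual\<close>

lemma lattice_eq: "lattice_of V = range (\<lambda>k. V *v ivec k)"
proof -
  have "\<exists>k. x = ivec k" if "\<forall>i. x $ i \<in> \<int>" for x :: "real^'n"
    using that by (intro exI[of _ "\<lambda>i. \<lfloor>x $ i\<rfloor>"]) (simp add: vec_eq_iff)
  then show ?thesis by (force simp: lattice_of_def)
qed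

lemma inj_ivec: "inj ivec"
  by (auto simp: inj_def vec_eq_iff)

lemma inj_lattice: "inj (\<lambda>k. V *v ivec k)"
proof (rule injI)
  fix k l assume "V *v ivec k = V *v ivec l"
  then have "matrix_inv V *v (V *v ivec k) = matrix_inv V *v (V *v ivec l)" by simp
  then show "k = l" by (simp add: matrix_vector_mul_assoc inv_V inj_eq[OF inj_ivec])
qed

lemma inj_dual: "inj (\<lambda>m. W *v ivec m)"
proof (rule injI)
  fix k l assume "W *v ivec k = W *v ivec l"
  then have "transpose V *v (W *v ivec k) = transpose V *v (W *v ivec l)" by simp
  then show "k = l" by (simp only: W_transpose inj_eq[OF inj_ivec])
qed

text \<open>Pairing w with the columns of \<open>V\<close> shows that the transpose of
  \<open>V\<close> maps w to an integer vector, and \<open>W\<close> inverts that transpose. The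
  converse is the pairing identity \<open>W_inner\<close>.\<close>

lemma dual_lattice_eq: "dual_lattice V = range (\<lambda>m. W *v ivec m)"
proof (intro equalityI subsetI)
  fix w assume w: "w \<in> dual_lattice V"
  have int: "(transpose V *v w) $ i \<in> \<int>" for i
  proof -
    have "V *v axis i 1 \<in> lattice_of V" by (auto simp: lattice_of_def axis_def)
    then have "w \<bullet> (V *v axis i 1) \<in> \<int>" using w by (simp add: dual_lattice_def)
    moreover have "w \<bullet> (V *v axis i 1) = (transpose V *v w) $ i"
      by (simp add: dot_lmul_matrix[symmetric] inner_axis)
    ultimately show ?thesis by simp
  qed
  have "w = W *v ivec (\<lambda>i. \<lfloor>(transpose V *v w) $ i\<rfloor>)"
  proof -
    have "ivec (\<lambda>i. \<lfloor>(transpose V *v w) $ i\<rfloor>) = transpose V *v w"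
      using int by (simp add: vec_eq_iff del: transpose_matrix_vector)
    then show ?thesis by (simp only: W_transpose)
  qed
  then show "w \<in> range (\<lambda>m. W *v ivec m)" by blast
next
  fix w assume "w \<in> range (\<lambda>m. W *v ivec m)"
  then obtain m where "w = W *v ivec m" by blast
  moreover have "ivec m \<bullet> ivec k \<in> \<int>" for k
    by (auto simp: inner_vec_def intro!: Ints_sum)
  ultimately show "w \<in> dual_lattice V"
    by (auto simp: dual_lattice_def lattice_eq W_inner)
qed

lemma ivec_0 [simp]: "ivec (\<lambda>_. 0) = 0"
  by (simp add: vec_eq_iff)

lemma shift_nonzero: "q + V *v ivec k \<noteq> 0"
proof
  assume "q + V *v ivec k = 0"
  then have "q = - (V *v ivec k)" by (rule eq_neg_iff_add_eq_0[THEN iffD2])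
  also have "\<dots> = V *v ivec (\<lambda>i. - k i)"
  proof -
    have "ivec (\<lambda>i. - k i) = - ivec k" by (simp add: vec_eq_iff)
    then show ?thesis by (simp add: matrix_vector_mult_def vec_eq_iff sum_negf)
  qed
  finally show False using q_notin lattice_eq by blast
qed

lemma E_pos: "0 < E k t" by (simp add: E_def)

lemma h_nonneg: "0 \<le> h t" by (simp add: h_def)

lemma D_nonneg: "0 \<le> D m t" by (simp add: D_def h_nonneg)

lemma norm_ph [simp]: "norm (ph m) = 1" by (simp add: ph_def)

lemma E_measurable [measurable]: "E k \<in> borel_measurable borel"
  unfolding E_def by measurable

lemma h_measurable [measurable]: "h \<in> borel_measurable borel"
  unfolding h_def by measurable

lemma D_measurable [measurable]: "D m \<in> borel_measurable borel"
  unfolding D_def by measurable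

lemma \<Theta>_measurable [measurable]: "\<Theta> \<in> borel_measurable borel"
  unfolding \<Theta>_def by measurable

lemma G_measurable [measurable]: "G \<in> borel_measurable borel"
  unfolding G_def by measurable

lemma integrable_E: "0 < t \<Longrightarrow> integrable (count_space UNIV) (\<lambda>k. E k t)"
  unfolding E_def using det_V by (intro integrable_gauss_sum) auto

lemma integrable_D:
  assumes "0 < t"
  shows "integrable (count_space UNIV) (\<lambda>m. D m t)"
proof -
  have "integrable (count_space UNIV) (\<lambda>m. h t * exp (- ((norm (0 + W *v ivec m))\<^sup>2 * (pi\<^sup>2 / t))))"
    using assms det_W by (intro integrable_mult_right integrable_gauss_sum) auto
  then show ?thesis by (simp add: D_def mult_ac)
qed

text \<open>Poisson summation for y \<mapsto> exp (- t |q + V y|^2). Substituting z = V y + q in its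
  Fourier integral produces the phase \<open>ph m\<close> and the dual frequency \<open>W m\<close>,
  with no Jacobian since \<open>det V = 1\<close>.\<close>

theorem poisson_theta:
  assumes t: "0 < t"
  shows "complex_of_real (\<Theta> t) = (\<integral>m. ph m * complex_of_real (D m t) \<partial>count_space UNIV)"
proof -
  define A where "A y = complex_of_real (exp (- (t * (norm (q + V *v y))\<^sup>2)))" for y
  have hat: "has_bochner_integral lborel (\<lambda>y. A y * cis (- (2 * pi * (ivec m \<bullet> y)))) (ph m * complex_of_real (D m t))" for m
  proof -
    let ?w = "W *v ivec m"
    let ?g = "\<lambda>z. complex_of_real (exp (- (t * (norm z)\<^sup>2))) * cis (- (2 * pi * (?w \<bullet> z)))"
    have e: "A y * cis (- (2 * pi * (ivec m \<bullet> y))) = ph m * ?g (V *v y + q)" for y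
    proof -
      have "ivec m \<bullet> y = ?w \<bullet> (V *v y)" by (simp add: W_inner)
      then have "cis (- (2 * pi * (ivec m \<bullet> y))) = ph m * cis (- (2 * pi * (?w \<bullet> (V *v y + q))))"
        by (simp add: ph_def cis_mult inner_add_right algebra_simps)
      then show ?thesis by (simp add: A_def add.commute)
    qed
    note g = gauss_fourier_vec[OF t, of ?w]
    have gm[measurable]: "?g \<in> borel_measurable borel" by measurable
    have "has_bochner_integral lborel (\<lambda>z. ?g (z + q)) (complex_of_real ((pi / t) powr (CARD('n) / 2) * exp (- (pi\<^sup>2 * (norm ?w)\<^sup>2 / t))))"
      using g integral_lborel_translate[OF gm, of q] by (simp only: has_bochner_integral_iff)
    then have "has_bochner_integral (distr lborel borel ((*v) V)) (\<lambda>z. ?g (z + q)) (complex_of_real ((pi / t) powr (CARD('n) / 2) * exp (- (pi\<^sup>2 * (norm ?w)\<^sup>2 / t))))"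
      using det_V by (simp only: lborel_distr_matrix)
    then have "has_bochner_integral lborel (\<lambda>y. ?g (V *v y + q)) (complex_of_real ((pi / t) powr (CARD('n) / 2) * exp (- (pi\<^sup>2 * (norm ?w)\<^sup>2 / t))))"
      by (subst (asm) has_bochner_integral_iff) (simp add: has_bochner_integral_iff integrable_distr_eq integral_distr)
    also have "(pi / t) powr (CARD('n) / 2) * exp (- (pi\<^sup>2 * (norm ?w)\<^sup>2 / t)) = D m t"
      using t by (simp add: D_def h_def powr_divide)
    finally show ?thesis unfolding e by (rule has_bochner_integral_mult_right)
  qed
  obtain c where c: "c > 0" "\<And>k. c * (\<Sum>i\<in>UNIV. real (nat \<bar>k i\<bar>)) \<le> (norm (V *v ivec k))\<^sup>2"
    using matrix_ivec_bound[of V] det_V by auto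
  \<comment> \<open>Bounds |q + V y| on the cube, where |y| is at most the dimension;
    \<open>gauss_sum_bound\<close> with shift q + V y then gives a majorant independent of
    y.\<close>
  define R where "R = norm q + onorm ((*v) V) * CARD('n)"
  have "(\<integral>k. A (ivec k) \<partial>count_space UNIV) = (\<integral>m. \<integral>y. A y * cis (- (2 * pi * (ivec m \<bullet> y))) \<partial>lborel \<partial>count_space UNIV)"
  proof (rule poisson_summation[where D = "\<lambda>k. exp (t * R\<^sup>2) * (\<Prod>i\<in>UNIV. exp (- (t * c / 2)) ^ nat \<bar>k i\<bar>)"])
    show "continuous_on UNIV A"
      unfolding A_def by (intro continuous_intros matrix_vector_mult_linear_continuous_on)
    \<comment> \<open>At frequency 0 the phase is 1, so the transform computed above contains the
      integrability of \<open>A\<close>.\<close>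
    show "integrable lborel A"
      using integrable.intros[OF hat[of "\<lambda>_. 0"]] by simp
    show "integrable (count_space UNIV) (\<lambda>m. \<integral>y. A y * cis (- (2 * pi * (ivec m \<bullet> y))) \<partial>lborel)"
      unfolding has_bochner_integral_integral_eq[OF hat]
      by (rule Bochner_Integration.integrable_bound[OF integrable_D[OF t]]) (auto simp: norm_mult)
    show "integrable (count_space UNIV) (\<lambda>k::'n \<Rightarrow> int. exp (t * R\<^sup>2) * (\<Prod>i\<in>UNIV. exp (- (t * c / 2)) ^ nat \<bar>k i\<bar>))"
      using t c by (intro integrable_mult_right integrable_powabs_prod) auto
    fix k and y :: "real^'n" assume y: "\<And>i. \<bar>y $ i\<bar> \<le> 1/2"
    have "norm y \<le> (\<Sum>i\<in>UNIV. \<bar>y $ i\<bar>)" by (rule norm_le_l1_cart)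
    also have "\<dots> \<le> (\<Sum>i\<in>(UNIV::'n set). 1)" by (intro sum_mono order_trans[OF y]) auto
    finally have ny: "norm y \<le> CARD('n)" by simp
    have "norm (q + V *v y) \<le> norm q + onorm ((*v) V) * norm y"
      using onorm[OF matrix_vector_mul_bounded_linear[of V], of y] norm_triangle_ineq[of q "V *v y"] by linarith
    also have "\<dots> \<le> R"
      unfolding R_def using ny by (intro add_left_mono mult_left_mono onorm_pos_le matrix_vector_mul_bounded_linear)
    finally have "(norm (q + V *v y))\<^sup>2 \<le> R\<^sup>2" by (intro power_mono) auto
    then have R: "exp (t * (norm (q + V *v y))\<^sup>2) \<le> exp (t * R\<^sup>2)" using t by simp
    have "norm (A (y + ivec k)) = exp (- ((norm ((q + V *v y) + V *v ivec k))\<^sup>2 * t))"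
      by (simp add: A_def matrix_vector_right_distrib add.assoc mult.commute)
    also have "\<dots> \<le> exp (t * (norm (q + V *v y))\<^sup>2) * (\<Prod>i\<in>UNIV. exp (- (t * c / 2)) ^ nat \<bar>k i\<bar>)"
      by (rule gauss_sum_bound[OF c(2) t])
    also have "\<dots> \<le> exp (t * R\<^sup>2) * (\<Prod>i\<in>UNIV. exp (- (t * c / 2)) ^ nat \<bar>k i\<bar>)"
      by (intro mult_right_mono R prod_nonneg) auto
    finally show "norm (A (y + ivec k)) \<le> exp (t * R\<^sup>2) * (\<Prod>i\<in>UNIV. exp (- (t * c / 2)) ^ nat \<bar>k i\<bar>)" .
  qed
  moreover have "A (ivec k) = complex_of_real (E k t)" for k
    by (simp add: A_def E_def mult.commute)
  ultimately show ?thesis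
    unfolding \<Theta>_def by (simp add: has_bochner_integral_integral_eq[OF hat])
qed

end

section \<open>Uniform decay and right continuity of \<open>G\<close>\<close>

lemma power_div_fact_le_exp:
  fixes x :: real
  assumes "0 \<le> x"
  shows "x ^ n / fact n \<le> exp x"
proof -
  have "(\<Sum>k\<in>{n}. x ^ k /\<^sub>R fact k) \<le> (\<Sum>k. x ^ k /\<^sub>R fact k)"
    using assms exp_converges[of x] by (intro sum_le_suminf) (auto simp: sums_iff)
  then show ?thesis
    using exp_converges[of x] by (simp add: sums_iff divide_inverse mult.commute)
qed

context shifted_lattice
begin

lemma integrable_ph_D: "0 < t \<Longrightarrow> integrable (count_space UNIV) (\<lambda>m. ph m * complex_of_real (D m t))"
  by (rule Bochner_Integration.integrable_bound[OF integrable_D]) (auto simp: norm_mult)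

lemma G_dual:
  assumes t: "0 < t" "t < 1"
  shows "complex_of_real (G t) = (\<integral>m. (if m = (\<lambda>_. 0) then 0 else ph m * complex_of_real (D m t)) \<partial>count_space UNIV)"
proof -
  let ?f = "\<lambda>m. ph m * complex_of_real (D m t)"
  let ?z = "(\<lambda>_. 0) :: 'n \<Rightarrow> int"
  have z: "has_bochner_integral (count_space UNIV) (\<lambda>m. indicator {?z} m *\<^sub>R ?f ?z) (measure (count_space UNIV) {?z} *\<^sub>R ?f ?z)"
    by (rule has_bochner_integral_scaleR_left, rule has_bochner_integral_real_indicator) auto
  have "(\<integral>m. (if m = ?z then 0 else ?f m) \<partial>count_space UNIV) = (\<integral>m. ?f m - indicator {?z} m *\<^sub>R ?f ?z \<partial>count_space UNIV)"
    by (intro Bochner_Integration.integral_cong) (auto simp: indicator_def)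
  also have "\<dots> = (\<integral>m. ?f m \<partial>count_space UNIV) - (\<integral>m. indicator {?z} m *\<^sub>R ?f ?z \<partial>count_space UNIV)"
    by (rule Bochner_Integration.integral_diff[OF integrable_ph_D[OF t(1)] integrable.intros[OF z]])
  also have "(\<integral>m. indicator {?z} m *\<^sub>R ?f ?z \<partial>count_space UNIV) = complex_of_real (h t)"
    unfolding has_bochner_integral_integral_eq[OF z] by (simp add: measure_def ph_def D_def)
  finally show ?thesis
    using t poisson_theta[OF t(1)] by (simp add: G_def)
qed

text \<open>A majorant independent of t and summable in m. Part of the exponent is kept for
  summability; the rest, which for m \<noteq> 0 is at least b/t, absorbs the singularity of
  \<open>h\<close> at 0.\<close>

lemma D_bound:
  obtains K where "\<And>t m. 0 < t \<Longrightarrow> t < 1 \<Longrightarrow> m \<noteq> (\<lambda>_. 0) \<Longrightarrow> D m t \<le> K * exp (- ((norm (0 + W *v ivec m))\<^sup>2 * (pi\<^sup>2 / 2)))"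
proof -
  let ?n = "CARD('n)"
  obtain c where c: "c > 0" "\<And>k. c * (\<Sum>i\<in>UNIV. real (nat \<bar>k i\<bar>)) \<le> (norm (W *v ivec k))\<^sup>2"
    using matrix_ivec_bound[OF det_W] by blast
  define b where "b = pi\<^sup>2 * c / 2"
  have b: "b > 0" using c by (simp add: b_def)
  define K where "K = pi powr (?n / 2) * (fact ?n / b ^ ?n)"
  have "D m t \<le> K * exp (- ((norm (0 + W *v ivec m))\<^sup>2 * (pi\<^sup>2 / 2)))"
    if t: "0 < t" "t < 1" and m: "m \<noteq> (\<lambda>_. 0)" for t m
  proof -
    define X where "X = pi\<^sup>2 * (norm (W *v ivec m))\<^sup>2"
    obtain i where i: "m i \<noteq> 0" using m by auto
    have "1 \<le> real (nat \<bar>m i\<bar>)" using i by simp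
    also have "\<dots> \<le> (\<Sum>i\<in>UNIV. real (nat \<bar>m i\<bar>))" by (intro member_le_sum) auto
    finally have "c \<le> (norm (W *v ivec m))\<^sup>2"
      using c by (intro order_trans[OF _ c(2)]) auto
    then have X: "2 * b \<le> X" by (simp add: X_def b_def)
    \<comment> \<open>Half of X/t is at least X/2 because t < 1, the other half at least b/t because
      X \<ge> 2 b.\<close>
    have "X / 2 + b / t \<le> X / t"
    proof -
      have "t * X \<le> 1 * X" using t X b by (intro mult_right_mono) auto
      then have "X / 2 \<le> X / 2 / t" using t by (simp add: field_simps)
      moreover have "b / t \<le> X / 2 / t" using X t by (intro divide_right_mono) auto
      moreover have "X / 2 / t + X / 2 / t = X / t" by (simp add: field_simps)
      ultimately show ?thesis by linarith
    qed
    then have "exp (- (X / t)) \<le> exp (- (b / t)) * exp (- (X / 2))"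
      by (simp flip: exp_add)
    moreover have "h t * exp (- (b / t)) \<le> K"
    proof -
      \<comment> \<open>For t < 1 the exponent d/2 may be raised to the integer d, so that one term
        of the exponential series at b/t suffices. This is the origin of the factor d!/b^d in
        \<open>K\<close>.\<close>
      have "t powr ?n \<le> t powr (?n / 2)" using t by (intro powr_mono') auto
      then have "t ^ ?n \<le> t powr (?n / 2)" using t by (simp only: powr_realpow)
      then have "1 / t powr (?n / 2) \<le> 1 / t ^ ?n"
        using t by (intro divide_left_mono mult_pos_pos) auto
      also have "\<dots> = (1 / t) ^ ?n" by (rule power_one_over[symmetric])
      finally have "1 / t powr (?n / 2) \<le> (1 / t) ^ ?n" .
      moreover have "(1 / t) ^ ?n \<le> fact ?n / b ^ ?n * exp (b / t)"
      proof -
        have *: "P \<le> F / B * e" if "B * P / F \<le> e" "0 < B" "0 < F" for P B F e :: real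
          using that by (simp add: field_simps)
        have "(b * (1 / t)) ^ ?n / fact ?n \<le> exp (b * (1 / t))"
          using b t by (intro power_div_fact_le_exp) auto
        then show ?thesis
          unfolding power_mult_distrib using b by (intro *) auto
      qed
      ultimately have "1 / t powr (?n / 2) \<le> fact ?n / b ^ ?n * exp (b / t)" by linarith
      then have "pi powr (?n / 2) * (1 / t powr (?n / 2)) \<le> pi powr (?n / 2) * (fact ?n / b ^ ?n * exp (b / t))"
        by (intro mult_left_mono) auto
      then have "h t \<le> K * exp (b / t)" by (simp add: h_def K_def mult.assoc)
      then have "h t * exp (- (b / t)) \<le> K * exp (b / t) * exp (- (b / t))" by (intro mult_right_mono) auto
      then show ?thesis by (simp add: mult.assoc flip: exp_add)
    qed
    moreover have "h t * exp (- (X / t)) \<le> h t * (exp (- (b / t)) * exp (- (X / 2)))"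
      using calculation(1) h_nonneg by (rule mult_left_mono)
    moreover have "h t * exp (- (b / t)) * exp (- (X / 2)) \<le> K * exp (- (X / 2))"
      using calculation(2) by (rule mult_right_mono) simp
    ultimately have "h t * exp (- (X / t)) \<le> K * exp (- (X / 2))" by (simp only: mult.assoc)
    then show ?thesis by (simp add: D_def X_def mult_ac)
  qed
  then show ?thesis by (rule that)
qed

text \<open>The rate is a positive lower bound for all |q + v|^2, hence the same for every
  k.\<close>

lemma E_decay:
  obtains c where "c > 0" "\<And>s t k. 0 \<le> t \<Longrightarrow> E k (s + t) \<le> exp (- (c * t)) * E k s"
proof -
  obtain c where c: "c > 0" "\<And>k. c \<le> (norm (q + V *v ivec k))\<^sup>2"
    using lattice_norm_bounded_below[of V q] shift_nonzero det_V by auto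
  have "E k (s + t) \<le> exp (- (c * t)) * E k s" if "0 \<le> t" for s t k
    using mult_right_mono[OF c(2) that, of k] by (simp add: E_def algebra_simps flip: exp_add)
  with c(1) show ?thesis by (rule that)
qed

text \<open>Below 1 the dual expansion gives a constant bound by \<open>D_bound\<close>; from 1 on,
  \<open>G\<close> is \<Theta>, which decays from its value at 1 by \<open>E_decay\<close>.\<close>

lemma G_bound:
  obtains C c where "0 \<le> C" "0 < c" "\<And>t. 0 < t \<Longrightarrow> \<bar>G t\<bar> \<le> C * exp (- (c * t))"
proof -
  obtain K where K: "\<And>t m. 0 < t \<Longrightarrow> t < 1 \<Longrightarrow> m \<noteq> (\<lambda>_. 0) \<Longrightarrow> D m t \<le> K * exp (- ((norm (0 + W *v ivec m))\<^sup>2 * (pi\<^sup>2 / 2)))"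
    using D_bound by blast
  obtain c where c: "c > 0" "\<And>s t k. 0 \<le> t \<Longrightarrow> E k (s + t) \<le> exp (- (c * t)) * E k s"
    using E_decay by blast
  let ?S = "\<integral>m. exp (- ((norm (0 + W *v ivec m))\<^sup>2 * (pi\<^sup>2 / 2))) \<partial>count_space UNIV"
  have S: "0 \<le> ?S" by simp
  have \<Theta>1: "0 \<le> \<Theta> 1" unfolding \<Theta>_def using E_pos by (simp add: less_imp_le)
  have small: "\<bar>G t\<bar> \<le> \<bar>K\<bar> * ?S" if t: "0 < t" "t < 1" for t
  proof -
    have "\<bar>G t\<bar> = norm (complex_of_real (G t))" by simp
    also have "\<dots> \<le> (\<integral>m. \<bar>K\<bar> * exp (- ((norm (0 + W *v ivec m))\<^sup>2 * (pi\<^sup>2 / 2))) \<partial>count_space UNIV)"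
      unfolding G_dual[OF t]
    proof (rule norm_integral_le)
      show "integrable (count_space UNIV) (\<lambda>m. \<bar>K\<bar> * exp (- ((norm (0 + W *v ivec m))\<^sup>2 * (pi\<^sup>2 / 2))))"
        by (intro integrable_mult_right integrable_gauss_sum det_W) simp
      fix m
      have "K * exp (- ((norm (0 + W *v ivec m))\<^sup>2 * (pi\<^sup>2 / 2))) \<le> \<bar>K\<bar> * exp (- ((norm (0 + W *v ivec m))\<^sup>2 * (pi\<^sup>2 / 2)))"
        by (intro mult_right_mono) auto
      then show "norm (if m = (\<lambda>_. 0) then 0 else ph m * complex_of_real (D m t)) \<le> \<bar>K\<bar> * exp (- ((norm (0 + W *v ivec m))\<^sup>2 * (pi\<^sup>2 / 2)))"
        using order_trans[OF K[OF t, of m]] D_nonneg[of m t]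
        by (cases "m = (\<lambda>_. 0)") (simp, simp only: norm_mult norm_ph norm_of_real mult_1_left abs_of_nonneg if_False not_False_eq_True)
    qed
    finally show ?thesis by simp
  qed
  have large: "\<bar>G t\<bar> \<le> exp c * \<Theta> 1 * exp (- (c * t))" if t: "1 \<le> t" for t
  proof -
    have "\<bar>G t\<bar> = \<Theta> t"
      using t E_pos by (simp add: G_def \<Theta>_def less_imp_le)
    also have "\<dots> \<le> (\<integral>k. exp (- (c * (t - 1))) * E k 1 \<partial>count_space UNIV)"
      unfolding \<Theta>_def using t c(2)[of "t - 1" _ 1] by (intro integral_mono integrable_E integrable_mult_right) auto
    also have "\<dots> = exp c * \<Theta> 1 * exp (- (c * t))"
      by (simp add: \<Theta>_def algebra_simps flip: exp_add)
    finally show ?thesis .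
  qed
  \<comment> \<open>The factor exp c merges both regimes: exp (c - c t) is at least 1 for t < 1, and
    for t \<ge> 1 it is the decay measured from 1.\<close>
  have "\<bar>G t\<bar> \<le> (exp c * (\<Theta> 1 + \<bar>K\<bar> * ?S)) * exp (- (c * t))" if t: "0 < t" for t
  proof (cases "t < 1")
    case True
    have "1 \<le> exp (c - c * t)" using True c(1) by simp
    then have "\<bar>K\<bar> * ?S * 1 \<le> \<bar>K\<bar> * ?S * exp (c - c * t)"
      using S by (intro mult_left_mono mult_nonneg_nonneg) auto
    then have "\<bar>G t\<bar> \<le> \<bar>K\<bar> * ?S * exp (c - c * t)"
      using small[OF t True] by linarith
    also have "\<dots> \<le> (\<Theta> 1 + \<bar>K\<bar> * ?S) * exp (c - c * t)"
      using \<Theta>1 by (intro mult_right_mono) auto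
    also have "exp (c - c * t) = exp c * exp (- (c * t))" by (simp flip: exp_add)
    finally show ?thesis by (simp only: mult_ac)
  next
    case False
    then have "\<bar>G t\<bar> \<le> exp c * \<Theta> 1 * exp (- (c * t))" by (intro large) simp
    also have "\<dots> \<le> (exp c * (\<Theta> 1 + \<bar>K\<bar> * ?S)) * exp (- (c * t))"
      using S by (intro mult_right_mono mult_left_mono) auto
    finally show ?thesis .
  qed
  moreover have "0 \<le> exp c * (\<Theta> 1 + \<bar>K\<bar> * ?S)" using \<Theta>1 S by simp
  ultimately show ?thesis using c(1) by (intro that)
qed

lemma G_right_continuous:
  assumes s: "0 < s" and X: "\<And>n. 0 < X n" "X \<longlonglongrightarrow> 0"
  shows "(\<lambda>n. G (s + X n)) \<longlonglongrightarrow> G s"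
  unfolding G_def
proof (rule tendsto_diff)
  show "(\<lambda>n. \<Theta> (s + X n)) \<longlonglongrightarrow> \<Theta> s"
    unfolding \<Theta>_def
  proof (rule integral_dominated_convergence[where w = "\<lambda>k. E k s"])
    show "AE k in count_space UNIV. (\<lambda>n. E k (s + X n)) \<longlonglongrightarrow> E k s"
    proof (rule AE_I2)
      fix k
      have "(\<lambda>n. E k (s + X n)) \<longlonglongrightarrow> E k (s + 0)"
        unfolding E_def using X(2) by (intro tendsto_intros)
      then show "(\<lambda>n. E k (s + X n)) \<longlonglongrightarrow> E k s" by simp
    qed
    \<comment> \<open>Each \<open>E k\<close> decreases in time, so the summable values at
      \<open>s\<close> dominate everything to the right of it.\<close>
    show "AE k in count_space UNIV. norm (E k (s + X n)) \<le> E k s" for n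
    proof (rule AE_I2)
      fix k
      have "(norm (q + V *v ivec k))\<^sup>2 * s \<le> (norm (q + V *v ivec k))\<^sup>2 * (s + X n)"
        using X(1)[of n] by (intro mult_left_mono) auto
      then show "norm (E k (s + X n)) \<le> E k s" by (simp add: E_def)
    qed
  qed (use integrable_E[OF s] in auto)
  show "(\<lambda>n. indicator {0<..<1} (s + X n) * h (s + X n)) \<longlonglongrightarrow> indicator {0<..<1} s * h s"
  proof (cases "s < 1")
    case True
    have "(\<lambda>n. s + X n) \<longlonglongrightarrow> s + 0" using X(2) by (intro tendsto_intros)
    then have l: "(\<lambda>n. s + X n) \<longlonglongrightarrow> s" by simp
    have "(\<lambda>n. h (s + X n)) \<longlonglongrightarrow> h s"
      unfolding h_def using s by (intro tendsto_intros l) auto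
    moreover have "eventually (\<lambda>n. h (s + X n) = indicator {0<..<1} (s + X n) * h (s + X n)) sequentially"
      using order_tendstoD(2)[OF l True] by eventually_elim (use s X(1) in \<open>simp add: add_pos_pos\<close>)
    ultimately show ?thesis
      using True s by (simp add: tendsto_cong)
  next
    case False
    then have "\<not> s + X n < 1" for n using X(1)[of n] by simp
    with False show ?thesis by simp
  qed
qed

end

section \<open>Measures with finite Laplace transform\<close>

text \<open>What the two parts of the measure of \<open>f\<close> and the measures of all
  \<open>g a\<close> have in common. The value c = 0 is excluded because the total mass may be
  infinite.\<close>

definition laplace_measure :: "real measure \<Rightarrow> bool" where
  "laplace_measure M \<longleftrightarrow> sets M = sets half_line \<and>
     (\<forall>c>0. (\<integral>\<^sup>+t. ennreal (exp (- (c * t))) \<partial>M) < \<infinity>)"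

lemma
  assumes M: "laplace_measure M"
  shows laplace_measure_sets: "sets M = sets half_line"
    and laplace_measure_space: "space M = {0<..}"
    and laplace_measure_measurable: "f \<in> borel_measurable borel \<Longrightarrow> f \<in> borel_measurable M"
    and laplace_measure_integrable: "0 < c \<Longrightarrow> integrable M (\<lambda>t. exp (- (c * t)))"
proof -
  show s: "sets M = sets half_line" using M by (simp add: laplace_measure_def)
  show "space M = {0<..}" using sets_eq_imp_space_eq[OF s] by (simp add: space_restrict_space)
  have m: "f \<in> borel_measurable M" if "f \<in> borel_measurable borel" for f :: "real \<Rightarrow> 'b::topological_space"
    using that unfolding measurable_cong_sets[OF s refl] by (rule measurable_restrict_space1)
  then show "f \<in> borel_measurable borel \<Longrightarrow> f \<in> borel_measurable M" .
  have e: "(\<lambda>t. exp (- (c * t))) \<in> borel_measurable M" for c :: real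
    unfolding measurable_cong_sets[OF s refl] by (rule measurable_restrict_space1) measurable
  show "0 < c \<Longrightarrow> integrable M (\<lambda>t. exp (- (c * t)))"
    using M e by (auto simp: laplace_measure_def intro!: integrableI_bounded)
qed

lemma laplace_measure_ident: "laplace_measure M \<Longrightarrow> (\<lambda>t. t) \<in> M \<rightarrow>\<^sub>M borel"
  by (rule laplace_measure_measurable) auto

text \<open>On (0,n] the function exp (n - t) is at least 1, so these sets have finite
  measure.\<close>

lemma laplace_measure_sigma_finite:
  assumes M: "laplace_measure M"
  shows "sigma_finite_measure M"
proof
  let ?A = "\<lambda>n::nat. {0<..real n}"
  have "emeasure M (?A n) \<noteq> \<infinity>" for n
  proof -
    have m: "?A n \<in> sets M"
      unfolding laplace_measure_sets[OF M] by (auto simp: sets_restrict_space intro!: image_eqI[of _ _ "?A n"])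
    have "emeasure M (?A n) = (\<integral>\<^sup>+t. indicator (?A n) t \<partial>M)" using m by simp
    also have "\<dots> \<le> (\<integral>\<^sup>+t. ennreal (exp n) * ennreal (exp (- (1 * t))) \<partial>M)"
      by (intro nn_integral_mono) (auto simp: indicator_def simp flip: ennreal_mult exp_add)
    also have "\<dots> = ennreal (exp n) * (\<integral>\<^sup>+t. ennreal (exp (- (1 * t))) \<partial>M)"
      by (intro nn_integral_cmult laplace_measure_measurable[OF M]) measurable
    also have "\<dots> < \<infinity>"
    proof -
      have "(\<integral>\<^sup>+t. ennreal (exp (- (1 * t))) \<partial>M) < \<infinity>"
        by (rule M[unfolded laplace_measure_def, THEN conjunct2, rule_format]) simp
      then show ?thesis by (simp add: ennreal_mult_less_top)
    qed
    finally show ?thesis by simp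
  qed
  moreover have "?A n \<in> sets M" for n
    unfolding laplace_measure_sets[OF M] by (auto simp: sets_restrict_space intro!: image_eqI[of _ _ "?A n"])
  moreover have "(\<Union>n. ?A n) = space M"
    unfolding laplace_measure_space[OF M] using real_arch_simple by auto
  ultimately show "\<exists>A. countable A \<and> A \<subseteq> sets M \<and> \<Union>A = space M \<and> (\<forall>a\<in>A. emeasure M a \<noteq> \<infinity>)"
    by (intro exI[of _ "range ?A"]) auto
qed

text \<open>Away from \<open>0\<close> the weight \<open>exp (- c t)\<close> is dominated by a multiple of
  \<open>exp (- c t / 2) - exp (- c t)\<close>, whose integral against \<open>\<nu> a\<close> tends to \<open>1 - 1 = 0\<close>.\<close>

lemma laplace_approx_identity:
  fixes K :: "real \<Rightarrow> real" and \<nu> :: "real \<Rightarrow> real measure"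
  assumes \<nu>: "\<And>a. 0 < a \<Longrightarrow> laplace_measure (\<nu> a)"
    and lim: "\<And>c. 0 < c \<Longrightarrow> ((\<lambda>a. \<integral>t. exp (- (c * t)) \<partial>\<nu> a) \<longlongrightarrow> 1) (at_right 0)"
    and K[measurable]: "K \<in> borel_measurable borel"
    and bound: "0 < c" "0 \<le> C" "\<And>t. 0 < t \<Longrightarrow> \<bar>K t\<bar> \<le> C * exp (- (c * t))"
    and K0: "(K \<longlongrightarrow> L) (at_right 0)"
  shows "((\<lambda>a. \<integral>t. K t \<partial>\<nu> a) \<longlongrightarrow> L) (at_right 0)"
proof (rule tendstoI)
  fix e :: real assume e: "0 < e"
  let ?A = "\<lambda>c a. \<integral>t. exp (- (c * t)) \<partial>\<nu> a"
  \<comment> \<open>\<open>K\<close> is compared with L exp (- c t) rather than with the constant L,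
    which may fail to be integrable. The factor exp (c t) expresses the error near 0 relative to the
    weight exp (- c t).\<close>
  have "((\<lambda>t. (K t - L * exp (- (c * t))) * exp (c * t)) \<longlongrightarrow> (L - L * exp (- (c * 0))) * exp (c * 0)) (at_right 0)"
    by (intro tendsto_intros K0)
  then have "((\<lambda>t. (K t - L * exp (- (c * t))) * exp (c * t)) \<longlongrightarrow> 0) (at_right 0)"
    by simp
  from tendstoD[OF this, of "e / 2"] e
  have "eventually (\<lambda>t. \<bar>(K t - L * exp (- (c * t))) * exp (c * t)\<bar> < e / 2) (at_right 0)"
    by (simp add: dist_real_def)
  then obtain d where d: "0 < d" "\<And>t. 0 < t \<Longrightarrow> t < d \<Longrightarrow> \<bar>(K t - L * exp (- (c * t))) * exp (c * t)\<bar> < e / 2"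
    unfolding eventually_at_right_field by blast
  \<comment> \<open>For t \<ge> d the difference exp (- c t / 2) - exp (- c t) is at least exp (- c
    t) (exp (c d / 2) - 1). This \<open>B\<close> makes its multiple dominate (C + |L|) exp (- c
    t).\<close>
  define B where "B = (C + \<bar>L\<bar>) / (exp (c / 2 * d) - 1)"
  have den: "0 < exp (c / 2 * d) - 1" using bound(1) d(1) by simp
  have B0: "0 \<le> B" unfolding B_def using den bound(2) by simp
  have pt: "\<bar>K t - L * exp (- (c * t))\<bar> \<le> e / 2 * exp (- (c * t)) + B * (exp (- (c / 2 * t)) - exp (- (c * t)))" if t: "0 < t" for t
  proof (cases "t < d")
    case True
    have "\<bar>K t - L * exp (- (c * t))\<bar> = \<bar>(K t - L * exp (- (c * t))) * exp (c * t)\<bar> * exp (- (c * t))"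
      by (simp add: abs_mult mult.assoc flip: exp_add)
    also have "\<dots> \<le> e / 2 * exp (- (c * t))"
      using d(2)[OF t True] by (intro mult_right_mono) auto
    also have "\<dots> \<le> e / 2 * exp (- (c * t)) + B * (exp (- (c / 2 * t)) - exp (- (c * t)))"
      using B0 bound(1) t by simp
    finally show ?thesis .
  next
    case False
    have "\<bar>K t - L * exp (- (c * t))\<bar> \<le> (C + \<bar>L\<bar>) * exp (- (c * t))"
      using bound(3)[OF t] by (intro order_trans[OF abs_triangle_ineq4]) (simp add: abs_mult distrib_right)
    also have "\<dots> = B * (exp (- (c * t)) * (exp (c / 2 * d) - 1))"
    proof -
      have "B * (exp (c / 2 * d) - 1) = C + \<bar>L\<bar>"
        unfolding B_def using den by (intro nonzero_eq_divide_eq[THEN iffD1]) auto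
      then show ?thesis by (simp only: mult.left_commute[of B] mult.commute)
    qed
    also have "\<dots> \<le> B * (exp (- (c * t)) * (exp (c / 2 * t) - 1))"
      using B0 bound(1) False by (intro mult_left_mono diff_right_mono) auto
    also have "exp (- (c * t)) * (exp (c / 2 * t) - 1) = exp (- (c / 2 * t)) - exp (- (c * t))"
    proof -
      have "exp (- (c * t)) * exp (c / 2 * t) = exp (- (c / 2 * t))"
        unfolding exp_add[symmetric] by (rule arg_cong[where f = exp]) (simp add: field_simps)
      then show ?thesis by (simp only: right_diff_distrib mult_1_right)
    qed
    finally show ?thesis using e by (simp add: add_increasing)
  qed
  \<comment> \<open>The integrated pointwise bound plus the error of replacing L times the transform
    at c by L. Its limit is e/2, which leaves room below e.\<close>
  define U where "U a = e / 2 * ?A c a + B * (?A (c / 2) a - ?A c a) + \<bar>L\<bar> * \<bar>?A c a - 1\<bar>" for a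
  have le: "\<bar>(\<integral>t. K t \<partial>\<nu> a) - L\<bar> \<le> U a" if a: "0 < a" for a
  proof -
    have sp: "space (\<nu> a) = {0<..}" by (rule laplace_measure_space[OF \<nu>[OF a]])
    note i = laplace_measure_integrable[OF \<nu>[OF a]]
    have ci: "integrable (\<nu> a) (\<lambda>t. exp (- (c * t)))" "integrable (\<nu> a) (\<lambda>t. exp (- (c / 2 * t)))"
      by (rule i, use bound(1) in simp)+
    have iK: "integrable (\<nu> a) K"
    proof (rule Bochner_Integration.integrable_bound[OF integrable_mult_right[OF ci(1), of C]])
      show "K \<in> borel_measurable (\<nu> a)" by (rule laplace_measure_measurable[OF \<nu>[OF a] K])
      show "AE t in \<nu> a. norm (K t) \<le> norm (C * exp (- (c * t)))"
        using bound by (intro AE_I2) (auto simp: sp)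
    qed
    have "(\<integral>t. K t \<partial>\<nu> a) - L * ?A c a = (\<integral>t. K t - L * exp (- (c * t)) \<partial>\<nu> a)"
      using iK ci by simp
    also have "\<bar>\<dots>\<bar> \<le> (\<integral>t. e / 2 * exp (- (c * t)) + B * (exp (- (c / 2 * t)) - exp (- (c * t))) \<partial>\<nu> a)"
      unfolding real_norm_def[symmetric]
    proof (rule norm_integral_le)
      show "integrable (\<nu> a) (\<lambda>t. e / 2 * exp (- (c * t)) + B * (exp (- (c / 2 * t)) - exp (- (c * t))))"
        by (intro Bochner_Integration.integrable_add integrable_mult_right Bochner_Integration.integrable_diff ci)
    qed (use pt in \<open>simp add: sp\<close>)
    also have "\<dots> = e / 2 * ?A c a + B * (?A (c / 2) a - ?A c a)"
      by (intro has_bochner_integral_integral_eq has_bochner_integral_add has_bochner_integral_mult_right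
          has_bochner_integral_diff has_bochner_integral_integrable ci)
    finally have "\<bar>(\<integral>t. K t \<partial>\<nu> a) - L * ?A c a\<bar> \<le> e / 2 * ?A c a + B * (?A (c / 2) a - ?A c a)" .
    moreover have "\<bar>L * ?A c a - L\<bar> = \<bar>L\<bar> * \<bar>?A c a - 1\<bar>"
      by (simp add: right_diff_distrib flip: abs_mult)
    ultimately show ?thesis unfolding U_def by linarith
  qed
  have "(U \<longlongrightarrow> e / 2 * 1 + B * (1 - 1) + \<bar>L\<bar> * \<bar>1 - 1\<bar>) (at_right 0)"
    unfolding U_def using bound(1) by (intro tendsto_intros lim) auto
  then have "eventually (\<lambda>a. U a < e) (at_right 0)"
    by (rule order_tendstoD(2)) (use e in simp)
  moreover have "eventually (\<lambda>a. 0 < a) (at_right (0::real))"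
    by (rule eventually_at_right_less)
  ultimately show "eventually (\<lambda>a. dist (\<integral>t. K t \<partial>\<nu> a) L < e) (at_right 0)"
  proof eventually_elim
    case (elim a)
    then show ?case using le[of a] unfolding dist_real_def by linarith
  qed
qed

section \<open>One positive measure: convolution identity, limit and dual expansion\<close>

lemma (in pair_sigma_finite) has_bochner_integral_pair_mult:
  fixes f :: "'a \<Rightarrow> real" and g :: "'b \<Rightarrow> real"
  assumes f: "integrable M1 f" and g: "integrable M2 g"
  shows "has_bochner_integral (M1 \<Otimes>\<^sub>M M2) (\<lambda>p. f (fst p) * g (snd p)) ((\<integral>x. f x \<partial>M1) * (\<integral>y. g y \<partial>M2))"
proof -
  have [measurable]: "f \<in> borel_measurable M1" "g \<in> borel_measurable M2"
    using f g by auto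
  have i: "integrable (M1 \<Otimes>\<^sub>M M2) (\<lambda>p. f (fst p) * g (snd p))"
    using f g by (intro Fubini_integrable) (auto simp: abs_mult)
  then show ?thesis
    using integral_fst'[OF i] by (simp add: has_bochner_integral_iff)
qed

context shifted_lattice
begin

text \<open>Since \<open>E k\<close> is multiplicative, each product of transforms is the integral
  of \<open>E k (s + t)\<close> over the product measure. The assumed summability allows summing
  under that integral and yields \<Theta>.\<close>

lemma gauss_sum_convolution:
  assumes M: "laplace_measure M" and \<nu>: "laplace_measure \<nu>"
    and sum: "integrable (count_space UNIV) (\<lambda>k. (\<integral>t. E k t \<partial>M) * (\<integral>t. E k t \<partial>\<nu>))"
  shows "(\<integral>k. (\<integral>t. E k t \<partial>M) * (\<integral>t. E k t \<partial>\<nu>) \<partial>count_space UNIV)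
       - (LINT t:{0<..<1}|convolution M \<nu>. h t) = (\<integral>t. \<integral>s. G (s + t) \<partial>M \<partial>\<nu>)"
proof -
  interpret M: sigma_finite_measure M by (rule laplace_measure_sigma_finite[OF M])
  interpret N: sigma_finite_measure \<nu> by (rule laplace_measure_sigma_finite[OF \<nu>])
  interpret P: pair_sigma_finite M \<nu> ..
  have iE: "integrable M (E k)" "integrable \<nu> (E k)" for k
    unfolding E_def using shift_nonzero[of k] by (auto intro!: laplace_measure_integrable M \<nu>)
  have [measurable]: "fst \<in> M \<Otimes>\<^sub>M \<nu> \<rightarrow>\<^sub>M borel" "snd \<in> M \<Otimes>\<^sub>M \<nu> \<rightarrow>\<^sub>M borel"
    using measurable_compose[OF measurable_fst laplace_measure_ident[OF M]]
      measurable_compose[OF measurable_snd laplace_measure_ident[OF \<nu>]] by auto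
  let ?P = "M \<Otimes>\<^sub>M \<nu>"
  have E_add: "E k (fst p + snd p) = E k (fst p) * E k (snd p)" for k p
    by (simp add: E_def distrib_left flip: exp_add)
  have b: "has_bochner_integral ?P (\<lambda>p. E k (fst p + snd p)) ((\<integral>t. E k t \<partial>M) * (\<integral>t. E k t \<partial>\<nu>))" for k
    unfolding E_add by (rule P.has_bochner_integral_pair_mult[OF iE])
  have m: "(\<lambda>p. E k (fst p + snd p)) \<in> borel_measurable ?P" for k by measurable
  have fin: "(\<integral>\<^sup>+p. \<integral>\<^sup>+k. ennreal (norm (E k (fst p + snd p))) \<partial>count_space UNIV \<partial>?P) < \<infinity>"
  proof (rule P.integral_count_space_swapI[OF m])
    show "integrable (count_space UNIV) (\<lambda>k. \<integral>p. norm (E k (fst p + snd p)) \<partial>?P)"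
      using sum E_pos has_bochner_integral_integral_eq[OF b] by (simp add: less_imp_le)
  qed (rule integrable.intros[OF b])
  note sw = P.integral_count_space_swap[OF m fin, folded \<Theta>_def]
  obtain C c where C: "0 \<le> C" "0 < c" "\<And>t. 0 < t \<Longrightarrow> \<bar>G t\<bar> \<le> C * exp (- (c * t))"
    using G_bound by blast
  have "integrable ?P (\<lambda>p. exp (- (c * fst p)) * exp (- (c * snd p)))"
    using C(2) by (intro integrable.intros[OF P.has_bochner_integral_pair_mult] laplace_measure_integrable M \<nu>)
  then have iG: "integrable ?P (\<lambda>p. G (fst p + snd p))"
  proof (rule Bochner_Integration.integrable_bound[OF integrable_mult_right[of C]])
    show "AE p in ?P. norm (G (fst p + snd p)) \<le> norm (C * (exp (- (c * fst p)) * exp (- (c * snd p))))"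
    proof (rule AE_I2)
      fix p assume "p \<in> space ?P"
      then have "0 < fst p + snd p"
        by (auto simp: space_pair_measure laplace_measure_space[OF M] laplace_measure_space[OF \<nu>])
      from C(3)[OF this] C(1) show "norm (G (fst p + snd p)) \<le> norm (C * (exp (- (c * fst p)) * exp (- (c * snd p))))"
        by (simp add: distrib_left exp_add[symmetric] abs_mult)
    qed
  qed measurable
  have "(LINT t:{0<..<1}|convolution M \<nu>. h t) = (\<integral>p. indicator {0<..<1} (fst p + snd p) * h (fst p + snd p) \<partial>?P)"
    unfolding convolution_def set_lebesgue_integral_def by (subst integral_distr) (auto simp: case_prod_unfold)
  \<comment> \<open>The \<open>h\<close> term is rewritten as \<Theta> - G, both already known to be
    integrable: \<Theta> by the interchange, \<open>G\<close> by its exponential bound.\<close>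
  also have "\<dots> = (\<integral>p. \<Theta> (fst p + snd p) - G (fst p + snd p) \<partial>?P)"
    by (simp add: G_def)
  also have "\<dots> = (\<integral>p. \<Theta> (fst p + snd p) \<partial>?P) - (\<integral>p. G (fst p + snd p) \<partial>?P)"
    by (rule Bochner_Integration.integral_diff[OF sw(1) iG])
  also have "(\<integral>p. \<Theta> (fst p + snd p) \<partial>?P) = (\<integral>k. (\<integral>t. E k t \<partial>M) * (\<integral>t. E k t \<partial>\<nu>) \<partial>count_space UNIV)"
    unfolding sw(4) has_bochner_integral_integral_eq[OF b] ..
  also have "(\<integral>p. G (fst p + snd p) \<partial>?P) = (\<integral>t. \<integral>s. G (s + t) \<partial>M \<partial>\<nu>)"
    using P.integral_snd[of "\<lambda>s t. G (s + t)"] iG by (simp add: case_prod_unfold)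
  finally show ?thesis by simp
qed

text \<open>The inner integral \<open>K\<close> inherits the exponential bound of \<open>G\<close>
  and has a right limit at 0, so \<open>laplace_approx_identity\<close> applies to it.\<close>

lemma gauss_sum_limit:
  fixes \<nu> :: "real \<Rightarrow> real measure"
  assumes M: "laplace_measure M" and \<nu>: "\<And>a. 0 < a \<Longrightarrow> laplace_measure (\<nu> a)"
    and lim: "\<And>c. 0 < c \<Longrightarrow> ((\<lambda>a. \<integral>t. exp (- (c * t)) \<partial>\<nu> a) \<longlongrightarrow> 1) (at_right 0)"
    and sum: "\<And>a. 0 < a \<Longrightarrow> integrable (count_space UNIV) (\<lambda>k. (\<integral>t. E k t \<partial>M) * (\<integral>t. E k t \<partial>\<nu> a))"
  shows "((\<lambda>a. (\<integral>k. (\<integral>t. E k t \<partial>M) * (\<integral>t. E k t \<partial>\<nu> a) \<partial>count_space UNIV)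
       - (LINT t:{0<..<1}|convolution M (\<nu> a). h t)) \<longlongrightarrow> (\<integral>t. G t \<partial>M)) (at_right 0)"
proof -
  interpret M: sigma_finite_measure M by (rule laplace_measure_sigma_finite[OF M])
  note [measurable] = laplace_measure_ident[OF M]
  have sp: "space M = {0<..}" by (rule laplace_measure_space[OF M])
  obtain C c where C: "0 \<le> C" "0 < c" "\<And>t. 0 < t \<Longrightarrow> \<bar>G t\<bar> \<le> C * exp (- (c * t))"
    using G_bound by blast
  note ie = laplace_measure_integrable[OF M C(2)]
  define K where "K t = (\<integral>s. G (s + t) \<partial>M)" for t
  have "((\<lambda>a. \<integral>t. K t \<partial>\<nu> a) \<longlongrightarrow> (\<integral>t. G t \<partial>M)) (at_right 0)"
  proof (rule laplace_approx_identity[OF \<nu> lim, where c = c and C = "C * (\<integral>s. exp (- (c * s)) \<partial>M)"])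
    show "K \<in> borel_measurable borel" unfolding K_def by measurable
    show "\<bar>K t\<bar> \<le> C * (\<integral>s. exp (- (c * s)) \<partial>M) * exp (- (c * t))" if t: "0 < t" for t
    proof -
      have "\<bar>K t\<bar> \<le> (\<integral>s. C * exp (- (c * t)) * exp (- (c * s)) \<partial>M)"
        unfolding K_def real_norm_def[symmetric]
      proof (rule norm_integral_le)
        fix s assume "s \<in> space M"
        then have "\<bar>G (s + t)\<bar> \<le> C * exp (- (c * (s + t)))" using t by (intro C(3)) (simp add: sp)
        also have "\<dots> = C * exp (- (c * t)) * exp (- (c * s))"
          by (simp add: algebra_simps flip: exp_add)
        finally show "norm (G (s + t)) \<le> C * exp (- (c * t)) * exp (- (c * s))" by simp
      qed (intro integrable_mult_right ie)
      then show ?thesis by (simp add: mult_ac)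
    qed
    \<comment> \<open>Dominated convergence works along sequences; approaching 0 from the right is
      exactly what right continuity of \<open>G\<close> permits.\<close>
    show "(K \<longlongrightarrow> (\<integral>t. G t \<partial>M)) (at_right 0)"
    proof (rule tendsto_at_right_sequentially[of 0 1])
      fix X :: "nat \<Rightarrow> real" assume X: "\<And>n. 0 < X n" "X \<longlonglongrightarrow> 0"
      show "(\<lambda>n. K (X n)) \<longlonglongrightarrow> (\<integral>t. G t \<partial>M)"
        unfolding K_def
      proof (rule integral_dominated_convergence[where w = "\<lambda>s. C * exp (- (c * s))"])
        show "AE s in M. (\<lambda>n. G (s + X n)) \<longlonglongrightarrow> G s"
          by (intro AE_I2 G_right_continuous X) (simp add: sp)
        show "AE s in M. norm (G (s + X n)) \<le> C * exp (- (c * s))" for n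
        proof (rule AE_I2)
          fix s assume s: "s \<in> space M"
          then have "\<bar>G (s + X n)\<bar> \<le> C * exp (- (c * (s + X n)))" using X(1)[of n] by (intro C(3)) (simp add: sp)
          also have "\<dots> \<le> C * exp (- (c * s))"
            using C(1,2) X(1)[of n] by (intro mult_left_mono) auto
          finally show "norm (G (s + X n)) \<le> C * exp (- (c * s))" by simp
        qed
      qed (use ie in \<open>auto intro!: laplace_measure_measurable[OF M]\<close>)
    qed simp
  qed (use C in auto)
  moreover have "eventually (\<lambda>a. (\<integral>t. K t \<partial>\<nu> a) = (\<integral>k. (\<integral>t. E k t \<partial>M) * (\<integral>t. E k t \<partial>\<nu> a) \<partial>count_space UNIV)
       - (LINT t:{0<..<1}|convolution M (\<nu> a). h t)) (at_right 0)"
    using eventually_at_right_less by eventually_elim (use gauss_sum_convolution[OF M \<nu> sum] in \<open>simp add: K_def\<close>)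
  ultimately show ?thesis by (rule Lim_transform_eventually)
qed

text \<open>The integral is split at 1, with the lattice sum used above and the dual sum below. The
  term of the zero vector is set to 0 so that the dual sum still runs over all integer
  vectors.\<close>

lemma integral_G:
  assumes M: "laplace_measure M"
  shows "integrable (count_space UNIV) (\<lambda>k. LINT t:{1..}|M. E k t)"
    and "integrable (count_space UNIV) (\<lambda>m. if m = (\<lambda>_. 0) then 0 else ph m * complex_of_real (LINT t:{0<..<1}|M. D m t))"
    and "complex_of_real (\<integral>t. G t \<partial>M) = complex_of_real (\<integral>k. (LINT t:{1..}|M. E k t) \<partial>count_space UNIV)
      + (\<integral>m. (if m = (\<lambda>_. 0) then 0 else ph m * complex_of_real (LINT t:{0<..<1}|M. D m t)) \<partial>count_space UNIV)"
proof -
  interpret M: sigma_finite_measure M by (rule laplace_measure_sigma_finite[OF M])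
  note [measurable] = laplace_measure_ident[OF M]
  note mm = laplace_measure_measurable[OF M]
  have sp: "space M = {0<..}" by (rule laplace_measure_space[OF M])
  obtain C c where C: "0 \<le> C" "0 < c" "\<And>t. 0 < t \<Longrightarrow> \<bar>G t\<bar> \<le> C * exp (- (c * t))"
    using G_bound by blast
  have Gm: "G \<in> borel_measurable M" by (rule mm) measurable
  have iG: "integrable M G"
    by (rule Bochner_Integration.integrable_bound[OF integrable_mult_right[OF laplace_measure_integrable[OF M C(2)], of C]])
       (use C in \<open>auto simp: sp Gm intro!: AE_I2\<close>)
  \<comment> \<open>On {1..} the functions \<Theta> and \<open>G\<close> coincide, so the bound for
    \<open>G\<close> supplies the absolute convergence of the lattice part.\<close>
  have iG1: "integrable M (\<lambda>t. indicator {1..} t * \<Theta> t)"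
    by (rule Bochner_Integration.integrable_bound[OF iG])
       (auto simp: indicator_def G_def intro!: mm AE_I2)
  have iG0: "integrable M (\<lambda>t. indicator {0<..<1} t * G t)"
    by (rule Bochner_Integration.integrable_bound[OF iG])
       (auto simp: indicator_def intro!: mm AE_I2)
  have split: "(\<integral>t. G t \<partial>M) = (\<integral>t. indicator {1..} t * \<Theta> t \<partial>M) + (\<integral>t. indicator {0<..<1} t * G t \<partial>M)"
  proof -
    have "(\<integral>t. G t \<partial>M) = (\<integral>t. indicator {1..} t * \<Theta> t + indicator {0<..<1} t * G t \<partial>M)"
      by (intro Bochner_Integration.integral_cong) (auto simp: sp indicator_def G_def)
    then show ?thesis using iG1 iG0 by simp
  qed

  let ?f = "\<lambda>k t. indicator {1..} t * E k t"
  have fm: "?f k \<in> borel_measurable M" for k by (rule mm) measurable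
  have "(\<integral>\<^sup>+t. \<integral>\<^sup>+k. ennreal (norm (?f k t)) \<partial>count_space UNIV \<partial>M) = (\<integral>\<^sup>+t. ennreal (indicator {1..} t * \<Theta> t) \<partial>M)"
  proof (rule nn_integral_cong)
    fix t assume "t \<in> space M"
    then have t: "0 < t" by (simp add: sp)
    have "(\<integral>\<^sup>+k. ennreal (norm (?f k t)) \<partial>count_space UNIV) = (\<integral>\<^sup>+k. ennreal (indicator {1..} t * E k t) \<partial>count_space UNIV)"
      using E_pos by (intro nn_integral_cong) (simp add: abs_mult less_imp_le)
    also have "\<dots> = ennreal (\<integral>k. indicator {1..} t * E k t \<partial>count_space UNIV)"
      using E_pos by (intro nn_integral_eq_integral integrable_mult_right integrable_E t) (auto simp: less_imp_le)
    finally show "(\<integral>\<^sup>+k. ennreal (norm (?f k t)) \<partial>count_space UNIV) = ennreal (indicator {1..} t * \<Theta> t)"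
      by (simp add: \<Theta>_def)
  qed
  also have "\<dots> < \<infinity>"
    using integrableD(2)[OF iG1] by (auto simp: less_top real_integrable_def)
  finally have ffin: "(\<integral>\<^sup>+t. \<integral>\<^sup>+k. ennreal (norm (?f k t)) \<partial>count_space UNIV \<partial>M) < \<infinity>" .
  note f = M.integral_count_space_swap[OF fm ffin]
  show "integrable (count_space UNIV) (\<lambda>k. LINT t:{1..}|M. E k t)"
    using f(3) by (simp add: set_lebesgue_integral_def)
  have f4: "(\<integral>t. indicator {1..} t * \<Theta> t \<partial>M) = (\<integral>k. (LINT t:{1..}|M. E k t) \<partial>count_space UNIV)"
    using f(4) by (simp add: set_lebesgue_integral_def \<Theta>_def)

  let ?g = "\<lambda>m t. if m = (\<lambda>_. 0) then 0 else ph m * complex_of_real (indicator {0<..<1} t * D m t)"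
  have gm: "?g m \<in> borel_measurable M" for m by (rule mm) measurable
  obtain K where K: "\<And>t m. 0 < t \<Longrightarrow> t < 1 \<Longrightarrow> m \<noteq> (\<lambda>_. 0) \<Longrightarrow> D m t \<le> K * exp (- ((norm (0 + W *v ivec m))\<^sup>2 * (pi\<^sup>2 / 2)))"
    using D_bound by blast
  let ?w = "\<lambda>m. \<bar>K\<bar> * exp (- ((norm (0 + W *v ivec m))\<^sup>2 * (pi\<^sup>2 / 2)))"
  have w: "integrable (count_space UNIV) ?w"
    by (intro integrable_mult_right integrable_gauss_sum det_W) simp
  \<comment> \<open>The factor exp (1 - t) is at least 1 where \<open>?g\<close> can be nonzero; it
    turns the majorant of \<open>D_bound\<close>, constant in t, into one integrable against
    \<open>M\<close>.\<close>
  have gle: "norm (?g m t) \<le> exp 1 * exp (- (1 * t)) * ?w m" if t: "0 < t" for m t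
  proof (cases "m = (\<lambda>_. 0) \<or> 1 \<le> t")
    case True then show ?thesis by (auto simp: indicator_def)
  next
    case False
    then have "norm (?g m t) = D m t" using t D_nonneg by (simp add: norm_mult)
    also have "\<dots> \<le> K * exp (- ((norm (0 + W *v ivec m))\<^sup>2 * (pi\<^sup>2 / 2)))" using False t by (intro K) auto
    also have "\<dots> \<le> 1 * ?w m" unfolding mult_1_left by (intro mult_right_mono) auto
    also have "1 * ?w m \<le> exp (1 - t) * ?w m" using False by (intro mult_right_mono) auto
    also have "exp (1 - t) = exp 1 * exp (- (1 * t))" by (simp flip: exp_add)
    finally show ?thesis .
  qed
  have "(\<integral>\<^sup>+t. \<integral>\<^sup>+m. ennreal (norm (?g m t)) \<partial>count_space UNIV \<partial>M)
      \<le> (\<integral>\<^sup>+t. \<integral>\<^sup>+m. ennreal (exp 1 * exp (- (1 * t)) * ?w m) \<partial>count_space UNIV \<partial>M)"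
    using gle by (intro nn_integral_mono ennreal_leI) (simp add: sp)
  also have "\<dots> = (\<integral>\<^sup>+t. ennreal (exp 1 * exp (- (1 * t)) * (\<integral>m. ?w m \<partial>count_space UNIV)) \<partial>M)"
    using w by (intro nn_integral_cong) (subst nn_integral_eq_integral, auto)
  also have "\<dots> = ennreal (\<integral>t. exp 1 * exp (- (1 * t)) * (\<integral>m. ?w m \<partial>count_space UNIV) \<partial>M)"
    by (intro nn_integral_eq_integral integrable_mult_left integrable_mult_right laplace_measure_integrable M) auto
  also have "\<dots> < \<infinity>" by simp
  finally have gfin: "(\<integral>\<^sup>+t. \<integral>\<^sup>+m. ennreal (norm (?g m t)) \<partial>count_space UNIV \<partial>M) < \<infinity>" .
  note g = M.integral_count_space_swap[OF gm gfin]
  have gI: "(\<integral>t. ?g m t \<partial>M) = (if m = (\<lambda>_. 0) then 0 else ph m * complex_of_real (LINT t:{0<..<1}|M. D m t))" for m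
    by (cases "m = (\<lambda>_. 0)") (simp, simp only: if_False set_lebesgue_integral_def real_scaleR_def integral_mult_right_zero integral_complex_of_real)
  show "integrable (count_space UNIV) (\<lambda>m. if m = (\<lambda>_. 0) then 0 else ph m * complex_of_real (LINT t:{0<..<1}|M. D m t))"
    using g(3) unfolding gI .
  have "complex_of_real (\<integral>t. indicator {0<..<1} t * G t \<partial>M) = (\<integral>t. complex_of_real (indicator {0<..<1} t * G t) \<partial>M)"
    by (simp only: integral_complex_of_real)
  also have "\<dots> = (\<integral>t. \<integral>m. ?g m t \<partial>count_space UNIV \<partial>M)"
  proof (rule Bochner_Integration.integral_cong[OF refl])
    fix t assume "t \<in> space M"
    then have t: "0 < t" by (simp add: sp)
    show "complex_of_real (indicator {0<..<1} t * G t) = (\<integral>m. ?g m t \<partial>count_space UNIV)"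
    proof (cases "t < 1")
      case True
      with t have ind: "indicator {0<..<1} t = (1::real)" by simp
      show ?thesis unfolding ind mult_1_left by (rule G_dual[OF t True])
    next
      case False
      then have "?g m t = 0" for m by simp
      then show ?thesis using False by simp
    qed
  qed
  also have "\<dots> = (\<integral>m. \<integral>t. ?g m t \<partial>M \<partial>count_space UNIV)" by (rule g(4))
  finally show "complex_of_real (\<integral>t. G t \<partial>M) = complex_of_real (\<integral>k. (LINT t:{1..}|M. E k t) \<partial>count_space UNIV)
      + (\<integral>m. (if m = (\<lambda>_. 0) then 0 else ph m * complex_of_real (LINT t:{0<..<1}|M. D m t)) \<partial>count_space UNIV)"
    unfolding split f4[symmetric] gI by simp
qed

end

section \<open>The periodic energy\<close>

lemma infsum_eq_integral_count_space:
  fixes f :: "'a \<Rightarrow> 'b::{banach, second_countable_topology}"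
  assumes "integrable (count_space A) f"
  shows "infsum f A = (\<integral>x. f x \<partial>count_space A)"
  using infsetsum_infsum[of f A] assms by (simp add: abs_summable_on_def infsetsum_def)

lemma gauss_transform_laplace:
  assumes "laplace_measure M" "z \<noteq> 0"
  shows "gauss_transform M z = ennreal (\<integral>t. exp (- ((norm z)\<^sup>2 * t)) \<partial>M)"
  unfolding gauss_transform_def using assms
  by (intro nn_integral_eq_integral laplace_measure_integrable) auto

text \<open>Every c > 0 is the squared norm of some vector, so finiteness of the Gaussian transform
  off 0 covers all rates.\<close>

lemma laplace_measureI:
  assumes "sets M = sets half_line" and fin: "\<And>z :: real^'n. z \<noteq> 0 \<Longrightarrow> gauss_transform M z < \<infinity>"
  shows "laplace_measure M"
  unfolding laplace_measure_def
proof (intro conjI allI impI)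
  fix c :: real assume c: "0 < c"
  obtain z :: "real^'n" where z: "norm z = sqrt c"
    using vector_choose_size[of "sqrt c"] c by auto
  then have "z \<noteq> 0" using c by auto
  from fin[OF this] show "(\<integral>\<^sup>+t. ennreal (exp (- (c * t))) \<partial>M) < \<infinity>"
    using c by (simp add: gauss_transform_def z)
qed fact

text \<open>The negative part has finite mass, hence a finite transform. An infinite transform of
  the positive part would then force f z = \<infinity> at some z \<noteq> 0.\<close>

lemma G_type_laplace:
  fixes f :: "real^'n \<Rightarrow> ereal"
  assumes f: "G_type f \<mu>"
  shows "laplace_measure (pos_part half_line \<mu>)" "laplace_measure (neg_part half_line \<mu>)"
proof -
  let ?P = "pos_part half_line \<mu>" and ?N = "neg_part half_line \<mu>"
  have N: "gauss_transform ?N z < \<infinity>" for z :: "real^'n"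
  proof -
    have "gauss_transform ?N z \<le> (\<integral>\<^sup>+t. 1 \<partial>?N)"
      unfolding gauss_transform_def by (intro nn_integral_mono) (auto simp: space_restrict_space)
    also have "\<dots> = emeasure ?N {0<..}" by (simp add: space_restrict_space)
    also have "\<dots> < \<infinity>" using f by (simp add: G_type_def)
    finally show ?thesis .
  qed
  have P: "gauss_transform ?P z < \<infinity>" if "z \<noteq> 0" for z :: "real^'n"
  proof (rule ccontr)
    assume "\<not> gauss_transform ?P z < \<infinity>"
    then have "enn2ereal (gauss_transform ?P z) = \<infinity>" by (simp add: less_top[symmetric] top_ennreal.rep_eq top_ereal_def)
    moreover have "f z < \<infinity>" "f z = enn2ereal (gauss_transform ?P z) - enn2ereal (gauss_transform ?N z)"
      using f that by (auto simp: G_type_def)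
    moreover have "enn2ereal (gauss_transform ?N z) \<noteq> \<infinity>"
      using N[of z] by (cases "gauss_transform ?N z") auto
    ultimately show False by (cases "enn2ereal (gauss_transform ?N z)") auto
  qed
  show "laplace_measure ?P" by (rule laplace_measureI[OF _ P]) auto
  show "laplace_measure ?N" by (rule laplace_measureI[OF _ N]) auto
qed

context shifted_lattice
begin

lemma infsum_lattice: "(\<Sum>\<^sub>\<infinity>v\<in>lattice_of V. F v) = (\<Sum>\<^sub>\<infinity>k. F (V *v ivec k))"
  unfolding lattice_eq infsum_reindex[OF inj_lattice] by (simp add: o_def)

lemma gauss_transform_shift:
  assumes "laplace_measure M"
  shows "gauss_transform M (q + V *v ivec k) = ennreal (\<integral>t. E k t \<partial>M)"
  using gauss_transform_laplace[OF assms shift_nonzero] by (simp add: E_def)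

text \<open>Identifies the kernel with the limit found by \<open>gauss_sum_limit\<close> for the two
  parts; in particular its value is real.\<close>

lemma periodic_kernel_eq:
  assumes P: "laplace_measure (pos_part half_line \<mu>)" and N: "laplace_measure (neg_part half_line \<mu>)"
    and xy: "x - y = q"
  shows "periodic_kernel V \<mu> x y
    = complex_of_real ((\<integral>t. G t \<partial>pos_part half_line \<mu>) - (\<integral>t. G t \<partial>neg_part half_line \<mu>))"
proof -
  let ?P = "pos_part half_line \<mu>" and ?N = "neg_part half_line \<mu>"
  let ?e = "\<lambda>M k. LINT t:{1..}|M. E k t"
  let ?d = "\<lambda>M m. if m = (\<lambda>_. 0) then 0 else ph m * complex_of_real (LINT t:{0<..<1}|M. D m t)"
  note IP = integral_G[OF P] and IN = integral_G[OF N]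
  have "(\<Sum>\<^sub>\<infinity>v\<in>lattice_of V. signed_lint half_line \<mu> {1..} (\<lambda>t. exp (- ((norm (x - y + v))\<^sup>2 * t))))
      = (\<Sum>\<^sub>\<infinity>k. ?e ?P k - ?e ?N k)"
    unfolding infsum_lattice xy signed_lint_def E_def[symmetric] ..
  also have "\<dots> = (\<integral>k. ?e ?P k \<partial>count_space UNIV) - (\<integral>k. ?e ?N k \<partial>count_space UNIV)"
    using IP(1) IN(1) by (simp add: infsum_eq_integral_count_space)
  finally have 1: "(\<Sum>\<^sub>\<infinity>v\<in>lattice_of V. signed_lint half_line \<mu> {1..} (\<lambda>t. exp (- ((norm (x - y + v))\<^sup>2 * t))))
      = (\<integral>k. ?e ?P k \<partial>count_space UNIV) - (\<integral>k. ?e ?N k \<partial>count_space UNIV)" .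
  let ?F = "\<lambda>w. exp (2 * of_real pi * \<i> * of_real (w \<bullet> (x - y))) *
          complex_of_real (signed_lint half_line \<mu> {0<..<1}
            (\<lambda>t. pi powr (CARD('n) / 2) / t powr (CARD('n) / 2) * exp (- (pi\<^sup>2 * (norm w)\<^sup>2 / t))))"
  have "dual_lattice V - {0} = (\<lambda>m. W *v ivec m) ` (UNIV - {\<lambda>_. 0})"
  proof -
    have "W *v ivec m = 0 \<longleftrightarrow> m = (\<lambda>_. 0)" for m
      using inj_eq[OF inj_dual, of m "\<lambda>_. 0"] by simp
    then show ?thesis unfolding dual_lattice_eq by auto
  qed
  then have "infsum ?F (dual_lattice V - {0}) = infsum (?F \<circ> (\<lambda>m. W *v ivec m)) (UNIV - {\<lambda>_. 0})"
    by (simp only: infsum_reindex[OF inj_on_subset[OF inj_dual subset_UNIV]])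
  \<comment> \<open>The excluded index 0 is put back with value 0, since the sums in
    \<open>integral_G\<close> run over all integer vectors.\<close>
  also have "\<dots> = (\<Sum>\<^sub>\<infinity>m. ?d ?P m - ?d ?N m)"
  proof (rule infsum_cong_neutral)
    fix m assume "m \<in> (UNIV - {\<lambda>_. 0}) \<inter> (UNIV :: ('n \<Rightarrow> int) set)"
    then have m: "m \<noteq> (\<lambda>_. 0)" by simp
    have ph: "exp (2 * of_real pi * \<i> * of_real ((W *v ivec m) \<bullet> (x - y))) = ph m"
      by (simp add: ph_def cis_conv_exp xy mult_ac)
    show "(?F \<circ> (\<lambda>m. W *v ivec m)) m = ?d ?P m - ?d ?N m"
      unfolding o_def ph signed_lint_def h_def[symmetric] D_def[symmetric]
      using m by (simp add: right_diff_distrib)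
  qed auto
  also have "\<dots> = (\<integral>m. ?d ?P m \<partial>count_space UNIV) - (\<integral>m. ?d ?N m \<partial>count_space UNIV)"
    using infsum_eq_integral_count_space[OF Bochner_Integration.integrable_diff[OF IP(2) IN(2)]]
      Bochner_Integration.integral_diff[OF IP(2) IN(2)] by simp
  finally have 2: "infsum ?F (dual_lattice V - {0}) = (\<integral>m. ?d ?P m \<partial>count_space UNIV) - (\<integral>m. ?d ?N m \<partial>count_space UNIV)" .
  show ?thesis
    unfolding periodic_kernel_def 1 2 of_real_diff IP(3) IN(3) by simp
qed

text \<open>The limit is taken for the positive and the negative part separately and subtracted. At
  the shifted lattice points all values of \<open>f\<close> and \<open>g a\<close> are finite, so
  the extended products are ordinary ones.\<close>

lemma pair_energy_tendsto:
  fixes \<nu> :: "real \<Rightarrow> real measure"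
  assumes f: "G_type f \<mu>" and \<nu>: "\<And>a. 0 < a \<Longrightarrow> laplace_measure (\<nu> a)"
    and lim: "\<And>c. 0 < c \<Longrightarrow> ((\<lambda>a. \<integral>t. exp (- (c * t)) \<partial>\<nu> a) \<longlongrightarrow> 1) (at_right 0)"
    and g: "\<And>a z. 0 < a \<Longrightarrow> z \<noteq> 0 \<Longrightarrow> g a z = enn2ereal (gauss_transform (\<nu> a) z)"
    and sumP: "\<And>a. 0 < a \<Longrightarrow> Infinite_Sum.abs_summable_on
           (\<lambda>v. enn2real (gauss_transform (pos_part half_line \<mu>) (q + v)) * real_of_ereal (g a (q + v))) (lattice_of V)"
    and sumN: "\<And>a. 0 < a \<Longrightarrow> Infinite_Sum.abs_summable_on
           (\<lambda>v. enn2real (gauss_transform (neg_part half_line \<mu>) (q + v)) * real_of_ereal (g a (q + v))) (lattice_of V)"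
  shows "((\<lambda>a. (\<Sum>\<^sub>\<infinity>v\<in>lattice_of V. real_of_ereal (f (q + v) * g a (q + v)))
        - signed_conv_lint half_line \<mu> (\<nu> a) {0<..<1} (\<lambda>t. pi powr (CARD('n) / 2) / t powr (CARD('n) / 2)))
      \<longlongrightarrow> (\<integral>t. G t \<partial>pos_part half_line \<mu>) - (\<integral>t. G t \<partial>neg_part half_line \<mu>)) (at_right 0)"
proof -
  let ?P = "pos_part half_line \<mu>" and ?N = "neg_part half_line \<mu>"
  note P = G_type_laplace(1)[OF f] and N = G_type_laplace(2)[OF f]
  let ?I = "\<lambda>M k. \<integral>t. E k t \<partial>M"
  have I0: "0 \<le> ?I M k" for M :: "real measure" and k
    using E_pos by (simp add: less_imp_le)
  have g_eq: "g a (q + V *v ivec k) = ereal (?I (\<nu> a) k)" if "0 < a" for a k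
    using g[OF that shift_nonzero] gauss_transform_shift[OF \<nu>[OF that]] I0[of "\<nu> a" k] by (simp add: enn2ereal_ennreal)
  have f_eq: "f (q + V *v ivec k) = ereal (?I ?P k - ?I ?N k)" for k
  proof -
    have "f (q + V *v ivec k) = enn2ereal (gauss_transform ?P (q + V *v ivec k)) - enn2ereal (gauss_transform ?N (q + V *v ivec k))"
      using f shift_nonzero[of k] by (simp add: G_type_def)
    then show ?thesis
      using I0[of ?P k] I0[of ?N k] by (simp add: gauss_transform_shift P N enn2ereal_ennreal)
  qed
  have sum: "integrable (count_space UNIV) (\<lambda>k. ?I M k * ?I (\<nu> a) k)"
    if M: "laplace_measure M" and a: "0 < a"
      and s: "Infinite_Sum.abs_summable_on (\<lambda>v. enn2real (gauss_transform M (q + v)) * real_of_ereal (g a (q + v))) (lattice_of V)"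
    for M a
  proof -
    have "Infinite_Sum.abs_summable_on (\<lambda>k. ?I M k * ?I (\<nu> a) k) UNIV"
      using s unfolding lattice_eq summable_on_reindex[OF inj_lattice] o_def gauss_transform_shift[OF M] g_eq[OF a]
      by (simp add: I0)
    then show ?thesis by (simp only: abs_summable_equivalent abs_summable_on_def)
  qed
  have sP: "integrable (count_space UNIV) (\<lambda>k. ?I ?P k * ?I (\<nu> a) k)"
    and sN: "integrable (count_space UNIV) (\<lambda>k. ?I ?N k * ?I (\<nu> a) k)" if "0 < a" for a
    by (rule sum[OF P that sumP[OF that]], rule sum[OF N that sumN[OF that]])
  have "((\<lambda>a. ((\<integral>k. ?I ?P k * ?I (\<nu> a) k \<partial>count_space UNIV) - (LINT t:{0<..<1}|convolution ?P (\<nu> a). h t))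
          - ((\<integral>k. ?I ?N k * ?I (\<nu> a) k \<partial>count_space UNIV) - (LINT t:{0<..<1}|convolution ?N (\<nu> a). h t)))
      \<longlongrightarrow> (\<integral>t. G t \<partial>?P) - (\<integral>t. G t \<partial>?N)) (at_right 0)"
    by (rule tendsto_diff[OF gauss_sum_limit[OF P \<nu> lim sP] gauss_sum_limit[OF N \<nu> lim sN]])
  moreover have "eventually (\<lambda>a. ((\<integral>k. ?I ?P k * ?I (\<nu> a) k \<partial>count_space UNIV) - (LINT t:{0<..<1}|convolution ?P (\<nu> a). h t))
          - ((\<integral>k. ?I ?N k * ?I (\<nu> a) k \<partial>count_space UNIV) - (LINT t:{0<..<1}|convolution ?N (\<nu> a). h t))
      = (\<Sum>\<^sub>\<infinity>v\<in>lattice_of V. real_of_ereal (f (q + v) * g a (q + v)))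
        - signed_conv_lint half_line \<mu> (\<nu> a) {0<..<1} (\<lambda>t. pi powr (CARD('n) / 2) / t powr (CARD('n) / 2))) (at_right 0)"
    using eventually_at_right_less
  proof eventually_elim
    case (elim a)
    have "(\<Sum>\<^sub>\<infinity>v\<in>lattice_of V. real_of_ereal (f (q + v) * g a (q + v)))
        = (\<Sum>\<^sub>\<infinity>k. ?I ?P k * ?I (\<nu> a) k - ?I ?N k * ?I (\<nu> a) k)"
      unfolding infsum_lattice f_eq g_eq[OF elim] by (simp add: left_diff_distrib)
    also have "\<dots> = (\<integral>k. ?I ?P k * ?I (\<nu> a) k \<partial>count_space UNIV) - (\<integral>k. ?I ?N k * ?I (\<nu> a) k \<partial>count_space UNIV)"
      using sP[OF elim] sN[OF elim] by (simp add: infsum_eq_integral_count_space)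
    finally show ?case
      unfolding signed_conv_lint_def h_def[symmetric] by simp
  qed
  ultimately show ?thesis by (rule Lim_transform_eventually)
qed

end

theorem theorem4p1:
  fixes V :: "real ^ 'n ^ 'n"
    and f :: "real ^ 'n \<Rightarrow> ereal" and \<mu>f :: "real set \<Rightarrow> ereal"
    and g :: "real \<Rightarrow> real ^ 'n \<Rightarrow> ereal" and \<mu>g :: "real \<Rightarrow> real measure"
    and N :: nat and x :: "nat \<Rightarrow> real ^ 'n"
  assumes V: "independent (columns V)" "det V = 1"
    and CF1: "G_type f \<mu>f"
    and CF2: "\<And>a. a > 0 \<Longrightarrow> sets (\<mu>g a) = sets half_line"
      "\<And>a z. a > 0 \<Longrightarrow> z \<noteq> 0 \<Longrightarrow> \<bar>g a z\<bar> \<noteq> \<infinity> \<and> g a z = enn2ereal (gauss_transform (\<mu>g a) z)"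
    and CF3:
      "\<And>a q. a > 0 \<Longrightarrow> q \<notin> lattice_of V \<Longrightarrow>
         Infinite_Sum.abs_summable_on
           (\<lambda>v. enn2real (gauss_transform (pos_part half_line \<mu>f) (q + v)) * real_of_ereal (g a (q + v)))
           (lattice_of V)"
      "\<And>a q. a > 0 \<Longrightarrow> q \<notin> lattice_of V \<Longrightarrow>
         Infinite_Sum.abs_summable_on
           (\<lambda>v. enn2real (gauss_transform (neg_part half_line \<mu>f) (q + v)) * real_of_ereal (g a (q + v)))
           (lattice_of V)"
    and CF4: "\<And>z. z \<noteq> 0 \<Longrightarrow> ((\<lambda>a. g a z) \<longlongrightarrow> 1) (at_right 0)"
    and nondegenerate: "\<And>i j. i \<in> {1..N} \<Longrightarrow> j \<in> {1..N} \<Longrightarrow> i \<noteq> j \<Longrightarrow> x i - x j \<notin> lattice_of V"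
  shows "\<exists>E :: real.
    ((\<lambda>a. regularized_energy V f \<mu>f (g a) (\<mu>g a) N x) \<longlongrightarrow> E) (at_right 0) \<and>
    periodic_energy V f \<mu>f g \<mu>g N x = ereal E \<and>
    complex_of_real E = (\<Sum>k=1..N. \<Sum>j\<in>{1..N} - {k}. periodic_kernel V \<mu>f (x k) (x j))"
proof -
  have \<nu>: "laplace_measure (\<mu>g a)" if a: "0 < a" for a
  proof (rule laplace_measureI[OF CF2(1)[OF a]])
    fix z :: "real^'n" assume "z \<noteq> 0"
    then show "gauss_transform (\<mu>g a) z < \<infinity>"
      using CF2(2)[OF a, of z] by (cases "gauss_transform (\<mu>g a) z") (auto simp: top_ennreal.rep_eq top_ereal_def)
  qed
  \<comment> \<open>(CF4) at a vector of squared norm c is convergence of the Laplace transforms at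
    c.\<close>
  have lim: "((\<lambda>a. \<integral>t. exp (- (c * t)) \<partial>\<mu>g a) \<longlongrightarrow> 1) (at_right 0)" if c: "0 < c" for c
  proof -
    obtain z :: "real^'n" where z: "norm z = sqrt c"
      using vector_choose_size[of "sqrt c"] c by auto
    then have z0: "z \<noteq> 0" using c by auto
    have "eventually (\<lambda>a. g a z = ereal (\<integral>t. exp (- (c * t)) \<partial>\<mu>g a)) (at_right 0)"
      using eventually_at_right_less
    proof eventually_elim
      case (elim a)
      then show ?case
        using CF2(2)[OF elim z0] gauss_transform_laplace[OF \<nu>[OF elim] z0] c by (simp add: z enn2ereal_ennreal)
    qed
    from Lim_transform_eventually[OF CF4[OF z0] this] show ?thesis
      by (simp only: lim_ereal one_ereal_def)
  qed
  define L where "L k j = (\<integral>t. shifted_lattice.G V (x k - x j) t \<partial>pos_part half_line \<mu>f)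
      - (\<integral>t. shifted_lattice.G V (x k - x j) t \<partial>neg_part half_line \<mu>f)" for k j
  define L' where "L' = (\<Sum>k=1..N. \<Sum>j\<in>{1..N} - {k}. L k j)"
  have sl: "shifted_lattice V (x k - x j)" if "k \<in> {1..N}" "j \<in> {1..N} - {k}" for k j
    using V(2) nondegenerate[of k j] that by unfold_locales auto
  have t: "((\<lambda>a. regularized_energy V f \<mu>f (g a) (\<mu>g a) N x) \<longlongrightarrow> L') (at_right 0)"
    unfolding regularized_energy_def L'_def
  proof (intro tendsto_sum)
    fix k j assume kj: "k \<in> {1..N}" "j \<in> {1..N} - {k}"
    interpret shifted_lattice V "x k - x j" by (rule sl[OF kj])
    show "((\<lambda>a. (\<Sum>\<^sub>\<infinity>v\<in>lattice_of V. real_of_ereal (f (x k - x j + v) * g a (x k - x j + v)))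
        - signed_conv_lint half_line \<mu>f (\<mu>g a) {0<..<1} (\<lambda>t. pi powr (CARD('n) / 2) / t powr (CARD('n) / 2)))
      \<longlongrightarrow> L k j) (at_right 0)"
      unfolding L_def using CF2(2) CF3 q_notin
      by (intro pair_energy_tendsto CF1 \<nu> lim) auto
  qed
  \<comment> \<open>A limit along a nontrivial filter is also the limit superior.\<close>
  have "periodic_energy V f \<mu>f g \<mu>g N x = ereal L'"
    unfolding periodic_energy_def using t by (intro lim_imp_Limsup) auto
  moreover have "complex_of_real L' = (\<Sum>k=1..N. \<Sum>j\<in>{1..N} - {k}. periodic_kernel V \<mu>f (x k) (x j))"
    unfolding L'_def of_real_sum
  proof (intro sum.cong refl)
    fix k j assume kj: "k \<in> {1..N}" "j \<in> {1..N} - {k}"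
    interpret shifted_lattice V "x k - x j" by (rule sl[OF kj])
    show "complex_of_real (L k j) = periodic_kernel V \<mu>f (x k) (x j)"
      unfolding L_def using periodic_kernel_eq[OF G_type_laplace[OF CF1] refl] ..
  qed
  ultimately show ?thesis using t by blast
qed

end
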